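(* Let $\mathbf{k}$ be a commutative ring and $\mathcal{A}$ a base category over $\mathbf{k}$. Stratified linear categories over $\mathcal{A}$ are in one-to-one correspondence, up to isomorphism, with twisted tensor products of a strongly upward monoid and a strongly downward monoid in $\mathcal{A}\text{-bim}$. (The correspondence sends a stratified linear category $\mathcal{C}$ to the triple $(\mathcal{C}^+,\mathcal{C}^-,\tau)$, where $\tau(g\otimes f)$ is the element of $\mathcal{C}^+\otimes_{\mathcal{A}}\mathcal{C}^-$ corresponding to the composite $gf\in\mathcal{C}$, and in the other direction a triple $(\mathcal{C}^+,\mathcal{C}^-,\tau)$ to its twisted tensor product $\mathcal{C}_\tau=\mathcal{C}^+\otimes_\tau\mathcal{C}^-$.)
   Context: All categories and functors are $\mathbf{k}$-linear. **Base category.** A linear category $\mathcal{A}$ whose object set carries a partial order $\le$ satisfying the descending chain condition, with $\mathcal{A}(x,y)=0$ for $x\ne y$; $\mathcal{A}_x=\mathcal{A}(x,x)$. An $\mathcal{A}$-bimodule $M$ is a family of $(\mathcal{A}_y,\mathcal{A}_x)$-bimodules $M(x,y)$; morphisms are families of bimodule maps. $\mathcal{A}\text{-bim}$ is monoidal with $(M\otimes_{\mathcal{A}}N)(x,y)=\bigoplus_zM(z,y)\otimes_{\mathcal{A}_z}N(x,z)$ and unit $\mathcal{A}$ (treated as strict). **Stratified linear category over $\mathcal{A}$.** A linear category $\mathcal{C}$ with $\mathrm{Ob}(\mathcal{C})=\mathrm{Ob}(\mathcal{A})$, a linear functor $i:\mathcal{A}\to\mathcal{C}$ that is the identity on objects,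 and wide linear subcategories $\mathcal{C}^\pm$ such that: $\mathcal{C}^+(x,y)=0$ unless $x\le y$, $\mathcal{C}^-(x,y)=0$ unless $x\ge y$; $\mathcal{C}^+(x,x)=\mathcal{C}^-(x,x)$; $i$ maps $\mathcal{A}_x$ isomorphically onto $\mathcal{C}^\pm(x,x)$; and composition induces isomorphisms $\bigoplus_y\mathcal{C}^+(y,z)\otimes_{\mathcal{A}_y}\mathcal{C}^-(x,y)\to\mathcal{C}(x,z)$. A morphism $\mathcal{C}\to\mathcal{D}$ of stratified linear categories over $\mathcal{A}$ is a linear functor $F$ with $F\circ i_{\mathcal{C}}=i_{\mathcal{D}}$ and $F(\mathcal{C}^\pm(x,y))\subset\mathcal{D}^\pm(x,y)$; isomorphisms are invertible morphisms. **Strongly upward/downward monoids.** A monoid $(\mathcal{D},\mu,\eta)$ in $\mathcal{A}\text{-bim}$ is strongly upward (resp. strongly downward) if $\mathcal{D}(x,y)=0$ unless $x\le y$ (resp. $x\ge y$) and $\eta_x:\mathcal{A}_x\to\mathcal{D}(x,x)$ is an isomorphism for every $x$. Monoids in $\mathcal{A}\text{-bim}$ are the same as linear categories over $\mathcal{A}$ (linear categories with object set $\mathrm{Ob}(\mathcal{A})$ and an identity-on-objects linear functor from $\mathcal{A}$). **Twisted tensor products.** For a strongly upward monoid $\mathcal{C}^+$ and a strongly downward monoid $\mathcal{C}^-$, a twist is a morphism $\tau:\mathcal{C}^-\otimes_{\mathcal{A}}\mathcal{C}^+\to\mathcal{C}^+\otimes_{\mathcal{A}}\mathcal{C}^-$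 in $\mathcal{A}\text{-bim}$ with (writing an object for its identity) $\tau(\mu^-\otimes\mathcal{C}^+)=(\mathcal{C}^+\otimes\mu^-)(\tau\otimes\mathcal{C}^-)(\mathcal{C}^-\otimes\tau)$, $\tau(\eta^-\otimes\mathcal{C}^+)=\mathcal{C}^+\otimes\eta^-$, $\tau(\mathcal{C}^-\otimes\mu^+)=(\mu^+\otimes\mathcal{C}^-)(\mathcal{C}^+\otimes\tau)(\tau\otimes\mathcal{C}^+)$, $\tau(\mathcal{C}^-\otimes\eta^+)=\eta^+\otimes\mathcal{C}^-$. The twisted tensor product $\mathcal{C}_\tau$ is the monoid $\mathcal{C}^+\otimes_{\mathcal{A}}\mathcal{C}^-$ with multiplication $(\mu^+\otimes\mu^-)(\mathcal{C}^+\otimes\tau\otimes\mathcal{C}^-)$ and unit $\eta^+\otimes\eta^-$; it contains $\mathcal{C}^+$ and $\mathcal{C}^-$ via $f\mapsto f\otimes\mathrm{id}$ and $g\mapsto\mathrm{id}\otimes g$. A twisted tensor product is understood as the datum of the triple $(\mathcal{C}^+,\mathcal{C}^-,\tau)$; an isomorphism $(\mathcal{C}^+,\mathcal{C}^-,\tau)\to(\mathcal{D}^+,\mathcal{D}^-,\tau')$ is a pair of monoid isomorphisms $f^\pm:\mathcal{C}^\pm\to\mathcal{D}^\pm$ with $(f^+\otimes f^-)\tau=\tau'(f^-\otimes f^+)$. *)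

theory Defs
  imports "HOL-Algebra.Module" "HOL-Algebra.AbelCoset"
begin

section \<open>Modules over the ground ring\<close>

definition linear_map ::
  "('k, 'r) ring_scheme \<Rightarrow> ('k, 'a, 's) module_scheme \<Rightarrow> ('k, 'b, 't) module_scheme \<Rightarrow> ('a \<Rightarrow> 'b) \<Rightarrow> bool" where
  "linear_map R M N f \<longleftrightarrow>
     f \<in> carrier M \<rightarrow> carrier N \<and>
     (\<forall>u\<in>carrier M. \<forall>v\<in>carrier M. f (u \<oplus>\<^bsub>M\<^esub> v) = f u \<oplus>\<^bsub>N\<^esub> f v) \<and>
     (\<forall>r\<in>carrier R. \<forall>u\<in>carrier M. f (r \<odot>\<^bsub>M\<^esub> u) = r \<odot>\<^bsub>N\<^esub> f u)"

text \<open>The multiplicative fields of the records below are irrelevant: only the module structure is used.\<close>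

definition free_module :: "('k, 'r) ring_scheme \<Rightarrow> 's set \<Rightarrow> ('k, 's \<Rightarrow> 'k) module" where
  "free_module R S =
     \<lparr>carrier = {f. (\<forall>s\<in>S. f s \<in> carrier R) \<and> (\<forall>s. s \<notin> S \<longrightarrow> f s = \<zero>\<^bsub>R\<^esub>) \<and> finite {s. f s \<noteq> \<zero>\<^bsub>R\<^esub>}},
      monoid.mult = undefined, one = undefined,
      zero = (\<lambda>s. \<zero>\<^bsub>R\<^esub>),
      add = (\<lambda>f g s. f s \<oplus>\<^bsub>R\<^esub> g s),
      smult = (\<lambda>r f s. r \<otimes>\<^bsub>R\<^esub> f s)\<rparr>"

definition basis_vec :: "('k, 'r) ring_scheme \<Rightarrow> 's \<Rightarrow> 's \<Rightarrow> 'k" where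
  "basis_vec R s = (\<lambda>t. if t = s then \<one>\<^bsub>R\<^esub> else \<zero>\<^bsub>R\<^esub>)"

definition submodule_span :: "('k, 'r) ring_scheme \<Rightarrow> ('k, 'a, 's) module_scheme \<Rightarrow> 'a set \<Rightarrow> 'a set" where
  "submodule_span R M X = \<Inter>{H. submodule H R M \<and> X \<subseteq> H}"

definition quot_module :: "('k, 'a, 's) module_scheme \<Rightarrow> 'a set \<Rightarrow> ('k, 'a set) module" where
  "quot_module M H =
     \<lparr>carrier = a_rcosets\<^bsub>M\<^esub> H,
      monoid.mult = undefined, one = undefined,
      zero = H,
      add = (\<lambda>X Y. X <+>\<^bsub>M\<^esub> Y),
      smult = (\<lambda>r X. \<Union>f\<in>X. H +>\<^bsub>M\<^esub> (r \<odot>\<^bsub>M\<^esub> f))\<rparr>"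

definition direct_sum_module :: "'i set \<Rightarrow> ('i \<Rightarrow> ('k, 'a, 's) module_scheme) \<Rightarrow> ('k, 'i \<Rightarrow> 'a) module" where
  "direct_sum_module I M =
     \<lparr>carrier = {t \<in> (\<Pi>\<^sub>E i\<in>I. carrier (M i)). finite {i\<in>I. t i \<noteq> \<zero>\<^bsub>M i\<^esub>}},
      monoid.mult = undefined, one = undefined,
      zero = (\<lambda>i\<in>I. \<zero>\<^bsub>M i\<^esub>),
      add = (\<lambda>t u. \<lambda>i\<in>I. t i \<oplus>\<^bsub>M i\<^esub> u i),
      smult = (\<lambda>r t. \<lambda>i\<in>I. r \<odot>\<^bsub>M i\<^esub> t i)\<rparr>"

subsection \<open>Tensor product over a noncommutative algebra\<close>

text \<open>
  \<open>B\<close> is the underlying set of an \<open>R\<close>-algebra acting on \<open>M\<close> from the right by \<open>ra\<close> and on \<open>N\<close>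
  from the left by \<open>la\<close>.
\<close>

definition tensor_rels ::
  "('k, 'r) ring_scheme \<Rightarrow> 'b set \<Rightarrow> ('k, 'm, 's) module_scheme \<Rightarrow> ('m \<Rightarrow> 'b \<Rightarrow> 'm) \<Rightarrow>
   ('k, 'n, 't) module_scheme \<Rightarrow> ('b \<Rightarrow> 'n \<Rightarrow> 'n) \<Rightarrow> ('m \<times> 'n \<Rightarrow> 'k) set" where
  "tensor_rels R B M ra N la =
     (let F = free_module R (carrier M \<times> carrier N); e = (\<lambda>m n. basis_vec R (m, n)) in
       {e (m \<oplus>\<^bsub>M\<^esub> m') n \<ominus>\<^bsub>F\<^esub> (e m n \<oplus>\<^bsub>F\<^esub> e m' n) | m m' n.
          m \<in> carrier M \<and> m' \<in> carrier M \<and> n \<in> carrier N} \<union>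
       {e m (n \<oplus>\<^bsub>N\<^esub> n') \<ominus>\<^bsub>F\<^esub> (e m n \<oplus>\<^bsub>F\<^esub> e m n') | m n n'.
          m \<in> carrier M \<and> n \<in> carrier N \<and> n' \<in> carrier N} \<union>
       {e (r \<odot>\<^bsub>M\<^esub> m) n \<ominus>\<^bsub>F\<^esub> (r \<odot>\<^bsub>F\<^esub> e m n) | r m n.
          r \<in> carrier R \<and> m \<in> carrier M \<and> n \<in> carrier N} \<union>
       {e m (r \<odot>\<^bsub>N\<^esub> n) \<ominus>\<^bsub>F\<^esub> (r \<odot>\<^bsub>F\<^esub> e m n) | r m n.
          r \<in> carrier R \<and> m \<in> carrier M \<and> n \<in> carrier N} \<union>
       {e (ra m b) n \<ominus>\<^bsub>F\<^esub> e m (la b n) | m b n.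
          m \<in> carrier M \<and> b \<in> B \<and> n \<in> carrier N})"

definition tensor_null ::
  "('k, 'r) ring_scheme \<Rightarrow> 'b set \<Rightarrow> ('k, 'm, 's) module_scheme \<Rightarrow> ('m \<Rightarrow> 'b \<Rightarrow> 'm) \<Rightarrow>
   ('k, 'n, 't) module_scheme \<Rightarrow> ('b \<Rightarrow> 'n \<Rightarrow> 'n) \<Rightarrow> ('m \<times> 'n \<Rightarrow> 'k) set" where
  "tensor_null R B M ra N la =
     submodule_span R (free_module R (carrier M \<times> carrier N)) (tensor_rels R B M ra N la)"

definition tensor_over ::
  "('k, 'r) ring_scheme \<Rightarrow> 'b set \<Rightarrow> ('k, 'm, 's) module_scheme \<Rightarrow> ('m \<Rightarrow> 'b \<Rightarrow> 'm) \<Rightarrow>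
   ('k, 'n, 't) module_scheme \<Rightarrow> ('b \<Rightarrow> 'n \<Rightarrow> 'n) \<Rightarrow> ('k, ('m \<times> 'n \<Rightarrow> 'k) set) module" where
  "tensor_over R B M ra N la =
     quot_module (free_module R (carrier M \<times> carrier N)) (tensor_null R B M ra N la)"

text \<open>
  The map on a tensor product induced by a balanced bilinear map \<open>\<beta>\<close> to \<open>P\<close>. The choice of
  the representative \<open>f\<close> of the class \<open>X\<close> is immaterial exactly because \<open>\<beta>\<close> is balanced.
\<close>

definition lift_over ::
  "('k, 'r) ring_scheme \<Rightarrow> ('k, 'p, 's) module_scheme \<Rightarrow> ('m \<Rightarrow> 'n \<Rightarrow> 'p) \<Rightarrow> ('m \<times> 'n \<Rightarrow> 'k) set \<Rightarrow> 'p" where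
  "lift_over R P \<beta> X =
     (let f = (SOME f. f \<in> X) in
      \<Oplus>\<^bsub>P\<^esub> s \<in> {s. f s \<noteq> \<zero>\<^bsub>R\<^esub>}. f s \<odot>\<^bsub>P\<^esub> \<beta> (fst s) (snd s))"


section \<open>Linear categories and the base category\<close>

text \<open>\<open>Comp C x y z g f\<close> is the composite of \<open>f : x \<rightarrow> y\<close> and \<open>g : y \<rightarrow> z\<close>.\<close>

record ('o, 'k, 'm) lincat =
  Obj :: "'o set"
  Hom :: "'o \<Rightarrow> 'o \<Rightarrow> ('k, 'm) module"
  Comp :: "'o \<Rightarrow> 'o \<Rightarrow> 'o \<Rightarrow> 'm \<Rightarrow> 'm \<Rightarrow> 'm"
  Id :: "'o \<Rightarrow> 'm"

locale linear_category = cring R for R :: "('k, 'r) ring_scheme" (structure) +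
  fixes C :: "('o, 'k, 'm, 'c) lincat_scheme"
  assumes Hom_module: "\<lbrakk>x \<in> Obj C; y \<in> Obj C\<rbrakk> \<Longrightarrow> module R (Hom C x y)"
    and Id_closed: "x \<in> Obj C \<Longrightarrow> Id C x \<in> carrier (Hom C x x)"
    and Comp_closed:
      "\<lbrakk>x \<in> Obj C; y \<in> Obj C; z \<in> Obj C; g \<in> carrier (Hom C y z); f \<in> carrier (Hom C x y)\<rbrakk> \<Longrightarrow>
       Comp C x y z g f \<in> carrier (Hom C x z)"
    and Comp_linear_left:
      "\<lbrakk>x \<in> Obj C; y \<in> Obj C; z \<in> Obj C; f \<in> carrier (Hom C x y)\<rbrakk> \<Longrightarrow>
       linear_map R (Hom C y z) (Hom C x z) (\<lambda>g. Comp C x y z g f)"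
    and Comp_linear_right:
      "\<lbrakk>x \<in> Obj C; y \<in> Obj C; z \<in> Obj C; g \<in> carrier (Hom C y z)\<rbrakk> \<Longrightarrow>
       linear_map R (Hom C x y) (Hom C x z) (\<lambda>f. Comp C x y z g f)"
    and Comp_assoc:
      "\<lbrakk>w \<in> Obj C; x \<in> Obj C; y \<in> Obj C; z \<in> Obj C; h \<in> carrier (Hom C y z);
        g \<in> carrier (Hom C x y); f \<in> carrier (Hom C w x)\<rbrakk> \<Longrightarrow>
       Comp C w x z (Comp C x y z h g) f = Comp C w y z h (Comp C w x y g f)"
    and Comp_Id_left:
      "\<lbrakk>x \<in> Obj C; y \<in> Obj C; f \<in> carrier (Hom C x y)\<rbrakk> \<Longrightarrow> Comp C x y y (Id C y) f = f"
    and Comp_Id_right: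
      "\<lbrakk>x \<in> Obj C; y \<in> Obj C; f \<in> carrier (Hom C x y)\<rbrakk> \<Longrightarrow> Comp C x x y f (Id C x) = f"

locale base_category = linear_category R A
  for R :: "('k, 'r) ring_scheme" (structure) and A :: "('o, 'k, 'a, 'z) lincat_scheme" +
  fixes leq :: "'o \<Rightarrow> 'o \<Rightarrow> bool"
  assumes leq_refl: "x \<in> Obj A \<Longrightarrow> leq x x"
    and leq_antisym: "\<lbrakk>x \<in> Obj A; y \<in> Obj A; leq x y; leq y x\<rbrakk> \<Longrightarrow> x = y"
    and leq_trans: "\<lbrakk>x \<in> Obj A; y \<in> Obj A; z \<in> Obj A; leq x y; leq y z\<rbrakk> \<Longrightarrow> leq x z"
    and leq_dcc: "\<nexists>c :: nat \<Rightarrow> 'o. \<forall>n. c n \<in> Obj A \<and> leq (c (Suc n)) (c n) \<and> c (Suc n) \<noteq> c n"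
    and Hom_offdiag: "\<lbrakk>x \<in> Obj A; y \<in> Obj A; x \<noteq> y\<rbrakk> \<Longrightarrow> carrier (Hom A x y) = {\<zero>\<^bsub>Hom A x y\<^esub>}"

text \<open>Linear functors \<open>C \<rightarrow> D\<close> that are the identity on objects.\<close>

definition linear_functor ::
  "('k, 'r) ring_scheme \<Rightarrow> ('o, 'k, 'm, 's) lincat_scheme \<Rightarrow> ('o, 'k, 'n, 't) lincat_scheme \<Rightarrow>
   ('o \<Rightarrow> 'o \<Rightarrow> 'm \<Rightarrow> 'n) \<Rightarrow> bool" where
  "linear_functor R C D F \<longleftrightarrow>
     Obj C = Obj D \<and>
     (\<forall>x\<in>Obj C. \<forall>y\<in>Obj C. linear_map R (Hom C x y) (Hom D x y) (F x y)) \<and>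
     (\<forall>x\<in>Obj C. F x x (Id C x) = Id D x) \<and>
     (\<forall>x\<in>Obj C. \<forall>y\<in>Obj C. \<forall>z\<in>Obj C. \<forall>g\<in>carrier (Hom C y z). \<forall>f\<in>carrier (Hom C x y).
        F x z (Comp C x y z g f) = Comp D x y z (F y z g) (F x y f))"


section \<open>The monoidal category of bimodules\<close>

text \<open>
  For \<open>a \<in> A\<^sub>y\<close>, \<open>b \<in> A\<^sub>x\<close> and \<open>m \<in> M(x,y)\<close>, the two actions are written \<open>lact M x y a m\<close> and
  \<open>ract M x y m b\<close>.
\<close>

record ('o, 'k, 'a, 'm) bimod =
  Sp :: "'o \<Rightarrow> 'o \<Rightarrow> ('k, 'm) module"
  lact :: "'o \<Rightarrow> 'o \<Rightarrow> 'a \<Rightarrow> 'm \<Rightarrow> 'm"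
  ract :: "'o \<Rightarrow> 'o \<Rightarrow> 'm \<Rightarrow> 'a \<Rightarrow> 'm"

abbreviation end_set :: "('o, 'k, 'a, 'z) lincat_scheme \<Rightarrow> 'o \<Rightarrow> 'a set" where
  "end_set A x \<equiv> carrier (Hom A x x)"

locale bimodule =
  fixes R :: "('k, 'r) ring_scheme" and A :: "('o, 'k, 'a, 'z) lincat_scheme"
    and M :: "('o, 'k, 'a, 'm, 's) bimod_scheme"
  assumes Sp_module: "\<lbrakk>x \<in> Obj A; y \<in> Obj A\<rbrakk> \<Longrightarrow> module R (Sp M x y)"
    and lact_linear: "\<lbrakk>x \<in> Obj A; y \<in> Obj A; a \<in> end_set A y\<rbrakk> \<Longrightarrow>
      linear_map R (Sp M x y) (Sp M x y) (\<lambda>m. lact M x y a m)"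
    and lact_linear': "\<lbrakk>x \<in> Obj A; y \<in> Obj A; m \<in> carrier (Sp M x y)\<rbrakk> \<Longrightarrow>
      linear_map R (Hom A y y) (Sp M x y) (\<lambda>a. lact M x y a m)"
    and ract_linear: "\<lbrakk>x \<in> Obj A; y \<in> Obj A; b \<in> end_set A x\<rbrakk> \<Longrightarrow>
      linear_map R (Sp M x y) (Sp M x y) (\<lambda>m. ract M x y m b)"
    and ract_linear': "\<lbrakk>x \<in> Obj A; y \<in> Obj A; m \<in> carrier (Sp M x y)\<rbrakk> \<Longrightarrow>
      linear_map R (Hom A x x) (Sp M x y) (\<lambda>b. ract M x y m b)"
    and lact_Id: "\<lbrakk>x \<in> Obj A; y \<in> Obj A; m \<in> carrier (Sp M x y)\<rbrakk> \<Longrightarrow> lact M x y (Id A y) m = m"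
    and ract_Id: "\<lbrakk>x \<in> Obj A; y \<in> Obj A; m \<in> carrier (Sp M x y)\<rbrakk> \<Longrightarrow> ract M x y m (Id A x) = m"
    and lact_Comp: "\<lbrakk>x \<in> Obj A; y \<in> Obj A; m \<in> carrier (Sp M x y); a \<in> end_set A y; a' \<in> end_set A y\<rbrakk> \<Longrightarrow>
      lact M x y (Comp A y y y a a') m = lact M x y a (lact M x y a' m)"
    and ract_Comp: "\<lbrakk>x \<in> Obj A; y \<in> Obj A; m \<in> carrier (Sp M x y); b \<in> end_set A x; b' \<in> end_set A x\<rbrakk> \<Longrightarrow>
      ract M x y m (Comp A x x x b b') = ract M x y (ract M x y m b) b'"
    and lact_ract: "\<lbrakk>x \<in> Obj A; y \<in> Obj A; m \<in> carrier (Sp M x y); a \<in> end_set A y; b \<in> end_set A x\<rbrakk> \<Longrightarrow>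
      ract M x y (lact M x y a m) b = lact M x y a (ract M x y m b)"

definition bimod_hom ::
  "('k, 'r) ring_scheme \<Rightarrow> ('o, 'k, 'a, 'z) lincat_scheme \<Rightarrow>
   ('o, 'k, 'a, 'm, 's) bimod_scheme \<Rightarrow> ('o, 'k, 'a, 'n, 't) bimod_scheme \<Rightarrow>
   ('o \<Rightarrow> 'o \<Rightarrow> 'm \<Rightarrow> 'n) \<Rightarrow> bool" where
  "bimod_hom R A M N f \<longleftrightarrow>
     (\<forall>x\<in>Obj A. \<forall>y\<in>Obj A.
        linear_map R (Sp M x y) (Sp N x y) (f x y) \<and>
        (\<forall>m\<in>carrier (Sp M x y). \<forall>a\<in>end_set A y. f x y (lact M x y a m) = lact N x y a (f x y m)) \<and>
        (\<forall>m\<in>carrier (Sp M x y). \<forall>b\<in>end_set A x. f x y (ract M x y m b) = ract N x y (f x y m) b))"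

definition unit_bimod :: "('o, 'k, 'a, 'z) lincat_scheme \<Rightarrow> ('o, 'k, 'a, 'a) bimod" where
  "unit_bimod A =
     \<lparr>Sp = Hom A, lact = (\<lambda>x y a m. Comp A x y y a m), ract = (\<lambda>x y m b. Comp A x x y m b)\<rparr>"

type_synonym ('o, 'k, 'm, 'n) tens = "'o \<Rightarrow> ('m \<times> 'n \<Rightarrow> 'k) set"

text \<open>The summand \<open>M(z,y) \<otimes>\<^bsub>A\<^sub>z\<^esub> N(x,z)\<close> of \<open>(M \<otimes>\<^sub>A N)(x,y)\<close>.\<close>

definition tens_at ::
  "('k, 'r) ring_scheme \<Rightarrow> ('o, 'k, 'a, 'z) lincat_scheme \<Rightarrow>
   ('o, 'k, 'a, 'm, 's) bimod_scheme \<Rightarrow> ('o, 'k, 'a, 'n, 't) bimod_scheme \<Rightarrow>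
   'o \<Rightarrow> 'o \<Rightarrow> 'o \<Rightarrow> ('k, ('m \<times> 'n \<Rightarrow> 'k) set) module" where
  "tens_at R A M N x y z =
     tensor_over R (end_set A z) (Sp M z y) (ract M z y) (Sp N x z) (lact N x z)"

definition tens_sp ::
  "('k, 'r) ring_scheme \<Rightarrow> ('o, 'k, 'a, 'z) lincat_scheme \<Rightarrow>
   ('o, 'k, 'a, 'm, 's) bimod_scheme \<Rightarrow> ('o, 'k, 'a, 'n, 't) bimod_scheme \<Rightarrow>
   'o \<Rightarrow> 'o \<Rightarrow> ('k, ('o, 'k, 'm, 'n) tens) module" where
  "tens_sp R A M N x y = direct_sum_module (Obj A) (tens_at R A M N x y)"

text \<open>\<open>m \<otimes> n\<close> in the summand indexed by \<open>z\<close>, for \<open>m \<in> M(z,y)\<close> and \<open>n \<in> N(x,z)\<close>.\<close>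

definition pure_tens ::
  "('k, 'r) ring_scheme \<Rightarrow> ('o, 'k, 'a, 'z) lincat_scheme \<Rightarrow>
   ('o, 'k, 'a, 'm, 's) bimod_scheme \<Rightarrow> ('o, 'k, 'a, 'n, 't) bimod_scheme \<Rightarrow>
   'o \<Rightarrow> 'o \<Rightarrow> 'o \<Rightarrow> 'm \<Rightarrow> 'n \<Rightarrow> ('o, 'k, 'm, 'n) tens" where
  "pure_tens R A M N x y z m n =
     (\<lambda>w\<in>Obj A.
        if w = z then
          tensor_null R (end_set A z) (Sp M z y) (ract M z y) (Sp N x z) (lact N x z)
            +>\<^bsub>free_module R (carrier (Sp M z y) \<times> carrier (Sp N x z))\<^esub> basis_vec R (m, n)
        else \<zero>\<^bsub>tens_at R A M N x y w\<^esub>)"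

text \<open>The linear map \<open>(M \<otimes>\<^sub>A N)(x,y) \<rightarrow> P\<close> determined by \<open>m \<otimes> n \<mapsto> \<beta> z m n\<close> on the summands.\<close>

definition tens_lift ::
  "('k, 'r) ring_scheme \<Rightarrow> ('o, 'k, 'a, 'z) lincat_scheme \<Rightarrow>
   ('o, 'k, 'a, 'm, 's) bimod_scheme \<Rightarrow> ('o, 'k, 'a, 'n, 't) bimod_scheme \<Rightarrow>
   'o \<Rightarrow> 'o \<Rightarrow> ('k, 'p, 'u) module_scheme \<Rightarrow> ('o \<Rightarrow> 'm \<Rightarrow> 'n \<Rightarrow> 'p) \<Rightarrow>
   ('o, 'k, 'm, 'n) tens \<Rightarrow> 'p" where
  "tens_lift R A M N x y P \<beta> t =
     (\<Oplus>\<^bsub>P\<^esub> z \<in> {z\<in>Obj A. t z \<noteq> \<zero>\<^bsub>tens_at R A M N x y z\<^esub>}. lift_over R P (\<beta> z) (t z))"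

definition tensor ::
  "('k, 'r) ring_scheme \<Rightarrow> ('o, 'k, 'a, 'z) lincat_scheme \<Rightarrow>
   ('o, 'k, 'a, 'm, 's) bimod_scheme \<Rightarrow> ('o, 'k, 'a, 'n, 't) bimod_scheme \<Rightarrow>
   ('o, 'k, 'a, ('o, 'k, 'm, 'n) tens) bimod" where
  "tensor R A M N =
     \<lparr>Sp = tens_sp R A M N,
      lact = (\<lambda>x y a. tens_lift R A M N x y (tens_sp R A M N x y)
                (\<lambda>z m n. pure_tens R A M N x y z (lact M z y a m) n)),
      ract = (\<lambda>x y t b. tens_lift R A M N x y (tens_sp R A M N x y)
                (\<lambda>z m n. pure_tens R A M N x y z m (ract N x z n b)) t)\<rparr>"

text \<open>\<open>f \<otimes> g : M \<otimes>\<^sub>A N \<rightarrow> M' \<otimes>\<^sub>A N'\<close>\<close>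

definition tens_map ::
  "('k, 'r) ring_scheme \<Rightarrow> ('o, 'k, 'a, 'z) lincat_scheme \<Rightarrow>
   ('o, 'k, 'a, 'm, 's) bimod_scheme \<Rightarrow> ('o, 'k, 'a, 'n, 't) bimod_scheme \<Rightarrow>
   ('o, 'k, 'a, 'p, 'u) bimod_scheme \<Rightarrow> ('o, 'k, 'a, 'q, 'v) bimod_scheme \<Rightarrow>
   ('o \<Rightarrow> 'o \<Rightarrow> 'm \<Rightarrow> 'p) \<Rightarrow> ('o \<Rightarrow> 'o \<Rightarrow> 'n \<Rightarrow> 'q) \<Rightarrow>
   'o \<Rightarrow> 'o \<Rightarrow> ('o, 'k, 'm, 'n) tens \<Rightarrow> ('o, 'k, 'p, 'q) tens" where
  "tens_map R A M N M' N' f g x y =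
     tens_lift R A M N x y (tens_sp R A M' N' x y)
       (\<lambda>z m n. pure_tens R A M' N' x y z (f z y m) (g x z n))"

abbreviation idm :: "'o \<Rightarrow> 'o \<Rightarrow> 'm \<Rightarrow> 'm" where
  "idm \<equiv> \<lambda>x y m. m"

subsection \<open>Structural isomorphisms\<close>

text \<open>
  The tensor product is only associative and unital up to the canonical isomorphisms
  \<open>(m \<otimes> n) \<otimes> p \<leftrightarrow> m \<otimes> (n \<otimes> p)\<close>, \<open>a \<otimes> m \<leftrightarrow> am\<close> and \<open>m \<otimes> a \<leftrightarrow> ma\<close>, so these are inserted
  wherever a strict monoidal structure would hide them.
\<close>

definition assoc ::
  "('k, 'r) ring_scheme \<Rightarrow> ('o, 'k, 'a, 'z) lincat_scheme \<Rightarrow>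
   ('o, 'k, 'a, 'm, 's) bimod_scheme \<Rightarrow> ('o, 'k, 'a, 'n, 't) bimod_scheme \<Rightarrow>
   ('o, 'k, 'a, 'p, 'u) bimod_scheme \<Rightarrow> 'o \<Rightarrow> 'o \<Rightarrow>
   ('o, 'k, ('o, 'k, 'm, 'n) tens, 'p) tens \<Rightarrow> ('o, 'k, 'm, ('o, 'k, 'n, 'p) tens) tens" where
  "assoc R A M N P x y =
     (let T = tens_sp R A M (tensor R A N P) x y in
      tens_lift R A (tensor R A M N) P x y T
        (\<lambda>z s p. tens_lift R A M N z y T
           (\<lambda>w m n. pure_tens R A M (tensor R A N P) x y w m (pure_tens R A N P x w z n p)) s))"

definition assoc_inv ::
  "('k, 'r) ring_scheme \<Rightarrow> ('o, 'k, 'a, 'z) lincat_scheme \<Rightarrow>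
   ('o, 'k, 'a, 'm, 's) bimod_scheme \<Rightarrow> ('o, 'k, 'a, 'n, 't) bimod_scheme \<Rightarrow>
   ('o, 'k, 'a, 'p, 'u) bimod_scheme \<Rightarrow> 'o \<Rightarrow> 'o \<Rightarrow>
   ('o, 'k, 'm, ('o, 'k, 'n, 'p) tens) tens \<Rightarrow> ('o, 'k, ('o, 'k, 'm, 'n) tens, 'p) tens" where
  "assoc_inv R A M N P x y =
     (let T = tens_sp R A (tensor R A M N) P x y in
      tens_lift R A M (tensor R A N P) x y T
        (\<lambda>w m s. tens_lift R A N P x w T
           (\<lambda>z n p. pure_tens R A (tensor R A M N) P x y z (pure_tens R A M N z y w m n) p) s))"

definition lunit ::
  "('k, 'r) ring_scheme \<Rightarrow> ('o, 'k, 'a, 'z) lincat_scheme \<Rightarrow>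
   ('o, 'k, 'a, 'm, 's) bimod_scheme \<Rightarrow> 'o \<Rightarrow> 'o \<Rightarrow> ('o, 'k, 'a, 'm) tens \<Rightarrow> 'm" where
  "lunit R A M x y =
     tens_lift R A (unit_bimod A) M x y (Sp M x y)
       (\<lambda>z a m. if z = y then lact M x y a m else \<zero>\<^bsub>Sp M x y\<^esub>)"

definition lunit_inv ::
  "('k, 'r) ring_scheme \<Rightarrow> ('o, 'k, 'a, 'z) lincat_scheme \<Rightarrow>
   ('o, 'k, 'a, 'm, 's) bimod_scheme \<Rightarrow> 'o \<Rightarrow> 'o \<Rightarrow> 'm \<Rightarrow> ('o, 'k, 'a, 'm) tens" where
  "lunit_inv R A M x y m = pure_tens R A (unit_bimod A) M x y y (Id A y) m"

definition runit ::
  "('k, 'r) ring_scheme \<Rightarrow> ('o, 'k, 'a, 'z) lincat_scheme \<Rightarrow>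
   ('o, 'k, 'a, 'm, 's) bimod_scheme \<Rightarrow> 'o \<Rightarrow> 'o \<Rightarrow> ('o, 'k, 'm, 'a) tens \<Rightarrow> 'm" where
  "runit R A M x y =
     tens_lift R A M (unit_bimod A) x y (Sp M x y)
       (\<lambda>z m a. if z = x then ract M x y m a else \<zero>\<^bsub>Sp M x y\<^esub>)"

definition runit_inv ::
  "('k, 'r) ring_scheme \<Rightarrow> ('o, 'k, 'a, 'z) lincat_scheme \<Rightarrow>
   ('o, 'k, 'a, 'm, 's) bimod_scheme \<Rightarrow> 'o \<Rightarrow> 'o \<Rightarrow> 'm \<Rightarrow> ('o, 'k, 'm, 'a) tens" where
  "runit_inv R A M x y m = pure_tens R A M (unit_bimod A) x y x m (Id A x)"


section \<open>Monoids in bimodules\<close>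

record ('o, 'k, 'a, 'm) bimod_mon = "('o, 'k, 'a, 'm) bimod" +
  Mu :: "'o \<Rightarrow> 'o \<Rightarrow> ('o, 'k, 'm, 'm) tens \<Rightarrow> 'm"
  Eta :: "'o \<Rightarrow> 'o \<Rightarrow> 'a \<Rightarrow> 'm"

locale bimod_monoid = bimodule R A D
  for R :: "('k, 'r) ring_scheme" and A :: "('o, 'k, 'a, 'z) lincat_scheme"
    and D :: "('o, 'k, 'a, 'm, 's) bimod_mon_scheme" +
  assumes Mu_hom: "bimod_hom R A (tensor R A D D) D (Mu D)"
    and Eta_hom: "bimod_hom R A (unit_bimod A) D (Eta D)"
    and Mu_assoc:
      "\<lbrakk>x \<in> Obj A; y \<in> Obj A; t \<in> carrier (Sp (tensor R A (tensor R A D D) D) x y)\<rbrakk> \<Longrightarrow>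
       Mu D x y (tens_map R A (tensor R A D D) D D D (Mu D) idm x y t) =
       Mu D x y (tens_map R A D (tensor R A D D) D D idm (Mu D) x y (assoc R A D D D x y t))"
    and Mu_unit_left:
      "\<lbrakk>x \<in> Obj A; y \<in> Obj A; u \<in> carrier (Sp (tensor R A (unit_bimod A) D) x y)\<rbrakk> \<Longrightarrow>
       Mu D x y (tens_map R A (unit_bimod A) D D D (Eta D) idm x y u) = lunit R A D x y u"
    and Mu_unit_right:
      "\<lbrakk>x \<in> Obj A; y \<in> Obj A; v \<in> carrier (Sp (tensor R A D (unit_bimod A)) x y)\<rbrakk> \<Longrightarrow>
       Mu D x y (tens_map R A D (unit_bimod A) D D idm (Eta D) x y v) = runit R A D x y v"

definition bimod_mon_hom ::
  "('k, 'r) ring_scheme \<Rightarrow> ('o, 'k, 'a, 'z) lincat_scheme \<Rightarrow>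
   ('o, 'k, 'a, 'm, 's) bimod_mon_scheme \<Rightarrow> ('o, 'k, 'a, 'n, 't) bimod_mon_scheme \<Rightarrow>
   ('o \<Rightarrow> 'o \<Rightarrow> 'm \<Rightarrow> 'n) \<Rightarrow> bool" where
  "bimod_mon_hom R A D E f \<longleftrightarrow>
     bimod_hom R A D E f \<and>
     (\<forall>x\<in>Obj A. \<forall>y\<in>Obj A.
        (\<forall>t\<in>carrier (Sp (tensor R A D D) x y).
           f x y (Mu D x y t) = Mu E x y (tens_map R A D D E E f f x y t)) \<and>
        (\<forall>a\<in>carrier (Hom A x y). f x y (Eta D x y a) = Eta E x y a))"

definition bimod_mon_iso ::
  "('k, 'r) ring_scheme \<Rightarrow> ('o, 'k, 'a, 'z) lincat_scheme \<Rightarrow>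
   ('o, 'k, 'a, 'm, 's) bimod_mon_scheme \<Rightarrow> ('o, 'k, 'a, 'n, 't) bimod_mon_scheme \<Rightarrow>
   ('o \<Rightarrow> 'o \<Rightarrow> 'm \<Rightarrow> 'n) \<Rightarrow> bool" where
  "bimod_mon_iso R A D E f \<longleftrightarrow>
     bimod_mon_hom R A D E f \<and>
     (\<exists>g. bimod_mon_hom R A E D g \<and>
        (\<forall>x\<in>Obj A. \<forall>y\<in>Obj A.
           (\<forall>m\<in>carrier (Sp D x y). g x y (f x y m) = m) \<and>
           (\<forall>n\<in>carrier (Sp E x y). f x y (g x y n) = n)))"

text \<open>
  Since the unit is a morphism of bimodules, it is an isomorphism on \<open>A\<^sub>x\<close> as soon as it is bijective.
\<close>

definition strongly_upward ::
  "('k, 'r) ring_scheme \<Rightarrow> ('o, 'k, 'a, 'z) lincat_scheme \<Rightarrow> ('o \<Rightarrow> 'o \<Rightarrow> bool) \<Rightarrow>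
   ('o, 'k, 'a, 'm, 's) bimod_mon_scheme \<Rightarrow> bool" where
  "strongly_upward R A leq D \<longleftrightarrow>
     bimod_monoid R A D \<and>
     (\<forall>x\<in>Obj A. \<forall>y\<in>Obj A. \<not> leq x y \<longrightarrow> carrier (Sp D x y) = {\<zero>\<^bsub>Sp D x y\<^esub>}) \<and>
     (\<forall>x\<in>Obj A. bij_betw (Eta D x x) (carrier (Hom A x x)) (carrier (Sp D x x)))"

definition strongly_downward ::
  "('k, 'r) ring_scheme \<Rightarrow> ('o, 'k, 'a, 'z) lincat_scheme \<Rightarrow> ('o \<Rightarrow> 'o \<Rightarrow> bool) \<Rightarrow>
   ('o, 'k, 'a, 'm, 's) bimod_mon_scheme \<Rightarrow> bool" where
  "strongly_downward R A leq D \<longleftrightarrow>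
     bimod_monoid R A D \<and>
     (\<forall>x\<in>Obj A. \<forall>y\<in>Obj A. \<not> leq y x \<longrightarrow> carrier (Sp D x y) = {\<zero>\<^bsub>Sp D x y\<^esub>}) \<and>
     (\<forall>x\<in>Obj A. bij_betw (Eta D x x) (carrier (Hom A x x)) (carrier (Sp D x x)))"


section \<open>Stratified linear categories\<close>

record ('o, 'k, 'a, 'm) strat = "('o, 'k, 'm) lincat" +
  Incl :: "'o \<Rightarrow> 'o \<Rightarrow> 'a \<Rightarrow> 'm"
  Pos :: "'o \<Rightarrow> 'o \<Rightarrow> 'm set"
  Neg :: "'o \<Rightarrow> 'o \<Rightarrow> 'm set"

definition wide_linear_subcategory ::
  "('k, 'r) ring_scheme \<Rightarrow> ('o, 'k, 'm, 'c) lincat_scheme \<Rightarrow> ('o \<Rightarrow> 'o \<Rightarrow> 'm set) \<Rightarrow> bool" where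
  "wide_linear_subcategory R C S \<longleftrightarrow>
     (\<forall>x\<in>Obj C. \<forall>y\<in>Obj C. submodule (S x y) R (Hom C x y)) \<and>
     (\<forall>x\<in>Obj C. Id C x \<in> S x x) \<and>
     (\<forall>x\<in>Obj C. \<forall>y\<in>Obj C. \<forall>z\<in>Obj C. \<forall>g\<in>S y z. \<forall>f\<in>S x y. Comp C x y z g f \<in> S x z)"

text \<open>A wide linear subcategory containing the image of \<open>A\<close>, as a bimodule and as a monoid.\<close>

definition part_bimod ::
  "('o, 'k, 'a, 'm, 's) strat_scheme \<Rightarrow> ('o \<Rightarrow> 'o \<Rightarrow> 'm set) \<Rightarrow> ('o, 'k, 'a, 'm) bimod" where
  "part_bimod C S =
     \<lparr>Sp = (\<lambda>x y. (Hom C x y)\<lparr>carrier := S x y\<rparr>),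
      lact = (\<lambda>x y a m. Comp C x y y (Incl C y y a) m),
      ract = (\<lambda>x y m b. Comp C x x y m (Incl C x x b))\<rparr>"

text \<open>The map \<open>(S \<otimes>\<^sub>A S')(x,y) \<rightarrow> C(x,y)\<close>, \<open>g \<otimes> f \<mapsto> gf\<close>.\<close>

definition comp_map ::
  "('k, 'r) ring_scheme \<Rightarrow> ('o, 'k, 'a, 'z) lincat_scheme \<Rightarrow> ('o, 'k, 'a, 'm, 's) strat_scheme \<Rightarrow>
   ('o \<Rightarrow> 'o \<Rightarrow> 'm set) \<Rightarrow> ('o \<Rightarrow> 'o \<Rightarrow> 'm set) \<Rightarrow> 'o \<Rightarrow> 'o \<Rightarrow> ('o, 'k, 'm, 'm) tens \<Rightarrow> 'm" where
  "comp_map R A C S S' x y =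
     tens_lift R A (part_bimod C S) (part_bimod C S') x y (Hom C x y) (\<lambda>z g f. Comp C x z y g f)"

definition part_monoid ::
  "('k, 'r) ring_scheme \<Rightarrow> ('o, 'k, 'a, 'z) lincat_scheme \<Rightarrow> ('o, 'k, 'a, 'm, 's) strat_scheme \<Rightarrow>
   ('o \<Rightarrow> 'o \<Rightarrow> 'm set) \<Rightarrow> ('o, 'k, 'a, 'm) bimod_mon" where
  "part_monoid R A C S =
     \<lparr>Sp = Sp (part_bimod C S), lact = lact (part_bimod C S), ract = ract (part_bimod C S),
      Mu = comp_map R A C S S, Eta = Incl C\<rparr>"

locale stratified = A: base_category R A leq + C: linear_category R C
  for R :: "('k, 'r) ring_scheme" (structure) and A :: "('o, 'k, 'a, 'z) lincat_scheme"
    and leq :: "'o \<Rightarrow> 'o \<Rightarrow> bool" and C :: "('o, 'k, 'a, 'm, 's) strat_scheme" +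
  assumes Obj_eq: "Obj C = Obj A"
    and Incl_functor: "linear_functor R A C (Incl C)"
    and Pos_sub: "wide_linear_subcategory R C (Pos C)"
    and Neg_sub: "wide_linear_subcategory R C (Neg C)"
    and Pos_zero: "\<lbrakk>x \<in> Obj C; y \<in> Obj C; \<not> leq x y\<rbrakk> \<Longrightarrow> Pos C x y = {\<zero>\<^bsub>Hom C x y\<^esub>}"
    and Neg_zero: "\<lbrakk>x \<in> Obj C; y \<in> Obj C; \<not> leq y x\<rbrakk> \<Longrightarrow> Neg C x y = {\<zero>\<^bsub>Hom C x y\<^esub>}"
    and Pos_Neg_diag: "x \<in> Obj C \<Longrightarrow> Pos C x x = Neg C x x"
    and Incl_bij: "x \<in> Obj C \<Longrightarrow> bij_betw (Incl C x x) (carrier (Hom A x x)) (Pos C x x)"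
    and Comp_iso: "\<lbrakk>x \<in> Obj C; z \<in> Obj C\<rbrakk> \<Longrightarrow>
      linear_map R (Sp (tensor R A (part_bimod C (Pos C)) (part_bimod C (Neg C))) x z) (Hom C x z)
        (comp_map R A C (Pos C) (Neg C) x z) \<and>
      bij_betw (comp_map R A C (Pos C) (Neg C) x z)
        (carrier (Sp (tensor R A (part_bimod C (Pos C)) (part_bimod C (Neg C))) x z))
        (carrier (Hom C x z))"

definition strat_hom ::
  "('k, 'r) ring_scheme \<Rightarrow> ('o, 'k, 'a, 'z) lincat_scheme \<Rightarrow>
   ('o, 'k, 'a, 'm, 's) strat_scheme \<Rightarrow> ('o, 'k, 'a, 'n, 't) strat_scheme \<Rightarrow>
   ('o \<Rightarrow> 'o \<Rightarrow> 'm \<Rightarrow> 'n) \<Rightarrow> bool" where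
  "strat_hom R A C D F \<longleftrightarrow>
     linear_functor R C D F \<and>
     (\<forall>x\<in>Obj A. \<forall>y\<in>Obj A.
        (\<forall>a\<in>carrier (Hom A x y). F x y (Incl C x y a) = Incl D x y a) \<and>
        F x y ` Pos C x y \<subseteq> Pos D x y \<and> F x y ` Neg C x y \<subseteq> Neg D x y)"

definition strat_isomorphic ::
  "('k, 'r) ring_scheme \<Rightarrow> ('o, 'k, 'a, 'z) lincat_scheme \<Rightarrow>
   ('o, 'k, 'a, 'm, 's) strat_scheme \<Rightarrow> ('o, 'k, 'a, 'n, 't) strat_scheme \<Rightarrow> bool" where
  "strat_isomorphic R A C D \<longleftrightarrow>
     (\<exists>F G. strat_hom R A C D F \<and> strat_hom R A D C G \<and>
        (\<forall>x\<in>Obj A. \<forall>y\<in>Obj A.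
           (\<forall>f\<in>carrier (Hom C x y). G x y (F x y f) = f) \<and>
           (\<forall>g\<in>carrier (Hom D x y). F x y (G x y g) = g)))"


section \<open>Twisted tensor products\<close>

text \<open>In \<open>twist R A P N \<tau>\<close>, the monoid \<open>P\<close> plays the role of \<open>C\<^sup>+\<close> and \<open>N\<close> that of \<open>C\<^sup>-\<close>.\<close>

definition twist ::
  "('k, 'r) ring_scheme \<Rightarrow> ('o, 'k, 'a, 'z) lincat_scheme \<Rightarrow>
   ('o, 'k, 'a, 'p, 's) bimod_mon_scheme \<Rightarrow> ('o, 'k, 'a, 'n, 't) bimod_mon_scheme \<Rightarrow>
   ('o \<Rightarrow> 'o \<Rightarrow> ('o, 'k, 'n, 'p) tens \<Rightarrow> ('o, 'k, 'p, 'n) tens) \<Rightarrow> bool" where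
  "twist R A P N \<tau> \<longleftrightarrow>
     (let NN = tensor R A N N; PP = tensor R A P P; NP = tensor R A N P; PN = tensor R A P N;
          U = unit_bimod A in
      bimod_hom R A NP PN \<tau> \<and>
      (\<forall>x\<in>Obj A. \<forall>y\<in>Obj A.
         (\<forall>t\<in>carrier (Sp (tensor R A NN P) x y).
            \<tau> x y (tens_map R A NN P N P (Mu N) idm x y t) =
            tens_map R A P NN P N idm (Mu N) x y
              (assoc R A P N N x y
                (tens_map R A NP N PN N \<tau> idm x y
                  (assoc_inv R A N P N x y
                    (tens_map R A N NP N PN idm \<tau> x y
                      (assoc R A N N P x y t)))))) \<and>
         (\<forall>t\<in>carrier (Sp (tensor R A U P) x y).
            \<tau> x y (tens_map R A U P N P (Eta N) idm x y t) =
            tens_map R A P U P N idm (Eta N) x y (runit_inv R A P x y (lunit R A P x y t))) \<and>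
         (\<forall>t\<in>carrier (Sp (tensor R A N PP) x y).
            \<tau> x y (tens_map R A N PP N P idm (Mu P) x y t) =
            tens_map R A PP N P N (Mu P) idm x y
              (assoc_inv R A P P N x y
                (tens_map R A P NP P PN idm \<tau> x y
                  (assoc R A P N P x y
                    (tens_map R A NP P PN P \<tau> idm x y
                      (assoc_inv R A N P P x y t)))))) \<and>
         (\<forall>t\<in>carrier (Sp (tensor R A N U) x y).
            \<tau> x y (tens_map R A N U N P idm (Eta P) x y t) =
            tens_map R A U N P N (Eta P) idm x y (lunit_inv R A N x y (runit R A N x y t)))))"

record ('o, 'k, 'a, 'p, 'n) triple =
  Up :: "('o, 'k, 'a, 'p) bimod_mon"
  Down :: "('o, 'k, 'a, 'n) bimod_mon"
  Tw :: "'o \<Rightarrow> 'o \<Rightarrow> ('o, 'k, 'n, 'p) tens \<Rightarrow> ('o, 'k, 'p, 'n) tens"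

definition twisted_triple ::
  "('k, 'r) ring_scheme \<Rightarrow> ('o, 'k, 'a, 'z) lincat_scheme \<Rightarrow> ('o \<Rightarrow> 'o \<Rightarrow> bool) \<Rightarrow>
   ('o, 'k, 'a, 'p, 'n) triple \<Rightarrow> bool" where
  "twisted_triple R A leq T \<longleftrightarrow>
     strongly_upward R A leq (Up T) \<and> strongly_downward R A leq (Down T) \<and>
     twist R A (Up T) (Down T) (Tw T)"

definition triple_isomorphic ::
  "('k, 'r) ring_scheme \<Rightarrow> ('o, 'k, 'a, 'z) lincat_scheme \<Rightarrow>
   ('o, 'k, 'a, 'p, 'n) triple \<Rightarrow> ('o, 'k, 'a, 'p', 'n') triple \<Rightarrow> bool" where
  "triple_isomorphic R A T T' \<longleftrightarrow>
     (\<exists>f g. bimod_mon_iso R A (Up T) (Up T') f \<and> bimod_mon_iso R A (Down T) (Down T') g \<and>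
        (\<forall>x\<in>Obj A. \<forall>y\<in>Obj A. \<forall>t\<in>carrier (Sp (tensor R A (Down T) (Up T)) x y).
           tens_map R A (Up T) (Down T) (Up T') (Down T') f g x y (Tw T x y t) =
           Tw T' x y (tens_map R A (Down T) (Up T) (Down T') (Up T') g f x y t)))"

text \<open>The monoid \<open>P \<otimes>\<^sub>A N\<close> with multiplication \<open>(\<mu>\<^sup>+ \<otimes> \<mu>\<^sup>-)(P \<otimes> \<tau> \<otimes> N)\<close>.\<close>

definition twisted_monoid ::
  "('k, 'r) ring_scheme \<Rightarrow> ('o, 'k, 'a, 'z) lincat_scheme \<Rightarrow> ('o, 'k, 'a, 'p, 'n) triple \<Rightarrow>
   ('o, 'k, 'a, ('o, 'k, 'p, 'n) tens) bimod_mon" where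
  "twisted_monoid R A T =
     (let P = Up T; N = Down T; \<tau> = Tw T; U = unit_bimod A;
          NN = tensor R A N N; PP = tensor R A P P; NP = tensor R A N P; PN = tensor R A P N in
      \<lparr>Sp = Sp PN, lact = lact PN, ract = ract PN,
       Mu = (\<lambda>x y t.
         tens_map R A PP NN P N (Mu P) (Mu N) x y
           (assoc_inv R A P P NN x y
             (tens_map R A P (tensor R A PN N) P (tensor R A P NN) idm (assoc R A P N N) x y
               (tens_map R A P (tensor R A NP N) P (tensor R A PN N) idm
                   (tens_map R A NP N PN N \<tau> idm) x y
                 (tens_map R A P (tensor R A N PN) P (tensor R A NP N) idm (assoc_inv R A N P N) x y
                   (assoc R A P N PN x y t)))))),
       Eta = (\<lambda>x y a. tens_map R A U U P N (Eta P) (Eta N) x y (lunit_inv R A U x y a))\<rparr>)"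

text \<open>
  The linear category over \<open>A\<close> corresponding to a monoid \<open>D\<close> in bimodules, with two designated
  families of subsets: \<open>gf = \<mu>(g \<otimes> f)\<close> and \<open>id\<^sub>x = \<eta>(id\<^sub>x)\<close>.
\<close>

definition category_of_monoid ::
  "('k, 'r) ring_scheme \<Rightarrow> ('o, 'k, 'a, 'z) lincat_scheme \<Rightarrow> ('o, 'k, 'a, 'm, 's) bimod_mon_scheme \<Rightarrow>
   ('o \<Rightarrow> 'o \<Rightarrow> 'm set) \<Rightarrow> ('o \<Rightarrow> 'o \<Rightarrow> 'm set) \<Rightarrow> ('o, 'k, 'a, 'm) strat" where
  "category_of_monoid R A D S S' =
     \<lparr>Obj = Obj A, Hom = Sp D,
      Comp = (\<lambda>x y z g f. Mu D x z (pure_tens R A D D x z y g f)),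
      Id = (\<lambda>x. Eta D x x (Id A x)),
      Incl = Eta D, Pos = S, Neg = S'\<rparr>"

text \<open>The twisted tensor product, with the images of \<open>f \<mapsto> f \<otimes> id\<close> and \<open>g \<mapsto> id \<otimes> g\<close>.\<close>

definition twisted_tensor_product ::
  "('k, 'r) ring_scheme \<Rightarrow> ('o, 'k, 'a, 'z) lincat_scheme \<Rightarrow> ('o, 'k, 'a, 'p, 'n) triple \<Rightarrow>
   ('o, 'k, 'a, ('o, 'k, 'p, 'n) tens) strat" where
  "twisted_tensor_product R A T =
     category_of_monoid R A (twisted_monoid R A T)
       (\<lambda>x y. (\<lambda>f. pure_tens R A (Up T) (Down T) x y x f (Eta (Down T) x x (Id A x)))
                 ` carrier (Sp (Up T) x y))
       (\<lambda>x y. (\<lambda>g. pure_tens R A (Up T) (Down T) x y y (Eta (Up T) y y (Id A y)) g)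
                 ` carrier (Sp (Down T) x y))"

text \<open>
  The triple of a stratified linear category: \<open>\<tau>(g \<otimes> f)\<close> is the preimage of the composite \<open>gf\<close>
  under the composition isomorphism.
\<close>

definition triple_of_strat ::
  "('k, 'r) ring_scheme \<Rightarrow> ('o, 'k, 'a, 'z) lincat_scheme \<Rightarrow> ('o, 'k, 'a, 'm, 's) strat_scheme \<Rightarrow>
   ('o, 'k, 'a, 'm, 'm) triple" where
  "triple_of_strat R A C =
     \<lparr>Up = part_monoid R A C (Pos C),
      Down = part_monoid R A C (Neg C),
      Tw = (\<lambda>x z t.
        inv_into (carrier (Sp (tensor R A (part_bimod C (Pos C)) (part_bimod C (Neg C))) x z))
          (comp_map R A C (Pos C) (Neg C) x z)
          (comp_map R A C (Neg C) (Pos C) x z t))\<rparr>"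

end

theory Submission
  imports Defs
begin

text \<open>
  Everything reduces to computations with pure tensors, since a linear map out of a tensor product
  of bimodules is determined by its values there. For a stratified category \<open>C\<close> the twist is
  characterised by \<open>c(\<tau>(g \<otimes> f)) = gf\<close>, where \<open>c\<close> is the composition isomorphism, so each twist axiom
  becomes an instance of associativity or of a unit law in \<open>C\<close> after applying \<open>c\<close>.

  Conversely, a twist \<open>\<tau>\<close> makes \<open>N\<close> act on \<open>P \<otimes> N\<close> from the left by \<open>n(p \<otimes> n') = \<tau>(n \<otimes> p)n'\<close> and \<open>P\<close> from
  the right by \<open>(p \<otimes> n)p' = p\<tau>(n \<otimes> p')\<close>, and the product of the twisted tensor product is
  \<open>(p \<otimes> n)s = p(ns)\<close>. The twist axioms for products say that \<open>ns\<close> is an action and that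
  \<open>n(pu) = \<tau>(n \<otimes> p)u\<close> (a product in the twisted tensor product); hence left multiplication by \<open>n\<close>
  commutes with right multiplications, and associativity follows.

  An isomorphism of triples \<open>(f, g)\<close> extends to the categories by \<open>pn \<mapsto> f(p)g(n)\<close>; it is multiplicative
  because it also maps \<open>np\<close> to \<open>g(n)f(p)\<close>, by compatibility with the twists. Since a triple is
  isomorphic to the triple of its twisted tensor product, the remaining claims are formal.
\<close>

section \<open>Linear maps and modules\<close>

text \<open>The monoidal category is not strict, and its tensors are families of cosets in free
  modules. The axioms in \<open>bimod_monoid\<close> and \<open>twist\<close> are therefore
  identities between long composites, over types that change with every bracketing. The universal
  property, in the form of \<open>tens_lift_linear\<close>, \<open>tens_lift_pure\<close> and
  \<open>tens_agree\<close>, hides the cosets. Every structural map is then evaluated at pure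
  tensors, and each axiom becomes an identity between elements, written with \<open>mul\<close>,
  \<open>un\<close> and \<open>exch\<close>, from which it can be recovered by linearity. Two
  features of the setting enter at definite places. Since \<open>A\<close> vanishes off the
  diagonal, a tensor product with the unit bimodule reduces to one summand, which is what makes the
  unit axioms accessible. Since the unit of a strongly upward or downward monoid is bijective on the
  diagonal, it has a retraction; this gives maps from \<open>P \<otimes> N\<close> back to
  \<open>P\<close> and to \<open>N\<close>, so both monoids embed in the twisted tensor product and
  can be read off from it.\<close>

lemma linear_mapI:
  assumes "\<And>u. u \<in> carrier M \<Longrightarrow> f u \<in> carrier N"
    and "\<And>u v. u \<in> carrier M \<Longrightarrow> v \<in> carrier M \<Longrightarrow> f (u \<oplus>\<^bsub>M\<^esub> v) = f u \<oplus>\<^bsub>N\<^esub> f v"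
    and "\<And>r u. r \<in> carrier R \<Longrightarrow> u \<in> carrier M \<Longrightarrow> f (r \<odot>\<^bsub>M\<^esub> u) = r \<odot>\<^bsub>N\<^esub> f u"
  shows "linear_map R M N f"
  using assms by (auto simp: linear_map_def)

lemma linear_map_closed: "\<lbrakk>linear_map R M N f; u \<in> carrier M\<rbrakk> \<Longrightarrow> f u \<in> carrier N"
  by (auto simp: linear_map_def)

lemma linear_map_add:
  "\<lbrakk>linear_map R M N f; u \<in> carrier M; v \<in> carrier M\<rbrakk> \<Longrightarrow>
     f (u \<oplus>\<^bsub>M\<^esub> v) = f u \<oplus>\<^bsub>N\<^esub> f v"
  by (auto simp: linear_map_def)

lemma linear_map_smult:
  "\<lbrakk>linear_map R M N f; r \<in> carrier R; u \<in> carrier M\<rbrakk> \<Longrightarrow>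
     f (r \<odot>\<^bsub>M\<^esub> u) = r \<odot>\<^bsub>N\<^esub> f u"
  by (auto simp: linear_map_def)

lemma linear_map_zero:
  assumes "module R M" "module R N" "linear_map R M N f"
  shows "f \<zero>\<^bsub>M\<^esub> = \<zero>\<^bsub>N\<^esub>"
proof -
  interpret M: module R M by fact
  interpret N: module R N by fact
  have "f \<zero>\<^bsub>M\<^esub> = f (\<zero>\<^bsub>R\<^esub> \<odot>\<^bsub>M\<^esub> \<zero>\<^bsub>M\<^esub>)" by simp
  also have "\<dots> = \<zero>\<^bsub>R\<^esub> \<odot>\<^bsub>N\<^esub> f \<zero>\<^bsub>M\<^esub>" by (intro linear_map_smult[OF assms(3)]) auto
  also have "\<dots> = \<zero>\<^bsub>N\<^esub>" by (simp add: linear_map_closed[OF assms(3)])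
  finally show ?thesis .
qed

lemma linear_map_compose:
  "\<lbrakk>linear_map R M N f; linear_map R N P g\<rbrakk> \<Longrightarrow> linear_map R M P (\<lambda>u. g (f u))"
  by (auto simp: linear_map_def Pi_iff)

lemma linear_map_id: "linear_map R M M (\<lambda>u. u)"
  by (auto simp: linear_map_def)

lemma linear_map_cong:
  assumes "linear_map R M N f" "module R M" "\<And>u. u \<in> carrier M \<Longrightarrow> g u = f u"
  shows "linear_map R M N g"
proof -
  interpret M: module R M by fact
  show ?thesis using assms(1,3) by (auto simp: linear_map_def Pi_iff)
qed

lemma linear_map_const_zero:
  assumes "module R N"
  shows "linear_map R M N (\<lambda>u. \<zero>\<^bsub>N\<^esub>)"
proof -
  interpret N: module R N by fact
  show ?thesis by (auto simp: linear_map_def)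
qed

lemma linear_map_add_maps:
  assumes "module R N" "linear_map R M N f" "linear_map R M N g"
  shows "linear_map R M N (\<lambda>u. f u \<oplus>\<^bsub>N\<^esub> g u)"
proof -
  interpret N: module R N by fact
  show ?thesis using assms(2,3)
    by (auto simp: linear_map_def Pi_iff N.M.a_ac N.smult_r_distr)
qed

lemma linear_map_smult_maps:
  assumes "module R N" "linear_map R M N f" "s \<in> carrier R"
  shows "linear_map R M N (\<lambda>u. s \<odot>\<^bsub>N\<^esub> f u)"
proof -
  interpret N: module R N by fact
  show ?thesis using assms(2,3)
    by (auto simp: linear_map_def Pi_iff N.smult_r_distr N.R.m_comm simp flip: N.smult_assoc1)
qed

lemma linear_map_the_inv:
  assumes "module R M" "linear_map R M N f" "bij_betw f (carrier M) (carrier N)"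
  shows "linear_map R N M (inv_into (carrier M) f)"
proof (rule linear_mapI)
  interpret M: module R M by fact
  let ?g = "inv_into (carrier M) f"
  have inj: "inj_on f (carrier M)" and im: "f ` carrier M = carrier N"
    using assms(3) by (auto simp: bij_betw_def)
  have g: "?g v \<in> carrier M" "f (?g v) = v" if "v \<in> carrier N" for v
    using that im by (auto simp: inv_into_into f_inv_into_f)
  have gI: "?g v = u" if "u \<in> carrier M" "f u = v" for u v
    using inv_into_f_f[OF inj that(1)] that(2) by simp
  show "?g v \<in> carrier M" if "v \<in> carrier N" for v using g that by simp
  show "?g (u \<oplus>\<^bsub>N\<^esub> v) = ?g u \<oplus>\<^bsub>M\<^esub> ?g v" if "u \<in> carrier N" "v \<in> carrier N" for u v
    by (rule gI) (auto simp: linear_map_add[OF assms(2)] g that)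
  show "?g (r \<odot>\<^bsub>N\<^esub> v) = r \<odot>\<^bsub>M\<^esub> ?g v" if "r \<in> carrier R" "v \<in> carrier N" for r v
    by (rule gI) (auto simp: linear_map_smult[OF assms(2)] g that)
qed

text \<open>The module axioms are equations, apart from the existence of negatives, so they pass
  along any surjection that respects the operations. Quotient modules are obtained in this
  way.\<close>

lemma module_image:
  assumes M: "module R M"
    and im: "\<pi> ` carrier M = carrier Q"
    and add: "\<And>u v. u \<in> carrier M \<Longrightarrow> v \<in> carrier M \<Longrightarrow> \<pi> u \<oplus>\<^bsub>Q\<^esub> \<pi> v = \<pi> (u \<oplus>\<^bsub>M\<^esub> v)"
    and smult: "\<And>r u. r \<in> carrier R \<Longrightarrow> u \<in> carrier M \<Longrightarrow> r \<odot>\<^bsub>Q\<^esub> \<pi> u = \<pi> (r \<odot>\<^bsub>M\<^esub> u)"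
    and zero: "\<zero>\<^bsub>Q\<^esub> = \<pi> \<zero>\<^bsub>M\<^esub>"
  shows "module R Q"
proof -
  interpret M: module R M by fact
  have rep: "\<exists>u\<in>carrier M. q = \<pi> u" if "q \<in> carrier Q" for q using im that by blast
  have cl: "\<pi> u \<in> carrier Q" if "u \<in> carrier M" for u using im that by blast
  have "abelian_group Q"
  proof (rule abelian_groupI)
    show "\<zero>\<^bsub>Q\<^esub> \<in> carrier Q" by (simp add: zero cl)
    fix p q s
    assume "p \<in> carrier Q" then obtain u where u: "u \<in> carrier M" "p = \<pi> u" using rep by blast
    show "\<zero>\<^bsub>Q\<^esub> \<oplus>\<^bsub>Q\<^esub> p = p" using u by (simp add: zero add)
    have "\<pi> (\<ominus>\<^bsub>M\<^esub> u) \<oplus>\<^bsub>Q\<^esub> p = \<zero>\<^bsub>Q\<^esub>" using u by (simp add: zero add M.M.l_neg)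
    then show "\<exists>y\<in>carrier Q. y \<oplus>\<^bsub>Q\<^esub> p = \<zero>\<^bsub>Q\<^esub>" using u cl by blast
    assume "q \<in> carrier Q" then obtain v where v: "v \<in> carrier M" "q = \<pi> v" using rep by blast
    show "p \<oplus>\<^bsub>Q\<^esub> q \<in> carrier Q" using u v by (simp add: add cl)
    show "p \<oplus>\<^bsub>Q\<^esub> q = q \<oplus>\<^bsub>Q\<^esub> p" using u v by (simp add: add M.M.a_comm)
    assume "s \<in> carrier Q" then obtain w where w: "w \<in> carrier M" "s = \<pi> w" using rep by blast
    show "p \<oplus>\<^bsub>Q\<^esub> q \<oplus>\<^bsub>Q\<^esub> s = p \<oplus>\<^bsub>Q\<^esub> (q \<oplus>\<^bsub>Q\<^esub> s)" using u v w by (simp add: add M.M.a_assoc)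
  qed
  then show ?thesis
  proof (rule moduleI[OF M.R.is_cring])
    fix a b p q
    assume a: "a \<in> carrier R"
    assume "p \<in> carrier Q" then obtain u where u: "u \<in> carrier M" "p = \<pi> u" using rep by blast
    show "a \<odot>\<^bsub>Q\<^esub> p \<in> carrier Q" using a u by (simp add: smult cl)
    { assume b: "b \<in> carrier R"
      show "(a \<oplus>\<^bsub>R\<^esub> b) \<odot>\<^bsub>Q\<^esub> p = a \<odot>\<^bsub>Q\<^esub> p \<oplus>\<^bsub>Q\<^esub> b \<odot>\<^bsub>Q\<^esub> p"
        using a b u by (simp add: smult add M.smult_l_distr)
      show "(a \<otimes>\<^bsub>R\<^esub> b) \<odot>\<^bsub>Q\<^esub> p = a \<odot>\<^bsub>Q\<^esub> (b \<odot>\<^bsub>Q\<^esub> p)"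
        using a b u by (simp add: smult M.smult_assoc1) }
    assume "q \<in> carrier Q" then obtain v where v: "v \<in> carrier M" "q = \<pi> v" using rep by blast
    show "a \<odot>\<^bsub>Q\<^esub> (p \<oplus>\<^bsub>Q\<^esub> q) = a \<odot>\<^bsub>Q\<^esub> p \<oplus>\<^bsub>Q\<^esub> a \<odot>\<^bsub>Q\<^esub> q"
      using a u v by (simp add: smult add M.smult_r_distr)
  next
    fix p assume "p \<in> carrier Q" then obtain u where u: "u \<in> carrier M" "p = \<pi> u" using rep by blast
    show "\<one>\<^bsub>R\<^esub> \<odot>\<^bsub>Q\<^esub> p = p" using u by (simp add: smult)
  qed
qed

section \<open>Free modules\<close>

lemma free_module_simps [simp]:
  "\<zero>\<^bsub>free_module R S\<^esub> = (\<lambda>s. \<zero>\<^bsub>R\<^esub>)"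
  "f \<oplus>\<^bsub>free_module R S\<^esub> g = (\<lambda>s. f s \<oplus>\<^bsub>R\<^esub> g s)"
  "r \<odot>\<^bsub>free_module R S\<^esub> f = (\<lambda>s. r \<otimes>\<^bsub>R\<^esub> f s)"
  by (auto simp: free_module_def)

lemma free_module_carrier:
  "f \<in> carrier (free_module R S) \<longleftrightarrow>
     (\<forall>s\<in>S. f s \<in> carrier R) \<and> (\<forall>s. s \<notin> S \<longrightarrow> f s = \<zero>\<^bsub>R\<^esub>) \<and> finite {s. f s \<noteq> \<zero>\<^bsub>R\<^esub>}"
  by (auto simp: free_module_def)

text \<open>The sum in \<open>lift_over\<close> for a given representative. Linearity is proved for
  it on the free module, where no choice interferes; independence of the representative comes
  afterwards.\<close>

definition free_lift ::
  "('k, 'r) ring_scheme \<Rightarrow> ('k, 'p, 's) module_scheme \<Rightarrow> ('a \<Rightarrow> 'p) \<Rightarrow> ('a \<Rightarrow> 'k) \<Rightarrow> 'p" where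
  "free_lift R P \<beta> f = (\<Oplus>\<^bsub>P\<^esub> s \<in> {s. f s \<noteq> \<zero>\<^bsub>R\<^esub>}. f s \<odot>\<^bsub>P\<^esub> \<beta> s)"

context cring begin

lemma free_module_coeff:
  "f \<in> carrier (free_module R S) \<Longrightarrow> f s \<in> carrier R"
  by (cases "s \<in> S") (auto simp: free_module_carrier)

lemma free_module_add_closed:
  assumes "f \<in> carrier (free_module R S)" "g \<in> carrier (free_module R S)"
  shows "(\<lambda>s. f s \<oplus> g s) \<in> carrier (free_module R S)"
proof -
  have "{s. f s \<oplus> g s \<noteq> \<zero>} \<subseteq> {s. f s \<noteq> \<zero>} \<union> {s. g s \<noteq> \<zero>}" by auto
  then show ?thesis using assms
    by (auto simp: free_module_carrier intro: finite_subset)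
qed

lemma free_module_smult_closed:
  assumes "r \<in> carrier R" "f \<in> carrier (free_module R S)"
  shows "(\<lambda>s. r \<otimes> f s) \<in> carrier (free_module R S)"
proof -
  have "{s. r \<otimes> f s \<noteq> \<zero>} \<subseteq> {s. f s \<noteq> \<zero>}" using assms by auto
  then show ?thesis using assms
    by (auto simp: free_module_carrier intro: finite_subset)
qed

lemma free_module_is_module: "module R (free_module R S)"
proof (rule moduleI)
  show "cring R" by (rule is_cring)
  note c = free_module_coeff[where S = S]
  show "abelian_group (free_module R S)"
  proof (rule abelian_groupI, goal_cases)
    case (6 f)
    have "{s. \<ominus> f s \<noteq> \<zero>} \<subseteq> {s. f s \<noteq> \<zero>}" by auto
    then have "(\<lambda>s. \<ominus> f s) \<in> carrier (free_module R S)" using 6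
      by (auto simp: free_module_carrier intro: finite_subset)
    then show ?case using c[OF 6] by (auto simp: l_neg fun_eq_iff intro!: bexI[of _ "\<lambda>s. \<ominus> f s"])
  qed (auto simp: free_module_add_closed c a_ac fun_eq_iff, auto simp: free_module_carrier)
qed (auto simp: free_module_smult_closed l_distr r_distr m_assoc free_module_coeff)

lemma basis_vec_closed: "s \<in> S \<Longrightarrow> basis_vec R s \<in> carrier (free_module R S)"
proof -
  have "{t. basis_vec R s t \<noteq> \<zero>} \<subseteq> {s}" by (auto simp: basis_vec_def)
  then show "s \<in> S \<Longrightarrow> ?thesis"
    by (auto simp: free_module_carrier intro: finite_subset) (auto simp: basis_vec_def)
qed

text \<open>Induction on the support: one nonzero coefficient is cleared, and the function is the
  remainder plus a multiple of a basis vector.\<close>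

lemma free_module_minimal:
  assumes K: "submodule K R (free_module R S)" and e: "\<And>s. s \<in> S \<Longrightarrow> basis_vec R s \<in> K"
    and f: "f \<in> carrier (free_module R S)"
  shows "f \<in> K"
proof -
  interpret F: module R "free_module R S" by (rule free_module_is_module)
  have "finite {s. f s \<noteq> \<zero>}" using f by (simp add: free_module_carrier)
  then have "f \<in> carrier (free_module R S) \<Longrightarrow> ?thesis"
  proof (induction "{s. f s \<noteq> \<zero>}" arbitrary: f rule: finite_induct)
    case empty
    then have "f = \<zero>\<^bsub>free_module R S\<^esub>" by auto
    then show ?case using subgroup.one_closed[OF submodule.axioms(1)[OF K]] by simp
  next
    case (insert s T)
    have fs: "f s \<noteq> \<zero>" using insert.hyps(4) by auto
    then have s: "s \<in> S" using insert.prems by (auto simp: free_module_carrier)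
    let ?g = "f(s := \<zero>)"
    have T: "T = {t. ?g t \<noteq> \<zero>}" using insert.hyps(2,4) by auto
    have g: "?g \<in> carrier (free_module R S)"
      using insert.prems insert.hyps(1) T by (auto simp: free_module_carrier)
    have 1: "?g \<in> K" using insert.hyps(3)[OF T g] .
    have "f s \<odot>\<^bsub>free_module R S\<^esub> basis_vec R s \<in> K"
      by (rule F.submoduleE(4)[OF K free_module_coeff[OF insert.prems] e[OF s]])
    then have "?g \<oplus>\<^bsub>free_module R S\<^esub> (f s \<odot>\<^bsub>free_module R S\<^esub> basis_vec R s) \<in> K"
      by (rule F.submoduleE(5)[OF K 1])
    moreover have "?g \<oplus>\<^bsub>free_module R S\<^esub> (f s \<odot>\<^bsub>free_module R S\<^esub> basis_vec R s) = f"
      using free_module_coeff[OF insert.prems] by (auto simp: basis_vec_def)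
    ultimately show ?case by simp
  qed
  then show ?thesis using f by blast
qed

text \<open>Links generation with uniqueness: fed into a minimality lemma such as
  \<open>free_module_minimal\<close>, it shows that linear maps which agree on generators agree
  everywhere.\<close>

lemma equalizer_submodule:
  assumes M: "module R M" and P: "module R P" and F: "linear_map R M P F" and G: "linear_map R M P G"
  shows "submodule {u \<in> carrier M. F u = G u} R M"
proof -
  interpret M: module R M by fact
  interpret P: module R P by fact
  \<comment> \<open>Negation is treated as scaling by minus one, since \<open>linear_map\<close>
    speaks only of sums and multiples.\<close>
  have neg: "H (\<ominus>\<^bsub>M\<^esub> u) = \<ominus>\<^bsub>P\<^esub> H u" if "linear_map R M P H" "u \<in> carrier M" for H u
  proof -
    have "H (\<ominus>\<^bsub>M\<^esub> u) = H ((\<ominus> \<one>) \<odot>\<^bsub>M\<^esub> u)" using that(2) by (simp add: M.smult_l_minus)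
    then show ?thesis using that by (simp add: linear_map_smult linear_map_closed P.smult_l_minus)
  qed
  show ?thesis
    by (rule M.submoduleI)
      (auto simp: linear_map_zero[OF M P F] linear_map_zero[OF M P G] neg[OF F] neg[OF G]
        linear_map_add[OF F] linear_map_add[OF G] linear_map_smult[OF F] linear_map_smult[OF G])
qed

lemma free_module_agree:
  assumes P: "module R P" and F: "linear_map R (free_module R S) P F" and G: "linear_map R (free_module R S) P G"
    and eq: "\<And>s. s \<in> S \<Longrightarrow> F (basis_vec R s) = G (basis_vec R s)"
    and f: "f \<in> carrier (free_module R S)"
  shows "F f = G f"
proof -
  have "f \<in> {u \<in> carrier (free_module R S). F u = G u}"
    by (rule free_module_minimal[OF equalizer_submodule[OF free_module_is_module P F G] _ f])
      (simp add: eq basis_vec_closed)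
  then show ?thesis by simp
qed

text \<open>The added terms have coefficient zero. A common finite superset is what allows the sums
  for two functions and for their sum, whose supports differ, to be compared.\<close>

lemma free_lift_superset:
  assumes P: "module R P" and \<beta>: "\<And>s. s \<in> S \<Longrightarrow> \<beta> s \<in> carrier P"
    and f: "f \<in> carrier (free_module R S)" and T: "finite T" "T \<subseteq> S" "{s. f s \<noteq> \<zero>} \<subseteq> T"
  shows "free_lift R P \<beta> f = (\<Oplus>\<^bsub>P\<^esub> s \<in> T. f s \<odot>\<^bsub>P\<^esub> \<beta> s)"
proof -
  interpret P: module R P by fact
  show ?thesis unfolding free_lift_def
    by (rule P.M.add.finprod_mono_neutral_cong_left)
      (use T \<beta>[OF subsetD[OF T(2)]] free_module_coeff[OF f] in \<open>auto intro!: P.smult_closed P.smult_l_null\<close>)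
qed

lemma free_lift_linear:
  assumes P: "module R P" and \<beta>: "\<And>s. s \<in> S \<Longrightarrow> \<beta> s \<in> carrier P"
  shows "linear_map R (free_module R S) P (free_lift R P \<beta>)"
proof -
  interpret P: module R P by fact
  interpret F: module R "free_module R S" by (rule free_module_is_module)
  have supp: "{s. f s \<noteq> \<zero>} \<subseteq> S" "finite {s. f s \<noteq> \<zero>}" if "f \<in> carrier (free_module R S)" for f
    using that by (auto simp: free_module_carrier)
  note c = free_module_coeff[where S = S]
  show ?thesis
  proof (rule linear_mapI)
    fix f assume f: "f \<in> carrier (free_module R S)"
    show "free_lift R P \<beta> f \<in> carrier P"
      unfolding free_lift_def using supp[OF f] \<beta> c[OF f] by (intro P.M.finsum_closed) auto
    { fix r assume r: "r \<in> carrier R"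
      have rf: "r \<odot>\<^bsub>free_module R S\<^esub> f \<in> carrier (free_module R S)" using f r by (rule F.smult_closed[rotated])
      have "free_lift R P \<beta> (r \<odot>\<^bsub>free_module R S\<^esub> f) = (\<Oplus>\<^bsub>P\<^esub> s \<in> {s. f s \<noteq> \<zero>}. (r \<odot>\<^bsub>free_module R S\<^esub> f) s \<odot>\<^bsub>P\<^esub> \<beta> s)"
        using supp[OF f] r by (intro free_lift_superset[OF P \<beta> rf]) auto
      also have "\<dots> = (\<Oplus>\<^bsub>P\<^esub> s \<in> {s. f s \<noteq> \<zero>}. r \<odot>\<^bsub>P\<^esub> (f s \<odot>\<^bsub>P\<^esub> \<beta> s))"
        using r c[OF f] \<beta> supp[OF f] by (intro P.M.finsum_cong') (auto simp: P.smult_assoc1)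
      also have "\<dots> = r \<odot>\<^bsub>P\<^esub> free_lift R P \<beta> f"
        unfolding free_lift_def using r c[OF f] \<beta> supp[OF f]
        by (intro P.finsum_smult_ldistr[symmetric]) auto
      finally show "free_lift R P \<beta> (r \<odot>\<^bsub>free_module R S\<^esub> f) = r \<odot>\<^bsub>P\<^esub> free_lift R P \<beta> f" . }
    fix g assume g: "g \<in> carrier (free_module R S)"
    let ?T = "{s. f s \<noteq> \<zero>} \<union> {s. g s \<noteq> \<zero>}"
    have T: "finite ?T" "?T \<subseteq> S" using supp[OF f] supp[OF g] by auto
    have fg: "f \<oplus>\<^bsub>free_module R S\<^esub> g \<in> carrier (free_module R S)" using f g by (rule F.M.a_closed)
    have "free_lift R P \<beta> (f \<oplus>\<^bsub>free_module R S\<^esub> g) = (\<Oplus>\<^bsub>P\<^esub> s \<in> ?T. (f \<oplus>\<^bsub>free_module R S\<^esub> g) s \<odot>\<^bsub>P\<^esub> \<beta> s)"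
      by (rule free_lift_superset[OF P \<beta> fg T]) auto
    also have "\<dots> = (\<Oplus>\<^bsub>P\<^esub> s \<in> ?T. f s \<odot>\<^bsub>P\<^esub> \<beta> s \<oplus>\<^bsub>P\<^esub> g s \<odot>\<^bsub>P\<^esub> \<beta> s)"
      using T c[OF f] c[OF g] \<beta> by (intro P.M.finsum_cong') (auto simp: P.smult_l_distr)
    also have "\<dots> = (\<Oplus>\<^bsub>P\<^esub> s \<in> ?T. f s \<odot>\<^bsub>P\<^esub> \<beta> s) \<oplus>\<^bsub>P\<^esub> (\<Oplus>\<^bsub>P\<^esub> s \<in> ?T. g s \<odot>\<^bsub>P\<^esub> \<beta> s)"
      using T c[OF f] c[OF g] \<beta> by (intro P.M.finsum_addf) auto
    also have "\<dots> = free_lift R P \<beta> f \<oplus>\<^bsub>P\<^esub> free_lift R P \<beta> g"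
      using free_lift_superset[OF P \<beta> f T] free_lift_superset[OF P \<beta> g T] by auto
    finally show "free_lift R P \<beta> (f \<oplus>\<^bsub>free_module R S\<^esub> g) = free_lift R P \<beta> f \<oplus>\<^bsub>P\<^esub> free_lift R P \<beta> g" .
  qed
qed

lemma free_lift_basis_vec:
  assumes P: "module R P" and \<beta>: "\<And>s. s \<in> S \<Longrightarrow> \<beta> s \<in> carrier P" and s: "s \<in> S"
  shows "free_lift R P \<beta> (basis_vec R s) = \<beta> s"
proof -
  interpret P: module R P by fact
  have "free_lift R P \<beta> (basis_vec R s) = (\<Oplus>\<^bsub>P\<^esub> t \<in> {s}. basis_vec R s t \<odot>\<^bsub>P\<^esub> \<beta> t)"
    using s by (intro free_lift_superset[where S = S and \<beta> = \<beta>, OF P \<beta> basis_vec_closed[OF s]]) (auto simp: basis_vec_def)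
  also have "\<dots> = \<beta> s" using \<beta>[OF s] by (subst P.M.finsum_insert) (auto simp: basis_vec_def)
  finally show ?thesis .
qed

end

section \<open>Quotient modules\<close>

lemma (in module) submodule_span_is_submodule:
  assumes "X \<subseteq> carrier M"
  shows "submodule (submodule_span R M X) R M"
proof (rule submoduleI)
  have c: "submodule (carrier M) R M" by (rule carrier_is_submodule)
  then show "submodule_span R M X \<subseteq> carrier M" using assms by (auto simp: submodule_span_def)
  show "\<zero>\<^bsub>M\<^esub> \<in> submodule_span R M X"
    by (auto simp: submodule_span_def submodule_def dest: subgroup.one_closed)
qed (auto simp: submodule_span_def intro: submoduleE)

lemma (in module) submodule_span_superset: "X \<subseteq> submodule_span R M X"
  by (auto simp: submodule_span_def)

lemma (in module) submodule_span_minimal: "\<lbrakk>submodule H R M; X \<subseteq> H\<rbrakk> \<Longrightarrow>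
    submodule_span R M X \<subseteq> H"
  by (auto simp: submodule_span_def)

context module begin

lemma submodule_abelian_subgroup:
  assumes "submodule H R M" shows "abelian_subgroup H M"
  using assms M.abelian_group_axioms
  by (intro abelian_subgroupI3 additive_subgroup.intro) (auto simp: submodule_def)

lemma submodule_coset_eq:
  assumes H: "submodule H R M" and u: "u \<in> carrier M" and v: "v \<in> carrier M"
  shows "H +>\<^bsub>M\<^esub> u = H +>\<^bsub>M\<^esub> v \<longleftrightarrow> u \<ominus>\<^bsub>M\<^esub> v \<in> H"
proof -
  interpret H: abelian_subgroup H M by (rule submodule_abelian_subgroup[OF H])
  have sub: "subgroup H (add_monoid M)" using H by (simp add: submodule_def)
  have "u \<in> H +>\<^bsub>M\<^esub> v \<longleftrightarrow> u \<ominus>\<^bsub>M\<^esub> v \<in> H"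
    using H.a_rcos_module[OF v u] by (simp add: M.minus_eq)
  moreover have "H +>\<^bsub>M\<^esub> u = H +>\<^bsub>M\<^esub> v \<longleftrightarrow> u \<in> H +>\<^bsub>M\<^esub> v"
    using M.a_repr_independence[OF _ v sub] H.a_rcos_self[OF u] by auto
  ultimately show ?thesis by simp
qed

lemma quot_module_proj:
  assumes H: "submodule H R M"
  shows "module R (quot_module M H)" (is ?mod)
    and "linear_map R M (quot_module M H) (\<lambda>u. H +>\<^bsub>M\<^esub> u)" (is ?lin)
    and "carrier (quot_module M H) = (\<lambda>u. H +>\<^bsub>M\<^esub> u) ` carrier M" (is ?im)
proof -
  interpret H: abelian_subgroup H M by (rule submodule_abelian_subgroup[OF H])
  show im: ?im by (auto simp: quot_module_def A_RCOSETS_def RCOSETS_def a_r_coset_def)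
  have add: "(H +>\<^bsub>M\<^esub> u) \<oplus>\<^bsub>quot_module M H\<^esub> (H +>\<^bsub>M\<^esub> v) = H +>\<^bsub>M\<^esub> (u \<oplus>\<^bsub>M\<^esub> v)"
    if "u \<in> carrier M" "v \<in> carrier M" for u v
    using that by (simp add: quot_module_def H.a_rcos_sum)
  \<comment> \<open>The multiple of a coset is defined as a union over all its members; the cosets
    in that union coincide because \<open>H\<close> is closed under scaling.\<close>
  have smult: "r \<odot>\<^bsub>quot_module M H\<^esub> (H +>\<^bsub>M\<^esub> u) = H +>\<^bsub>M\<^esub> (r \<odot>\<^bsub>M\<^esub> u)"
    if r: "r \<in> carrier R" and u: "u \<in> carrier M" for r u
  proof -
    have "H +>\<^bsub>M\<^esub> (r \<odot>\<^bsub>M\<^esub> v) = H +>\<^bsub>M\<^esub> (r \<odot>\<^bsub>M\<^esub> u)" if v: "v \<in> H +>\<^bsub>M\<^esub> u" for v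
    proof -
      have vM: "v \<in> carrier M" using v u H.a_elemrcos_carrier by blast
      have "v \<ominus>\<^bsub>M\<^esub> u \<in> H" using v H.a_rcos_module[OF u vM] by (simp add: M.minus_eq)
      then have "r \<odot>\<^bsub>M\<^esub> (v \<ominus>\<^bsub>M\<^esub> u) \<in> H" using submoduleE(4)[OF H r] by blast
      then have "r \<odot>\<^bsub>M\<^esub> v \<ominus>\<^bsub>M\<^esub> r \<odot>\<^bsub>M\<^esub> u \<in> H"
        using r u vM by (simp add: M.minus_eq smult_r_distr smult_r_minus)
      then show ?thesis using submodule_coset_eq[OF H] r u vM by blast
    qed
    moreover have "u \<in> H +>\<^bsub>M\<^esub> u" using u H.a_rcos_self by blast
    ultimately have "(\<Union>f\<in>H +>\<^bsub>M\<^esub> u. H +>\<^bsub>M\<^esub> (r \<odot>\<^bsub>M\<^esub> f)) = H +>\<^bsub>M\<^esub> (r \<odot>\<^bsub>M\<^esub> u)"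
      by blast
    then show ?thesis by (simp add: quot_module_def)
  qed
  have "H = H +>\<^bsub>M\<^esub> \<zero>\<^bsub>M\<^esub>"
    using H.a_subset by (auto simp: a_r_coset_def r_coset_def)
  then have zero: "\<zero>\<^bsub>quot_module M H\<^esub> = H +>\<^bsub>M\<^esub> \<zero>\<^bsub>M\<^esub>" by (simp add: quot_module_def)
  show ?mod
    by (rule module_image[OF module_axioms, where \<pi> = "\<lambda>u. H +>\<^bsub>M\<^esub> u"])
      (simp_all add: im add smult zero)
  show ?lin by (rule linear_mapI) (simp_all add: im add smult)
qed

end

section \<open>Tensor products over an algebra\<close>

text \<open>The condition under which the extension of \<beta> to the free module kills
  \<open>tensor_rels\<close>.\<close>

definition balanced_map ::
  "('k, 'r) ring_scheme \<Rightarrow> 'b set \<Rightarrow> ('k, 'm, 's) module_scheme \<Rightarrow> ('m \<Rightarrow> 'b \<Rightarrow> 'm) \<Rightarrow>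
   ('k, 'n, 't) module_scheme \<Rightarrow> ('b \<Rightarrow> 'n \<Rightarrow> 'n) \<Rightarrow> ('k, 'p, 'u) module_scheme \<Rightarrow> ('m \<Rightarrow> 'n \<Rightarrow> 'p) \<Rightarrow> bool" where
  "balanced_map R B M ra N la P \<beta> \<longleftrightarrow>
     (\<forall>m\<in>carrier M. linear_map R N P (\<beta> m)) \<and>
     (\<forall>n\<in>carrier N. linear_map R M P (\<lambda>m. \<beta> m n)) \<and>
     (\<forall>m\<in>carrier M. \<forall>b\<in>B. \<forall>n\<in>carrier N. \<beta> (ra m b) n = \<beta> m (la b n))"

locale tensor_factors = M: module R M + N: module R N
  for R :: "('k, 'r) ring_scheme" (structure) and B :: "'b set"
    and M :: "('k, 'm, 's) module_scheme" and ra :: "'m \<Rightarrow> 'b \<Rightarrow> 'm"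
    and N :: "('k, 'n, 't) module_scheme" and la :: "'b \<Rightarrow> 'n \<Rightarrow> 'n" +
  assumes ra_closed: "\<lbrakk>m \<in> carrier M; b \<in> B\<rbrakk> \<Longrightarrow> ra m b \<in> carrier M"
    and la_closed: "\<lbrakk>b \<in> B; n \<in> carrier N\<rbrakk> \<Longrightarrow> la b n \<in> carrier N"
begin

abbreviation "FM \<equiv> free_module R (carrier M \<times> carrier N)"
abbreviation "Null \<equiv> tensor_null R B M ra N la"
abbreviation "Ten \<equiv> tensor_over R B M ra N la"

definition pt :: "'m \<Rightarrow> 'n \<Rightarrow> ('m \<times> 'n \<Rightarrow> 'k) set" where
  "pt m n = Null +>\<^bsub>FM\<^esub> basis_vec R (m, n)"

lemma FM: "module R FM"
  by (rule M.R.free_module_is_module)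

interpretation F: module R FM by (rule FM)

lemma e_closed: "\<lbrakk>m \<in> carrier M; n \<in> carrier N\<rbrakk> \<Longrightarrow>
    basis_vec R (m, n) \<in> carrier FM"
  by (rule M.R.basis_vec_closed) simp

lemma tensor_rels_closed: "tensor_rels R B M ra N la \<subseteq> carrier FM"
proof -
  note [simp del] = free_module_simps
  show ?thesis
    unfolding tensor_rels_def Let_def
    by (auto intro!: F.M.minus_closed F.M.a_closed F.smult_closed e_closed ra_closed la_closed
      M.M.a_closed N.M.a_closed M.smult_closed N.smult_closed)
qed

lemma Null_submodule: "submodule Null R FM"
  unfolding tensor_null_def by (rule F.submodule_span_is_submodule[OF tensor_rels_closed])

lemma Ten_module: "module R Ten"
  unfolding tensor_over_def by (rule F.quot_module_proj(1)[OF Null_submodule])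

lemma proj_linear: "linear_map R FM Ten (\<lambda>f. Null +>\<^bsub>FM\<^esub> f)"
  unfolding tensor_over_def by (rule F.quot_module_proj(2)[OF Null_submodule])

lemma carrier_Ten: "carrier Ten = (\<lambda>f. Null +>\<^bsub>FM\<^esub> f) ` carrier FM"
  unfolding tensor_over_def by (rule F.quot_module_proj(3)[OF Null_submodule])

interpretation T: module R Ten by (rule Ten_module)

lemma proj_eqI:
  assumes "u \<ominus>\<^bsub>FM\<^esub> v \<in> tensor_rels R B M ra N la" "u \<in> carrier FM" "v \<in> carrier FM"
  shows "Null +>\<^bsub>FM\<^esub> u = Null +>\<^bsub>FM\<^esub> v"
  using assms F.submodule_span_superset[of "tensor_rels R B M ra N la"]
    F.submodule_coset_eq[OF Null_submodule] by (auto simp: tensor_null_def)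

lemma tensor_relsI:
  "\<lbrakk>m \<in> carrier M; m' \<in> carrier M; n \<in> carrier N\<rbrakk> \<Longrightarrow>
     basis_vec R (m \<oplus>\<^bsub>M\<^esub> m', n) \<ominus>\<^bsub>FM\<^esub> (basis_vec R (m, n) \<oplus>\<^bsub>FM\<^esub> basis_vec R (m', n)) \<in> tensor_rels R B M ra N la"
  "\<lbrakk>m \<in> carrier M; n \<in> carrier N; n' \<in> carrier N\<rbrakk> \<Longrightarrow>
     basis_vec R (m, n \<oplus>\<^bsub>N\<^esub> n') \<ominus>\<^bsub>FM\<^esub> (basis_vec R (m, n) \<oplus>\<^bsub>FM\<^esub> basis_vec R (m, n')) \<in> tensor_rels R B M ra N la"
  "\<lbrakk>r \<in> carrier R; m \<in> carrier M; n \<in> carrier N\<rbrakk> \<Longrightarrow>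
     basis_vec R (r \<odot>\<^bsub>M\<^esub> m, n) \<ominus>\<^bsub>FM\<^esub> (r \<odot>\<^bsub>FM\<^esub> basis_vec R (m, n)) \<in> tensor_rels R B M ra N la"
  "\<lbrakk>r \<in> carrier R; m \<in> carrier M; n \<in> carrier N\<rbrakk> \<Longrightarrow>
     basis_vec R (m, r \<odot>\<^bsub>N\<^esub> n) \<ominus>\<^bsub>FM\<^esub> (r \<odot>\<^bsub>FM\<^esub> basis_vec R (m, n)) \<in> tensor_rels R B M ra N la"
  "\<lbrakk>m \<in> carrier M; b \<in> B; n \<in> carrier N\<rbrakk> \<Longrightarrow>
     basis_vec R (ra m b, n) \<ominus>\<^bsub>FM\<^esub> basis_vec R (m, la b n) \<in> tensor_rels R B M ra N la"
  unfolding tensor_rels_def Let_def by blast+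

lemma pt_balanced: "balanced_map R B M ra N la Ten pt"
proof -
  note [simp del] = free_module_simps
  note add = linear_map_add[OF proj_linear, symmetric] and smult = linear_map_smult[OF proj_linear, symmetric]
  have "linear_map R N Ten (pt m)" if m: "m \<in> carrier M" for m
  proof (rule linear_mapI)
    show "pt m n \<in> carrier Ten" if "n \<in> carrier N" for n
      using m that e_closed by (auto simp: pt_def carrier_Ten)
    show "pt m (n \<oplus>\<^bsub>N\<^esub> n') = pt m n \<oplus>\<^bsub>Ten\<^esub> pt m n'" if "n \<in> carrier N" "n' \<in> carrier N" for n n'
      unfolding pt_def add[OF e_closed[OF m that(1)] e_closed[OF m that(2)]]
      by (rule proj_eqI) (use m that in \<open>auto intro!: tensor_relsI e_closed F.M.a_closed N.M.a_closed\<close>)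
    show "pt m (r \<odot>\<^bsub>N\<^esub> n) = r \<odot>\<^bsub>Ten\<^esub> pt m n" if "r \<in> carrier R" "n \<in> carrier N" for r n
      unfolding pt_def smult[OF that(1) e_closed[OF m that(2)]]
      by (rule proj_eqI) (use m that in \<open>auto intro!: tensor_relsI e_closed F.smult_closed N.smult_closed\<close>)
  qed
  moreover have "linear_map R M Ten (\<lambda>m. pt m n)" if n: "n \<in> carrier N" for n
  proof (rule linear_mapI)
    show "pt m n \<in> carrier Ten" if "m \<in> carrier M" for m
      using n that e_closed by (auto simp: pt_def carrier_Ten)
    show "pt (m \<oplus>\<^bsub>M\<^esub> m') n = pt m n \<oplus>\<^bsub>Ten\<^esub> pt m' n" if "m \<in> carrier M" "m' \<in> carrier M" for m m'
      unfolding pt_def add[OF e_closed[OF that(1) n] e_closed[OF that(2) n]]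
      by (rule proj_eqI) (use n that in \<open>auto intro!: tensor_relsI e_closed F.M.a_closed M.M.a_closed\<close>)
    show "pt (r \<odot>\<^bsub>M\<^esub> m) n = r \<odot>\<^bsub>Ten\<^esub> pt m n" if "r \<in> carrier R" "m \<in> carrier M" for r m
      unfolding pt_def smult[OF that(1) e_closed[OF that(2) n]]
      by (rule proj_eqI) (use n that in \<open>auto intro!: tensor_relsI e_closed F.smult_closed M.smult_closed\<close>)
  qed
  moreover have "pt (ra m b) n = pt m (la b n)" if "m \<in> carrier M" "b \<in> B" "n \<in> carrier N" for m b n
    unfolding pt_def
    by (rule proj_eqI) (use that in \<open>auto intro!: tensor_relsI e_closed ra_closed la_closed\<close>)
  ultimately show ?thesis by (simp add: balanced_map_def)
qed

lemma pt_closed: "\<lbrakk>m \<in> carrier M; n \<in> carrier N\<rbrakk> \<Longrightarrow> pt m n \<in> carrier Ten"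
  using pt_balanced by (auto simp: balanced_map_def dest: linear_map_closed)

text \<open>Uniqueness in the universal property: every class comes from the free module, where the
  basis vectors decide.\<close>

lemma Ten_agree:
  assumes P: "module R P" and f: "linear_map R Ten P f" and g: "linear_map R Ten P g"
    and eq: "\<And>m n. m \<in> carrier M \<Longrightarrow> n \<in> carrier N \<Longrightarrow> f (pt m n) = g (pt m n)"
    and t: "t \<in> carrier Ten"
  shows "f t = g t"
proof -
  obtain u where u: "u \<in> carrier FM" "t = Null +>\<^bsub>FM\<^esub> u" using t carrier_Ten by auto
  have "f (Null +>\<^bsub>FM\<^esub> u) = g (Null +>\<^bsub>FM\<^esub> u)"
    by (rule M.R.free_module_agree[OF P linear_map_compose[OF proj_linear f] linear_map_compose[OF proj_linear g] _ u(1)])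
      (use eq in \<open>auto simp: pt_def\<close>)
  then show ?thesis by (simp add: u)
qed

context
  fixes P :: "('k, 'p, 'u) module_scheme" and \<beta> :: "'m \<Rightarrow> 'n \<Rightarrow> 'p"
  assumes P: "module R P" and \<beta>: "balanced_map R B M ra N la P \<beta>"
begin

interpretation P: module R P by (rule P)

private abbreviation "E \<equiv> free_lift R P (\<lambda>s. \<beta> (fst s) (snd s))"

lemma \<beta>_closed: "\<lbrakk>m \<in> carrier M; n \<in> carrier N\<rbrakk> \<Longrightarrow> \<beta> m n \<in> carrier P"
  using \<beta> by (auto simp: balanced_map_def dest: linear_map_closed)

lemma E_linear: "linear_map R FM P E"
  by (rule M.R.free_lift_linear[OF P]) (auto simp: \<beta>_closed)

lemma E_basis: "\<lbrakk>m \<in> carrier M; n \<in> carrier N\<rbrakk> \<Longrightarrow>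
    E (basis_vec R (m, n)) = \<beta> m n"
  by (subst M.R.free_lift_basis_vec[OF P, where S = "carrier M \<times> carrier N"]) (auto simp: \<beta>_closed)

lemma E_minus: "\<lbrakk>u \<in> carrier FM; v \<in> carrier FM\<rbrakk> \<Longrightarrow>
    E (u \<ominus>\<^bsub>FM\<^esub> v) = E u \<ominus>\<^bsub>P\<^esub> E v"
proof -
  assume uv: "u \<in> carrier FM" "v \<in> carrier FM"
  have "u \<ominus>\<^bsub>FM\<^esub> v = u \<oplus>\<^bsub>FM\<^esub> ((\<ominus> \<one>) \<odot>\<^bsub>FM\<^esub> v)"
    using uv F.smult_l_minus[of \<one> v] by (simp add: F.M.minus_eq del: free_module_simps)
  then have "E (u \<ominus>\<^bsub>FM\<^esub> v) = E u \<oplus>\<^bsub>P\<^esub> ((\<ominus> \<one>) \<odot>\<^bsub>P\<^esub> E v)"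
    using uv by (simp add: linear_map_add[OF E_linear] linear_map_smult[OF E_linear] del: free_module_simps)
  then show ?thesis
    using uv linear_map_closed[OF E_linear] by (simp add: P.smult_l_minus P.M.minus_eq)
qed

text \<open>The kernel of \<open>E\<close> is a submodule, and bilinearity and balancing of \<beta>
  place each of the five families of relations in it; the span, being minimal, follows.\<close>

lemma E_Null: "u \<in> Null \<Longrightarrow> E u = \<zero>\<^bsub>P\<^esub>"
proof -
  note [simp del] = free_module_simps
  have K: "submodule {u \<in> carrier FM. E u = \<zero>\<^bsub>P\<^esub>} R FM"
    by (rule M.R.equalizer_submodule[OF FM P E_linear linear_map_const_zero[OF P]])
  have l: "\<And>m. m \<in> carrier M \<Longrightarrow> linear_map R N P (\<beta> m)" "\<And>n. n \<in> carrier N \<Longrightarrow> linear_map R M P (\<lambda>m. \<beta> m n)"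
    "\<And>m b n. m \<in> carrier M \<Longrightarrow> b \<in> B \<Longrightarrow> n \<in> carrier N \<Longrightarrow> \<beta> (ra m b) n = \<beta> m (la b n)"
    using \<beta> by (auto simp: balanced_map_def)
  have self: "p \<ominus>\<^bsub>P\<^esub> p = \<zero>\<^bsub>P\<^esub>" if "p \<in> carrier P" for p using that by (simp add: P.M.minus_eq P.M.r_neg)
  have "tensor_rels R B M ra N la \<subseteq> {u \<in> carrier FM. E u = \<zero>\<^bsub>P\<^esub>}"
  proof
    fix u assume u: "u \<in> tensor_rels R B M ra N la"
    then have "u \<in> carrier FM" using tensor_rels_closed by auto
    moreover have "E u = \<zero>\<^bsub>P\<^esub>" using u unfolding tensor_rels_def Let_def
      by (auto simp: E_minus E_basis linear_map_add[OF E_linear] linear_map_smult[OF E_linear] e_closed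
          linear_map_add[OF l(1)] linear_map_smult[OF l(1)] linear_map_add[OF l(2)] linear_map_smult[OF l(2)]
          l(3) ra_closed la_closed \<beta>_closed self)
    ultimately show "u \<in> {u \<in> carrier FM. E u = \<zero>\<^bsub>P\<^esub>}" by simp
  qed
  then have "Null \<subseteq> {u \<in> carrier FM. E u = \<zero>\<^bsub>P\<^esub>}"
    unfolding tensor_null_def by (rule F.submodule_span_minimal[OF K])
  then show "u \<in> Null \<Longrightarrow> E u = \<zero>\<^bsub>P\<^esub>" by auto
qed

text \<open>The choice operator in \<open>lift_over\<close> is discharged here: the chosen
  representative differs from \<open>u\<close> by an element of \<open>Null\<close>, on which
  \<open>E\<close> vanishes.\<close>

lemma lift_over_coset: "u \<in> carrier FM \<Longrightarrow> lift_over R P \<beta> (Null +>\<^bsub>FM\<^esub> u) = E u"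
proof -
  assume u: "u \<in> carrier FM"
  interpret H: abelian_subgroup Null FM by (rule F.submodule_abelian_subgroup[OF Null_submodule])
  define v where "v = (SOME f. f \<in> Null +>\<^bsub>FM\<^esub> u)"
  have vin: "v \<in> Null +>\<^bsub>FM\<^esub> u" unfolding v_def by (rule someI[where P = "\<lambda>f. f \<in> Null +>\<^bsub>FM\<^esub> u", OF H.a_rcos_self[OF u]])
  have v: "v \<in> carrier FM" by (rule H.a_elemrcos_carrier[OF u vin])
  have "v \<ominus>\<^bsub>FM\<^esub> u \<in> Null" using H.a_rcos_module[OF u v] vin by (simp add: F.M.minus_eq del: free_module_simps)
  then have "E v \<ominus>\<^bsub>P\<^esub> E u = \<zero>\<^bsub>P\<^esub>" using E_Null E_minus[OF v u] by simp
  then have "E v = E u"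
    using P.M.minus_equality[of "E v" "\<ominus>\<^bsub>P\<^esub> E u"] u v linear_map_closed[OF E_linear] by (simp add: P.M.minus_eq)
  moreover have "lift_over R P \<beta> (Null +>\<^bsub>FM\<^esub> u) = E v"
    by (simp add: lift_over_def free_lift_def v_def Let_def)
  ultimately show ?thesis by simp
qed

lemma lift_over_pt: "\<lbrakk>m \<in> carrier M; n \<in> carrier N\<rbrakk> \<Longrightarrow>
    lift_over R P \<beta> (pt m n) = \<beta> m n"
  by (simp add: pt_def lift_over_coset e_closed E_basis)

lemma lift_over_linear: "linear_map R Ten P (lift_over R P \<beta>)"
proof (rule linear_mapI)
  note [simp del] = free_module_simps
  note add = linear_map_add[OF proj_linear, symmetric] and smult = linear_map_smult[OF proj_linear, symmetric]
  fix t assume "t \<in> carrier Ten"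
  then obtain u where u: "u \<in> carrier FM" "t = Null +>\<^bsub>FM\<^esub> u" using carrier_Ten by auto
  show "lift_over R P \<beta> t \<in> carrier P" using u by (simp add: lift_over_coset linear_map_closed[OF E_linear])
  show "lift_over R P \<beta> (r \<odot>\<^bsub>Ten\<^esub> t) = r \<odot>\<^bsub>P\<^esub> lift_over R P \<beta> t" if "r \<in> carrier R" for r
    using u that by (simp add: smult lift_over_coset linear_map_smult[OF E_linear])
  fix t' assume "t' \<in> carrier Ten"
  then obtain u' where u': "u' \<in> carrier FM" "t' = Null +>\<^bsub>FM\<^esub> u'" using carrier_Ten by auto
  show "lift_over R P \<beta> (t \<oplus>\<^bsub>Ten\<^esub> t') = lift_over R P \<beta> t \<oplus>\<^bsub>P\<^esub> lift_over R P \<beta> t'"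
    using u u' by (simp add: add lift_over_coset linear_map_add[OF E_linear])
qed

end

end

section \<open>Direct sums\<close>

locale module_family = R?: cring R for R :: "('k, 'r) ring_scheme" (structure) +
  fixes I :: "'i set" and M :: "'i \<Rightarrow> ('k, 'a, 's) module_scheme"
  assumes modules: "i \<in> I \<Longrightarrow> module R (M i)"
begin

abbreviation "DS \<equiv> direct_sum_module I M"

lemma DS_simps:
  "\<zero>\<^bsub>DS\<^esub> = (\<lambda>i\<in>I. \<zero>\<^bsub>M i\<^esub>)"
  "t \<oplus>\<^bsub>DS\<^esub> u = (\<lambda>i\<in>I. t i \<oplus>\<^bsub>M i\<^esub> u i)"
  "r \<odot>\<^bsub>DS\<^esub> t = (\<lambda>i\<in>I. r \<odot>\<^bsub>M i\<^esub> t i)"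
  by (auto simp: direct_sum_module_def)

lemma DS_carrier:
  "t \<in> carrier DS \<longleftrightarrow> (\<forall>i\<in>I. t i \<in> carrier (M i)) \<and> t \<in> extensional I \<and> finite {i\<in>I. t i \<noteq> \<zero>\<^bsub>M i\<^esub>}"
  by (auto simp: direct_sum_module_def PiE_iff)

lemma abM: "i \<in> I \<Longrightarrow> abelian_group (M i)" using modules by (simp add: module_def)

lemma DS_add_closed: "\<lbrakk>t \<in> carrier DS; u \<in> carrier DS\<rbrakk> \<Longrightarrow>
    (\<lambda>i\<in>I. t i \<oplus>\<^bsub>M i\<^esub> u i) \<in> carrier DS"
proof -
  assume tu: "t \<in> carrier DS" "u \<in> carrier DS"
  then have "{i\<in>I. t i \<oplus>\<^bsub>M i\<^esub> u i \<noteq> \<zero>\<^bsub>M i\<^esub>} \<subseteq> {i\<in>I. t i \<noteq> \<zero>\<^bsub>M i\<^esub>} \<union> {i\<in>I. u i \<noteq> \<zero>\<^bsub>M i\<^esub>}"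
    using abM abelian_groupE(2,5) by (fastforce simp: DS_carrier)
  then show ?thesis using tu abelian_groupE(1)[OF abM]
    by (auto simp: DS_carrier intro: finite_subset)
qed

lemma DS_module: "module R DS"
proof (rule moduleI)
  show "cring R" by (rule is_cring)
  have z: "\<And>i. i \<in> I \<Longrightarrow> \<zero>\<^bsub>M i\<^esub> \<in> carrier (M i)" using abM abelian_groupE(2) by blast
  have sm: "(\<lambda>i\<in>I. r \<odot>\<^bsub>M i\<^esub> t i) \<in> carrier DS" if r: "r \<in> carrier R" and t: "t \<in> carrier DS" for r t
  proof -
    have "{i\<in>I. r \<odot>\<^bsub>M i\<^esub> t i \<noteq> \<zero>\<^bsub>M i\<^esub>} \<subseteq> {i\<in>I. t i \<noteq> \<zero>\<^bsub>M i\<^esub>}"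
      using r module.smult_r_null[OF modules] by auto
    then show ?thesis using r t module.smult_closed[OF modules]
      by (auto simp: DS_carrier intro: finite_subset)
  qed
  note e = DS_carrier[THEN iffD1]
  show "abelian_group DS"
  proof (rule abelian_groupI, goal_cases)
    case (1 t u) then show ?case by (simp add: DS_simps DS_add_closed)
  next
    case 2 then show ?case by (auto simp: DS_simps DS_carrier z)
  next
    case (3 t u v) then show ?case
      by (auto simp: DS_simps DS_carrier abelian_group.axioms(1)[OF abM] intro!: restrict_ext abelian_groupE(3)[OF abM])
  next
    case (4 t u) then show ?case
      by (auto simp: DS_simps DS_carrier intro!: restrict_ext abelian_groupE(4)[OF abM])
  next
    case (5 t)
    then have "(\<lambda>i\<in>I. (\<lambda>i\<in>I. \<zero>\<^bsub>M i\<^esub>) i \<oplus>\<^bsub>M i\<^esub> t i) = restrict t I"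
      by (intro restrict_ext) (simp add: DS_carrier abelian_groupE(5)[OF abM])
    then show ?case using 5 by (simp add: DS_simps DS_carrier extensional_restrict)
  next
    case (6 t)
    \<comment> \<open>Scaling by minus one instead of negating pointwise: finite support is then
      given by \<open>sm\<close>.\<close>
    let ?n = "\<lambda>i\<in>I. \<ominus>\<^bsub>R\<^esub> \<one> \<odot>\<^bsub>M i\<^esub> t i"
    have "(\<lambda>i\<in>I. ?n i \<oplus>\<^bsub>M i\<^esub> t i) = (\<lambda>i\<in>I. \<zero>\<^bsub>M i\<^esub>)"
    proof (rule restrict_ext)
      fix i assume i: "i \<in> I"
      interpret Mi: module R "M i" by (rule modules[OF i])
      show "?n i \<oplus>\<^bsub>M i\<^esub> t i = \<zero>\<^bsub>M i\<^esub>" using 6 i by (simp add: DS_carrier Mi.smult_l_minus Mi.M.l_neg)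
    qed
    moreover have "?n \<in> carrier DS" by (rule sm) (use 6 in auto)
    ultimately show ?case unfolding DS_simps by (intro bexI[of _ ?n])
  qed
  show "r \<odot>\<^bsub>DS\<^esub> t \<in> carrier DS" if "r \<in> carrier R" "t \<in> carrier DS" for r t
    using sm that by (simp add: DS_simps)
  fix t assume t: "t \<in> carrier DS"
  have "(\<lambda>i\<in>I. \<one> \<odot>\<^bsub>M i\<^esub> t i) = restrict t I"
    using t by (intro restrict_ext) (simp add: DS_carrier module.smult_one[OF modules])
  then show "\<one> \<odot>\<^bsub>DS\<^esub> t = t" using t by (simp add: DS_simps DS_carrier extensional_restrict)
next
  fix a b t assume "a \<in> carrier R" "b \<in> carrier R" "t \<in> carrier DS"
  then show "(a \<oplus> b) \<odot>\<^bsub>DS\<^esub> t = a \<odot>\<^bsub>DS\<^esub> t \<oplus>\<^bsub>DS\<^esub> b \<odot>\<^bsub>DS\<^esub> t"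
    "(a \<otimes> b) \<odot>\<^bsub>DS\<^esub> t = a \<odot>\<^bsub>DS\<^esub> (b \<odot>\<^bsub>DS\<^esub> t)"
    by (auto simp: DS_simps DS_carrier module.smult_l_distr[OF modules] module.smult_assoc1[OF modules]
        intro!: restrict_ext)
next
  fix a t u assume "a \<in> carrier R" "t \<in> carrier DS" "u \<in> carrier DS"
  then show "a \<odot>\<^bsub>DS\<^esub> (t \<oplus>\<^bsub>DS\<^esub> u) = a \<odot>\<^bsub>DS\<^esub> t \<oplus>\<^bsub>DS\<^esub> a \<odot>\<^bsub>DS\<^esub> u"
    by (auto simp: DS_simps DS_carrier module.smult_r_distr[OF modules] intro!: restrict_ext)
qed

definition inj :: "'i \<Rightarrow> 'a \<Rightarrow> 'i \<Rightarrow> 'a" where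
  "inj j a = (\<lambda>i\<in>I. if i = j then a else \<zero>\<^bsub>M i\<^esub>)"

lemma inj_linear: "j \<in> I \<Longrightarrow> linear_map R (M j) DS (inj j)"
proof (rule linear_mapI)
  assume j: "j \<in> I"
  have z: "\<And>i. i \<in> I \<Longrightarrow> \<zero>\<^bsub>M i\<^esub> \<in> carrier (M i)" using abM abelian_groupE(2) by blast
  show "inj j a \<in> carrier DS" if "a \<in> carrier (M j)" for a
  proof -
    have "{i \<in> I. inj j a i \<noteq> \<zero>\<^bsub>M i\<^esub>} \<subseteq> {j}" by (auto simp: inj_def)
    then show ?thesis using that z by (auto simp: DS_carrier intro: finite_subset) (auto simp: inj_def)
  qed
  show "inj j (a \<oplus>\<^bsub>M j\<^esub> b) = inj j a \<oplus>\<^bsub>DS\<^esub> inj j b" if "a \<in> carrier (M j)" "b \<in> carrier (M j)" for a b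
    using that z abelian_groupE(5)[OF abM] by (auto simp: DS_simps inj_def intro!: restrict_ext)
  show "inj j (r \<odot>\<^bsub>M j\<^esub> a) = r \<odot>\<^bsub>DS\<^esub> inj j a" if "r \<in> carrier R" "a \<in> carrier (M j)" for r a
    using that module.smult_r_null[OF modules] by (auto simp: DS_simps inj_def intro!: restrict_ext)
qed

text \<open>The induction of \<open>free_module_minimal\<close> again, clearing one component of the
  family at a time.\<close>

lemma DS_minimal:
  assumes K: "submodule K R DS" and gen: "\<And>j a. j \<in> I \<Longrightarrow> a \<in> carrier (M j) \<Longrightarrow> inj j a \<in> K"
    and t: "t \<in> carrier DS"
  shows "t \<in> K"
proof -
  interpret D: module R DS by (rule DS_module)
  have z: "\<And>i. i \<in> I \<Longrightarrow> \<zero>\<^bsub>M i\<^esub> \<in> carrier (M i)" using abM abelian_groupE(2) by blast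
  have "finite {i\<in>I. t i \<noteq> \<zero>\<^bsub>M i\<^esub>}" using t by (simp add: DS_carrier)
  then have "t \<in> carrier DS \<Longrightarrow> ?thesis"
  proof (induction "{i\<in>I. t i \<noteq> \<zero>\<^bsub>M i\<^esub>}" arbitrary: t rule: finite_induct)
    case empty
    then have "t = \<zero>\<^bsub>DS\<^esub>" by (auto simp: DS_simps DS_carrier extensional_def)
    then show ?case using subgroup.one_closed[OF submodule.axioms(1)[OF K]] by simp
  next
    case (insert j J)
    have j: "j \<in> I" using insert.hyps(4) by auto
    let ?u = "t(j := \<zero>\<^bsub>M j\<^esub>)"
    have J: "J = {i\<in>I. ?u i \<noteq> \<zero>\<^bsub>M i\<^esub>}" using insert.hyps(2,4) by auto
    have u: "?u \<in> carrier DS"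
      using insert.prems insert.hyps(1) J z j by (auto simp: DS_carrier extensional_def)
    have 1: "?u \<in> K" using insert.hyps(3)[OF J u] .
    have 2: "inj j (t j) \<in> K" using insert.prems j by (intro gen) (auto simp: DS_carrier)
    have "?u \<oplus>\<^bsub>DS\<^esub> inj j (t j) = t"
      using insert.prems j abelian_groupE(5)[OF abM] abelian_monoid.r_zero[OF abelian_group.axioms(1)[OF abM]]
      by (auto simp: DS_simps inj_def DS_carrier extensional_def)
    then show ?case using D.submoduleE(5)[OF K 1 2] by simp
  qed
  then show ?thesis using t by blast
qed

lemma DS_agree:
  assumes P: "module R P" and f: "linear_map R DS P f" and g: "linear_map R DS P g"
    and eq: "\<And>j a. j \<in> I \<Longrightarrow> a \<in> carrier (M j) \<Longrightarrow> f (inj j a) = g (inj j a)"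
    and t: "t \<in> carrier DS"
  shows "f t = g t"
proof -
  have "t \<in> {t \<in> carrier DS. f t = g t}"
    by (rule DS_minimal[OF equalizer_submodule[OF DS_module P f g] _ t])
      (auto simp: eq linear_map_closed[OF inj_linear])
  then show ?thesis by simp
qed

definition sum_lift :: "('k, 'p, 'u) module_scheme \<Rightarrow> ('i \<Rightarrow> 'a \<Rightarrow> 'p) \<Rightarrow> ('i \<Rightarrow> 'a) \<Rightarrow> 'p" where
  "sum_lift P \<phi> t = (\<Oplus>\<^bsub>P\<^esub> i \<in> {i\<in>I. t i \<noteq> \<zero>\<^bsub>M i\<^esub>}. \<phi> i (t i))"

context
  fixes P :: "('k, 'p, 'u) module_scheme" and \<phi> :: "'i \<Rightarrow> 'a \<Rightarrow> 'p"
  assumes P: "module R P" and \<phi>: "\<And>i. i \<in> I \<Longrightarrow> linear_map R (M i) P (\<phi> i)"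
begin

interpretation P: module R P by (rule P)

lemma sum_lift_superset:
  assumes t: "t \<in> carrier DS" and T: "finite T" "T \<subseteq> I" "{i\<in>I. t i \<noteq> \<zero>\<^bsub>M i\<^esub>} \<subseteq> T"
  shows "sum_lift P \<phi> t = (\<Oplus>\<^bsub>P\<^esub> i \<in> T. \<phi> i (t i))"
proof -
  have c: "\<phi> i (t i) \<in> carrier P" if "i \<in> T" for i
    using that t T linear_map_closed[OF \<phi>] by (auto simp: DS_carrier)
  have z: "\<phi> i (t i) = \<zero>\<^bsub>P\<^esub>" if "i \<in> T - {i\<in>I. t i \<noteq> \<zero>\<^bsub>M i\<^esub>}" for i
    using that T linear_map_zero[OF modules P \<phi>] by auto
  show ?thesis unfolding sum_lift_def
    by (rule P.M.add.finprod_mono_neutral_cong_left) (use T c z in auto)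
qed

lemma sum_lift_linear: "linear_map R DS P (sum_lift P \<phi>)"
proof (rule linear_mapI)
  interpret D: module R DS by (rule DS_module)
  fix t assume t: "t \<in> carrier DS"
  let ?T = "{i\<in>I. t i \<noteq> \<zero>\<^bsub>M i\<^esub>}"
  have T: "finite ?T" and tc: "\<And>i. i \<in> I \<Longrightarrow> t i \<in> carrier (M i)" using t by (auto simp: DS_carrier)
  have c: "\<And>i. i \<in> I \<Longrightarrow> \<phi> i (t i) \<in> carrier P" using linear_map_closed[OF \<phi>] tc by auto
  show "sum_lift P \<phi> t \<in> carrier P" unfolding sum_lift_def using c by (intro P.M.finsum_closed) auto
  { fix r assume r: "r \<in> carrier R"
    have "sum_lift P \<phi> (r \<odot>\<^bsub>DS\<^esub> t) = (\<Oplus>\<^bsub>P\<^esub> i \<in> ?T. \<phi> i ((r \<odot>\<^bsub>DS\<^esub> t) i))"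
      by (rule sum_lift_superset) (use T r t module.smult_r_null[OF modules] in \<open>auto simp: DS_simps(3)\<close>, use D.smult_closed in \<open>simp add: DS_simps(3)\<close>)
    also have "\<dots> = (\<Oplus>\<^bsub>P\<^esub> i \<in> ?T. r \<odot>\<^bsub>P\<^esub> \<phi> i (t i))"
      using r tc c by (intro P.M.finsum_cong') (auto simp: DS_simps linear_map_smult[OF \<phi>])
    also have "\<dots> = r \<odot>\<^bsub>P\<^esub> sum_lift P \<phi> t" unfolding sum_lift_def
      using r T c by (intro P.finsum_smult_ldistr[symmetric]) auto
    finally show "sum_lift P \<phi> (r \<odot>\<^bsub>DS\<^esub> t) = r \<odot>\<^bsub>P\<^esub> sum_lift P \<phi> t" . }
  fix u assume u: "u \<in> carrier DS"
  let ?U = "{i\<in>I. t i \<noteq> \<zero>\<^bsub>M i\<^esub>} \<union> {i\<in>I. u i \<noteq> \<zero>\<^bsub>M i\<^esub>}"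
  have U: "finite ?U" "?U \<subseteq> I" and uc: "\<And>i. i \<in> I \<Longrightarrow> u i \<in> carrier (M i)" using t u by (auto simp: DS_carrier)
  have d: "\<And>i. i \<in> I \<Longrightarrow> \<phi> i (u i) \<in> carrier P" using linear_map_closed[OF \<phi>] uc by auto
  have zz: "\<And>i. i \<in> I \<Longrightarrow> \<zero>\<^bsub>M i\<^esub> \<oplus>\<^bsub>M i\<^esub> \<zero>\<^bsub>M i\<^esub> = \<zero>\<^bsub>M i\<^esub>" using abelian_groupE(2,5)[OF abM] by auto
  have tu: "t \<oplus>\<^bsub>DS\<^esub> u \<in> carrier DS" using t u by (rule D.M.a_closed)
  have "sum_lift P \<phi> (t \<oplus>\<^bsub>DS\<^esub> u) = (\<Oplus>\<^bsub>P\<^esub> i \<in> ?U. \<phi> i ((t \<oplus>\<^bsub>DS\<^esub> u) i))"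
    by (rule sum_lift_superset[OF tu U]) (auto simp: DS_simps zz)
  also have "\<dots> = (\<Oplus>\<^bsub>P\<^esub> i \<in> ?U. \<phi> i (t i) \<oplus>\<^bsub>P\<^esub> \<phi> i (u i))"
    using tc uc c d by (intro P.M.finsum_cong') (auto simp: DS_simps linear_map_add[OF \<phi>])
  also have "\<dots> = (\<Oplus>\<^bsub>P\<^esub> i \<in> ?U. \<phi> i (t i)) \<oplus>\<^bsub>P\<^esub> (\<Oplus>\<^bsub>P\<^esub> i \<in> ?U. \<phi> i (u i))"
    using c d by (intro P.M.finsum_addf) auto
  also have "\<dots> = sum_lift P \<phi> t \<oplus>\<^bsub>P\<^esub> sum_lift P \<phi> u"
    using sum_lift_superset[OF t U] sum_lift_superset[OF u U] by auto
  finally show "sum_lift P \<phi> (t \<oplus>\<^bsub>DS\<^esub> u) = sum_lift P \<phi> t \<oplus>\<^bsub>P\<^esub> sum_lift P \<phi> u" .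
qed

lemma sum_lift_inj: "\<lbrakk>j \<in> I; a \<in> carrier (M j)\<rbrakk> \<Longrightarrow>
    sum_lift P \<phi> (inj j a) = \<phi> j a"
proof -
  assume j: "j \<in> I" and a: "a \<in> carrier (M j)"
  have "sum_lift P \<phi> (inj j a) = (\<Oplus>\<^bsub>P\<^esub> i \<in> {j}. \<phi> i (inj j a i))"
    by (rule sum_lift_superset[OF linear_map_closed[OF inj_linear[OF j] a]]) (use j in \<open>auto simp: inj_def\<close>)
  also have "\<dots> = \<phi> j a" using linear_map_closed[OF \<phi>[OF j] a] j by (subst P.M.finsum_insert) (auto simp: inj_def)
  finally show ?thesis .
qed

end

end

section \<open>Tensor products of bimodules\<close>

text \<open>One condition for each middle object \<open>z\<close>, because \<open>tens_sp\<close> is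
  a direct sum over \<open>z\<close>; nothing links the maps for different \<open>z\<close>.\<close>

definition balanced ::
  "('k, 'r) ring_scheme \<Rightarrow> ('o, 'k, 'a, 'z) lincat_scheme \<Rightarrow>
   ('o, 'k, 'a, 'm, 's) bimod_scheme \<Rightarrow> ('o, 'k, 'a, 'n, 't) bimod_scheme \<Rightarrow>
   'o \<Rightarrow> 'o \<Rightarrow> ('k, 'p, 'u) module_scheme \<Rightarrow> ('o \<Rightarrow> 'm \<Rightarrow> 'n \<Rightarrow> 'p) \<Rightarrow> bool" where
  "balanced R A M N x y P \<beta> \<longleftrightarrow>
     (\<forall>z\<in>Obj A. balanced_map R (end_set A z) (Sp M z y) (ract M z y) (Sp N x z) (lact N x z) P (\<beta> z))"

lemma balancedI:
  assumes "\<And>z m. z \<in> Obj A \<Longrightarrow> m \<in> carrier (Sp M z y) \<Longrightarrow> linear_map R (Sp N x z) P (\<beta> z m)"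
    and "\<And>z n. z \<in> Obj A \<Longrightarrow> n \<in> carrier (Sp N x z) \<Longrightarrow> linear_map R (Sp M z y) P (\<lambda>m. \<beta> z m n)"
    and "\<And>z m b n. z \<in> Obj A \<Longrightarrow> m \<in> carrier (Sp M z y) \<Longrightarrow> b \<in> end_set A z \<Longrightarrow> n \<in> carrier (Sp N x z) \<Longrightarrow>
      \<beta> z (ract M z y m b) n = \<beta> z m (lact N x z b n)"
  shows "balanced R A M N x y P \<beta>"
  using assms by (auto simp: balanced_def balanced_map_def)

lemma balancedD:
  assumes "balanced R A M N x y P \<beta>" "z \<in> Obj A"
  shows "m \<in> carrier (Sp M z y) \<Longrightarrow> linear_map R (Sp N x z) P (\<beta> z m)"
    and "n \<in> carrier (Sp N x z) \<Longrightarrow> linear_map R (Sp M z y) P (\<lambda>m. \<beta> z m n)"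
    and "\<lbrakk>m \<in> carrier (Sp M z y); b \<in> end_set A z; n \<in> carrier (Sp N x z)\<rbrakk> \<Longrightarrow>
       \<beta> z (ract M z y m b) n = \<beta> z m (lact N x z b n)"
  using assms by (auto simp: balanced_def balanced_map_def)

lemma Sp_tensor [simp]: "Sp (tensor R A M N) = tens_sp R A M N"
  by (simp add: tensor_def)

lemma bimod_hom_linear:
  "\<lbrakk>bimod_hom R A M N f; x \<in> Obj A; y \<in> Obj A\<rbrakk> \<Longrightarrow>
     linear_map R (Sp M x y) (Sp N x y) (f x y)"
  by (simp add: bimod_hom_def)

lemma bimod_hom_closed:
  "\<lbrakk>bimod_hom R A M N f; x \<in> Obj A; y \<in> Obj A; m \<in> carrier (Sp M x y)\<rbrakk> \<Longrightarrow>
     f x y m \<in> carrier (Sp N x y)"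
  by (blast intro: linear_map_closed bimod_hom_linear)

lemma bimod_hom_lact:
  "\<lbrakk>bimod_hom R A M N f; x \<in> Obj A; y \<in> Obj A; m \<in> carrier (Sp M x y); a \<in> end_set A y\<rbrakk> \<Longrightarrow>
     f x y (lact M x y a m) = lact N x y a (f x y m)"
  by (simp add: bimod_hom_def)

lemma bimod_hom_ract:
  "\<lbrakk>bimod_hom R A M N f; x \<in> Obj A; y \<in> Obj A; m \<in> carrier (Sp M x y); b \<in> end_set A x\<rbrakk> \<Longrightarrow>
     f x y (ract M x y m b) = ract N x y (f x y m) b"
  by (simp add: bimod_hom_def)

lemma bimod_hom_id: "bimod_hom R A M M idm"
  by (simp add: bimod_hom_def linear_map_id)

lemma bimod_hom_compose:
  assumes "bimod_hom R A M N f" "bimod_hom R A N P g"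
  shows "bimod_hom R A M P (\<lambda>x y m. g x y (f x y m))"
  using linear_map_compose[OF bimod_hom_linear[OF assms(1)] bimod_hom_linear[OF assms(2)]]
    bimod_hom_closed[OF assms(1)] bimod_hom_lact[OF assms(1)] bimod_hom_ract[OF assms(1)]
    bimod_hom_lact[OF assms(2)] bimod_hom_ract[OF assms(2)]
  by (simp add: bimod_hom_def)

context bimodule begin

lemma lact_closed [simp, intro]:
  "\<lbrakk>x \<in> Obj A; y \<in> Obj A; a \<in> end_set A y; m \<in> carrier (Sp M x y)\<rbrakk> \<Longrightarrow>
     lact M x y a m \<in> carrier (Sp M x y)"
  by (rule linear_map_closed[OF lact_linear])

lemma ract_closed [simp, intro]:
  "\<lbrakk>x \<in> Obj A; y \<in> Obj A; b \<in> end_set A x; m \<in> carrier (Sp M x y)\<rbrakk> \<Longrightarrow>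
     ract M x y m b \<in> carrier (Sp M x y)"
  by (rule linear_map_closed[OF ract_linear])

end

lemmas [simp] = bimodule.lact_closed bimodule.ract_closed bimodule.Sp_module

locale bimodule_category = linear_category R A
  for R :: "('k, 'r) ring_scheme" (structure) and A :: "('o, 'k, 'a, 'z) lincat_scheme"
begin

abbreviation bim :: "('o, 'k, 'a, 'm, 's) bimod_scheme \<Rightarrow> bool" where "bim \<equiv> bimodule R A"
abbreviation pure where "pure \<equiv> pure_tens R A"
abbreviation ten where "ten \<equiv> tensor R A"
abbreviation tsp where "tsp \<equiv> tens_sp R A"
abbreviation tmap where "tmap \<equiv> tens_map R A"
abbreviation tlift where "tlift \<equiv> tens_lift R A"
abbreviation cs where "cs M x y \<equiv> carrier (Sp M x y)"

lemma tens_factors: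
  assumes "bim M" "bim N" "x \<in> Obj A" "y \<in> Obj A" "z \<in> Obj A"
  shows "tensor_factors R (end_set A z) (Sp M z y) (ract M z y) (Sp N x z) (lact N x z)"
  using assms by (simp add: tensor_factors_def tensor_factors_axioms_def)

lemma tens_family:
  assumes "bim M" "bim N" "x \<in> Obj A" "y \<in> Obj A"
  shows "module_family R (Obj A) (tens_at R A M N x y)"
  using tensor_factors.Ten_module[OF tens_factors[OF assms]] is_cring
  by (simp add: module_family_def module_family_axioms_def tens_at_def)

lemma tens_module [simp]:
  assumes "bim M" "bim N" "x \<in> Obj A" "y \<in> Obj A"
  shows "module R (tsp M N x y)"
  unfolding tens_sp_def by (rule module_family.DS_module[OF tens_family[OF assms]])

text \<open>Splits \<open>pure_tens\<close> into its two layers, the tensor product at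
  \<open>z\<close> and the inclusion of that summand, so that its properties can be composed from
  theirs.\<close>

lemma pure_inj:
  assumes "bim M" "bim N" "x \<in> Obj A" "y \<in> Obj A" "z \<in> Obj A"
  shows "pure M N x y z m n =
    module_family.inj (Obj A) (tens_at R A M N x y) z
      (tensor_factors.pt R (end_set A z) (Sp M z y) (ract M z y) (Sp N x z) (lact N x z) m n)"
  by (simp add: pure_tens_def module_family.inj_def[OF tens_family[OF assms(1-4)]]
      tensor_factors.pt_def[OF tens_factors[OF assms]])

lemma pure_balanced:
  assumes "bim M" "bim N" "x \<in> Obj A" "y \<in> Obj A"
  shows "balanced R A M N x y (tsp M N x y) (pure M N x y)"
proof -
  have b: "balanced_map R (end_set A z) (Sp M z y) (ract M z y) (Sp N x z) (lact N x z) (tens_at R A M N x y z)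
      (tensor_factors.pt R (end_set A z) (Sp M z y) (ract M z y) (Sp N x z) (lact N x z))" if "z \<in> Obj A" for z
    unfolding tens_at_def by (rule tensor_factors.pt_balanced[OF tens_factors[OF assms that]])
  note i = module_family.inj_linear[OF tens_family[OF assms], folded tens_sp_def]
  show ?thesis
  proof (rule balancedI)
    fix z m assume z: "z \<in> Obj A" and "m \<in> cs M z y"
    then have l: "linear_map R (Sp N x z) (tens_at R A M N x y z)
      (tensor_factors.pt R (end_set A z) (Sp M z y) (ract M z y) (Sp N x z) (lact N x z) m)"
      using b[OF z] by (simp add: balanced_map_def)
    have e: "pure M N x y z m = (\<lambda>n. module_family.inj (Obj A) (tens_at R A M N x y) z
      (tensor_factors.pt R (end_set A z) (Sp M z y) (ract M z y) (Sp N x z) (lact N x z) m n))"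
      using pure_inj[OF assms z] by auto
    show "linear_map R (Sp N x z) (tsp M N x y) (pure M N x y z m)"
      unfolding e by (rule linear_map_compose[OF l i[OF z]])
  next
    fix z n assume z: "z \<in> Obj A" and "n \<in> cs N x z"
    then have l: "linear_map R (Sp M z y) (tens_at R A M N x y z)
      (\<lambda>m. tensor_factors.pt R (end_set A z) (Sp M z y) (ract M z y) (Sp N x z) (lact N x z) m n)"
      using b[OF z] by (simp add: balanced_map_def)
    show "linear_map R (Sp M z y) (tsp M N x y) (\<lambda>m. pure M N x y z m n)"
      unfolding pure_inj[OF assms z] by (rule linear_map_compose[OF l i[OF z]])
  next
    fix z m b n assume z: "z \<in> Obj A" and "m \<in> cs M z y" "b \<in> end_set A z" "n \<in> cs N x z"
    then show "pure M N x y z (ract M z y m b) n = pure M N x y z m (lact N x z b n)"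
      using b[OF z] by (simp add: balanced_map_def pure_inj[OF assms z])
  qed
qed

lemmas pure_linear_right = balancedD(1)[OF pure_balanced]
lemmas pure_linear_left = balancedD(2)[OF pure_balanced]
lemmas pure_shift = balancedD(3)[OF pure_balanced]

lemma pure_closed [simp]:
  assumes "bim M" "bim N" "x \<in> Obj A" "y \<in> Obj A" "z \<in> Obj A" "m \<in> cs M z y" "n \<in> cs N x z"
  shows "pure M N x y z m n \<in> carrier (tsp M N x y)"
  by (rule linear_map_closed[OF pure_linear_right[OF assms(1-6)] assms(7)])

lemma pure_zero:
  assumes "bim M" "bim N" "x \<in> Obj A" "y \<in> Obj A" "z \<in> Obj A"
  shows "m \<in> cs M z y \<Longrightarrow> pure M N x y z m \<zero>\<^bsub>Sp N x z\<^esub> = \<zero>\<^bsub>tsp M N x y\<^esub>"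
    and "n \<in> cs N x z \<Longrightarrow> pure M N x y z \<zero>\<^bsub>Sp M z y\<^esub> n = \<zero>\<^bsub>tsp M N x y\<^esub>"
  using linear_map_zero[OF _ _ pure_linear_right[OF assms]] linear_map_zero[OF _ _ pure_linear_left[OF assms]] assms
  by simp_all

text \<open>Summands generate the direct sum, and pure tensors generate each summand. Most
  equalities of tensors below are reduced to pure tensors by this rule.\<close>

lemma tens_agree:
  assumes "bim M" "bim N" "x \<in> Obj A" "y \<in> Obj A" and P: "module R P"
    and f: "linear_map R (tsp M N x y) P f" and g: "linear_map R (tsp M N x y) P g"
    and eq: "\<And>z m n. z \<in> Obj A \<Longrightarrow> m \<in> cs M z y \<Longrightarrow> n \<in> cs N x z \<Longrightarrow>
      f (pure M N x y z m n) = g (pure M N x y z m n)"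
    and t: "t \<in> carrier (tsp M N x y)"
  shows "f t = g t"
proof (rule module_family.DS_agree[OF tens_family[OF assms(1-4)] P, folded tens_sp_def, OF f g _ t])
  fix z a assume z: "z \<in> Obj A" and a: "a \<in> carrier (tens_at R A M N x y z)"
  note i = module_family.inj_linear[OF tens_family[OF assms(1-4)] z, folded tens_sp_def]
  show "f (module_family.inj (Obj A) (tens_at R A M N x y) z a) =
        g (module_family.inj (Obj A) (tens_at R A M N x y) z a)"
    by (rule tensor_factors.Ten_agree[OF tens_factors[OF assms(1-4) z] P, folded tens_at_def,
        OF linear_map_compose[OF i f] linear_map_compose[OF i g] _ a])
      (simp add: eq[OF z] flip: pure_inj[OF assms(1-4) z])
qed

lemma lift_over_lin:
  assumes "bim M" "bim N" "x \<in> Obj A" "y \<in> Obj A" "module R P" "balanced R A M N x y P \<beta>" "z \<in> Obj A"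
  shows "linear_map R (tens_at R A M N x y z) P (lift_over R P (\<beta> z))"
  unfolding tens_at_def
  by (rule tensor_factors.lift_over_linear[OF tens_factors[OF assms(1-4,7)] assms(5)])
    (use assms(6,7) in \<open>simp add: balanced_def\<close>)

lemma tens_lift_sum:
  assumes "bim M" "bim N" "x \<in> Obj A" "y \<in> Obj A"
  shows "tlift M N x y P \<beta> =
    module_family.sum_lift (Obj A) (tens_at R A M N x y) P (\<lambda>z. lift_over R P (\<beta> z))"
  by (rule ext) (simp add: tens_lift_def module_family.sum_lift_def[OF tens_family[OF assms]])

lemma tens_lift_linear:
  assumes "bim M" "bim N" "x \<in> Obj A" "y \<in> Obj A" "module R P" "balanced R A M N x y P \<beta>"
  shows "linear_map R (tsp M N x y) P (tlift M N x y P \<beta>)"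
  unfolding tens_lift_sum[OF assms(1-4)] tens_sp_def
  by (rule module_family.sum_lift_linear[OF tens_family[OF assms(1-4)] assms(5)]) (rule lift_over_lin[OF assms])

text \<open>With \<open>tens_lift_linear\<close> and \<open>tens_agree\<close> this completes the
  universal property of the tensor product of bimodules, through which the later calculations
  pass.\<close>

lemma tens_lift_pure:
  assumes "bim M" "bim N" "x \<in> Obj A" "y \<in> Obj A" "module R P" "balanced R A M N x y P \<beta>"
    "z \<in> Obj A" "m \<in> cs M z y" "n \<in> cs N x z"
  shows "tlift M N x y P \<beta> (pure M N x y z m n) = \<beta> z m n"
proof -
  note f = tens_factors[OF assms(1-4,7)]
  have b: "balanced_map R (end_set A z) (Sp M z y) (ract M z y) (Sp N x z) (lact N x z) P (\<beta> z)"
    using assms(6,7) by (simp add: balanced_def)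
  show ?thesis
    unfolding tens_lift_sum[OF assms(1-4)] pure_inj[OF assms(1-4,7)]
    by (subst module_family.sum_lift_inj[OF tens_family[OF assms(1-4)] assms(5) lift_over_lin[OF assms(1-6)] assms(7)])
      (use tensor_factors.pt_closed[OF f assms(8,9)] tensor_factors.lift_over_pt[OF f assms(5) b assms(8,9)]
        in \<open>simp_all add: tens_at_def\<close>)
qed

text \<open>For fixed \<open>q\<close> the lift is linear in the tensor, so linearity in
  \<open>q\<close> is an identity between linear maps of \<open>t\<close> and may be tested at pure
  tensors. It serves the actions, which must be linear in the scalar, and the nested lifts in
  \<open>assoc\<close>.\<close>

lemma tens_lift_linear_param:
  assumes "bim M" "bim N" "x \<in> Obj A" "y \<in> Obj A" and P: "module R P" and Q: "module R Q"
    and b: "\<And>q. q \<in> carrier Q \<Longrightarrow> balanced R A M N x y P (\<beta> q)"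
    and l: "\<And>z m n. z \<in> Obj A \<Longrightarrow> m \<in> cs M z y \<Longrightarrow> n \<in> cs N x z \<Longrightarrow>
      linear_map R Q P (\<lambda>q. \<beta> q z m n)"
    and t: "t \<in> carrier (tsp M N x y)"
  shows "linear_map R Q P (\<lambda>q. tlift M N x y P (\<beta> q) t)"
proof (rule linear_mapI)
  interpret Q: module R Q by fact
  note tl = tens_lift_linear[OF assms(1-5) b] and tp = tens_lift_pure[OF assms(1-5) b]
  show "tlift M N x y P (\<beta> q) t \<in> carrier P" if "q \<in> carrier Q" for q
    using linear_map_closed[OF tl[OF that] t] .
  show "tlift M N x y P (\<beta> (q \<oplus>\<^bsub>Q\<^esub> q')) t =
      tlift M N x y P (\<beta> q) t \<oplus>\<^bsub>P\<^esub> tlift M N x y P (\<beta> q') t"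
    if "q \<in> carrier Q" "q' \<in> carrier Q" for q q'
    by (rule tens_agree[OF assms(1-5) tl linear_map_add_maps[OF P tl tl] _ t])
      (use that in \<open>simp_all add: tp linear_map_add[OF l]\<close>)
  show "tlift M N x y P (\<beta> (r \<odot>\<^bsub>Q\<^esub> q)) t = r \<odot>\<^bsub>P\<^esub> tlift M N x y P (\<beta> q) t"
    if "r \<in> carrier R" "q \<in> carrier Q" for r q
    by (rule tens_agree[OF assms(1-5) tl linear_map_smult_maps[OF P tl] _ t])
      (use that in \<open>simp_all add: tp linear_map_smult[OF l]\<close>)
qed

lemma lact_balanced:
  assumes "bim M" "bim N" "x \<in> Obj A" "y \<in> Obj A" "a \<in> end_set A y"
  shows "balanced R A M N x y (tsp M N x y) (\<lambda>z m n. pure M N x y z (lact M z y a m) n)"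
  using assms
  by (intro balancedI)
    (auto intro!: pure_linear_right linear_map_compose[OF bimodule.lact_linear pure_linear_left]
      simp: bimodule.lact_ract pure_shift simp flip: bimodule.lact_ract)

lemma ract_balanced:
  assumes "bim M" "bim N" "x \<in> Obj A" "y \<in> Obj A" "b \<in> end_set A x"
  shows "balanced R A M N x y (tsp M N x y) (\<lambda>z m n. pure M N x y z m (ract N x z n b))"
  using assms
  by (intro balancedI)
    (auto intro!: pure_linear_left linear_map_compose[OF bimodule.ract_linear pure_linear_right]
      simp: bimodule.lact_ract pure_shift)

lemma lact_pure:
  assumes "bim M" "bim N" "x \<in> Obj A" "y \<in> Obj A" "a \<in> end_set A y"
    "z \<in> Obj A" "m \<in> cs M z y" "n \<in> cs N x z"
  shows "lact (ten M N) x y a (pure M N x y z m n) = pure M N x y z (lact M z y a m) n"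
  using assms by (simp add: tensor_def tens_lift_pure[OF _ _ _ _ _ lact_balanced])

lemma ract_pure:
  assumes "bim M" "bim N" "x \<in> Obj A" "y \<in> Obj A" "b \<in> end_set A x"
    "z \<in> Obj A" "m \<in> cs M z y" "n \<in> cs N x z"
  shows "ract (ten M N) x y (pure M N x y z m n) b = pure M N x y z m (ract N x z n b)"
  using assms by (simp add: tensor_def tens_lift_pure[OF _ _ _ _ _ ract_balanced])

text \<open>Each action is linear in the tensor, so the action laws are tested at pure tensors,
  where the left action touches only \<open>M\<close> and the right action only
  \<open>N\<close>.\<close>

lemma tensor_bimodule [simp]:
  assumes M: "bim M" and N: "bim N"
  shows "bim (ten M N)"
proof -
  note mod = tens_module[OF M N]
  have ll: "linear_map R (tsp M N x y) (tsp M N x y) (lact (ten M N) x y a)"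
    if "x \<in> Obj A" "y \<in> Obj A" "a \<in> end_set A y" for x y a
    using tens_lift_linear[OF M N that(1,2) mod lact_balanced[OF M N that]] that by (simp add: tensor_def)
  have rl: "linear_map R (tsp M N x y) (tsp M N x y) (\<lambda>t. ract (ten M N) x y t b)"
    if "x \<in> Obj A" "y \<in> Obj A" "b \<in> end_set A x" for x y b
    using tens_lift_linear[OF M N that(1,2) mod ract_balanced[OF M N that]] that by (simp add: tensor_def)
  note lp = lact_pure[OF M N] and rp = ract_pure[OF M N]
  show ?thesis
  proof (rule bimodule.intro, unfold Sp_tensor)
    fix x y assume xy: "x \<in> Obj A" "y \<in> Obj A"
    note ag = tens_agree[OF M N xy mod[OF xy]]
    note ll = ll[OF xy] and rl = rl[OF xy]
    show "module R (tsp M N x y)" using mod xy .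
    show "linear_map R (tsp M N x y) (tsp M N x y) (\<lambda>m. lact (ten M N) x y a m)"
      if "a \<in> end_set A y" for a using ll that .
    show "linear_map R (tsp M N x y) (tsp M N x y) (\<lambda>m. ract (ten M N) x y m b)"
      if "b \<in> end_set A x" for b using rl that .
    fix t assume t: "t \<in> carrier (tsp M N x y)"
    show "linear_map R (Hom A y y) (tsp M N x y) (\<lambda>a. lact (ten M N) x y a t)"
      unfolding tensor_def
      by (simp, rule tens_lift_linear_param[OF M N xy mod[OF xy] Hom_module[OF xy(2) xy(2)] _ _ t])
        (use xy M N in \<open>auto intro!: lact_balanced linear_map_compose[OF bimodule.lact_linear' pure_linear_left]\<close>)
    show "linear_map R (Hom A x x) (tsp M N x y) (\<lambda>a. ract (ten M N) x y t a)"
      unfolding tensor_def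
      by (simp, rule tens_lift_linear_param[OF M N xy mod[OF xy] Hom_module[OF xy(1) xy(1)] _ _ t])
        (use xy M N in \<open>auto intro!: ract_balanced linear_map_compose[OF bimodule.ract_linear' pure_linear_right]\<close>)
    have Id: "Id A x \<in> end_set A x" "Id A y \<in> end_set A y" using xy by (auto intro: Id_closed)
    show "lact (ten M N) x y (Id A y) t = t"
      by (rule ag[OF ll[OF Id(2)] linear_map_id _ t]) (use xy Id M N in \<open>simp_all add: lp bimodule.lact_Id\<close>)
    show "ract (ten M N) x y t (Id A x) = t"
      by (rule ag[OF rl[OF Id(1)] linear_map_id _ t]) (use xy Id M N in \<open>simp_all add: rp bimodule.ract_Id\<close>)
    show "lact (ten M N) x y (Comp A y y y a a') t =
        lact (ten M N) x y a (lact (ten M N) x y a' t)"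
      if a: "a \<in> end_set A y" "a' \<in> end_set A y" for a a'
    proof -
      have c: "Comp A y y y a a' \<in> end_set A y" using xy a by (auto intro: Comp_closed)
      show ?thesis
        by (rule ag[OF ll[OF c] linear_map_compose[OF ll[OF a(2)] ll[OF a(1)]] _ t])
          (use xy a c M N in \<open>simp_all add: lp bimodule.lact_Comp\<close>)
    qed
    show "ract (ten M N) x y t (Comp A x x x b b') =
        ract (ten M N) x y (ract (ten M N) x y t b) b'"
      if b: "b \<in> end_set A x" "b' \<in> end_set A x" for b b'
    proof -
      have c: "Comp A x x x b b' \<in> end_set A x" using xy b by (auto intro: Comp_closed)
      show ?thesis
        by (rule ag[OF rl[OF c] linear_map_compose[OF rl[OF b(1)] rl[OF b(2)]] _ t])
          (use xy b c M N in \<open>simp_all add: rp bimodule.ract_Comp\<close>)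
    qed
    show "ract (ten M N) x y (lact (ten M N) x y a t) b =
        lact (ten M N) x y a (ract (ten M N) x y t b)"
      if a: "a \<in> end_set A y" "b \<in> end_set A x" for a b
      by (rule ag[OF linear_map_compose[OF ll[OF a(1)] rl[OF a(2)]] linear_map_compose[OF rl[OF a(2)] ll[OF a(1)]] _ t])
          (use xy a M N in \<open>simp_all add: rp lp\<close>)
  qed
qed

lemma Sp_unit [simp]: "Sp (unit_bimod A) = Hom A"
  and lact_unit [simp]: "lact (unit_bimod A) x y = Comp A x y y"
  and ract_unit [simp]: "ract (unit_bimod A) x y = Comp A x x y"
  by (auto simp: unit_bimod_def)

lemma unit_bimodule [simp]: "bim (unit_bimod A)"
  by (rule bimodule.intro)
    (auto simp: Comp_Id_left Comp_Id_right Comp_assoc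
      intro: Hom_module Comp_linear_left Comp_linear_right)

lemma tens_lift_hom:
  assumes M: "bim M" and N: "bim N" and Q: "bim Q"
    and b: "\<And>x y. x \<in> Obj A \<Longrightarrow> y \<in> Obj A \<Longrightarrow> balanced R A M N x y (Sp Q x y) (\<beta> x y)"
    and l: "\<And>x y z m n a. x \<in> Obj A \<Longrightarrow> y \<in> Obj A \<Longrightarrow> z \<in> Obj A \<Longrightarrow> m \<in> cs M z y \<Longrightarrow>
      n \<in> cs N x z \<Longrightarrow> a \<in> end_set A y \<Longrightarrow> \<beta> x y z (lact M z y a m) n = lact Q x y a (\<beta> x y z m n)"
    and r: "\<And>x y z m n a. x \<in> Obj A \<Longrightarrow> y \<in> Obj A \<Longrightarrow> z \<in> Obj A \<Longrightarrow> m \<in> cs M z y \<Longrightarrow>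
      n \<in> cs N x z \<Longrightarrow> a \<in> end_set A x \<Longrightarrow> \<beta> x y z m (ract N x z n a) = ract Q x y (\<beta> x y z m n) a"
  shows "bimod_hom R A (ten M N) Q (\<lambda>x y. tlift M N x y (Sp Q x y) (\<beta> x y))"
proof -
  note MN = tensor_bimodule[OF M N]
  show ?thesis unfolding bimod_hom_def
  proof (intro ballI conjI)
    fix x y assume xy: "x \<in> Obj A" "y \<in> Obj A"
    have mQ: "module R (Sp Q x y)" using Q xy by simp
    note tl = tens_lift_linear[OF M N xy mQ b[OF xy]] and tp = tens_lift_pure[OF M N xy mQ b[OF xy]]
    note ag = tens_agree[OF M N xy mQ]
    show "linear_map R (Sp (ten M N) x y) (Sp Q x y) (tlift M N x y (Sp Q x y) (\<beta> x y))"
      using tl by simp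
    fix t a assume t: "t \<in> cs (ten M N) x y"
    { assume a: "a \<in> end_set A y"
      note ll = bimodule.lact_linear[OF MN xy a, unfolded Sp_tensor] bimodule.lact_linear[OF Q xy a]
      show "tlift M N x y (Sp Q x y) (\<beta> x y) (lact (ten M N) x y a t) =
        lact Q x y a (tlift M N x y (Sp Q x y) (\<beta> x y) t)"
        by (rule ag[OF linear_map_compose[OF ll(1) tl] linear_map_compose[OF tl ll(2)] _ t[unfolded Sp_tensor]])
          (use M N xy a in \<open>simp add: lact_pure tp l\<close>) }
    { assume a: "a \<in> end_set A x"
      note ll = bimodule.ract_linear[OF MN xy a, unfolded Sp_tensor] bimodule.ract_linear[OF Q xy a]
      show "tlift M N x y (Sp Q x y) (\<beta> x y) (ract (ten M N) x y t a) =
        ract Q x y (tlift M N x y (Sp Q x y) (\<beta> x y) t) a"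
        by (rule ag[OF linear_map_compose[OF ll(1) tl] linear_map_compose[OF tl ll(2)] _ t[unfolded Sp_tensor]])
          (use M N xy a in \<open>simp add: ract_pure tp r\<close>) }
  qed
qed

lemma tens_map_balanced:
  assumes "bim M" "bim N" "bim M'" "bim N'" and f: "bimod_hom R A M M' f" and g: "bimod_hom R A N N' g"
    and "x \<in> Obj A" "y \<in> Obj A"
  shows "balanced R A M N x y (tsp M' N' x y) (\<lambda>z m n. pure M' N' x y z (f z y m) (g x z n))"
  using assms(1-4,7,8)
  by (intro balancedI)
    (auto intro!: linear_map_compose[OF bimod_hom_linear[OF f] pure_linear_left]
       linear_map_compose[OF bimod_hom_linear[OF g] pure_linear_right] bimod_hom_closed[OF f] bimod_hom_closed[OF g]
      simp: bimod_hom_ract[OF f] bimod_hom_lact[OF g] pure_shift bimod_hom_closed[OF f] bimod_hom_closed[OF g])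

lemma tens_map_pure:
  assumes "bim M" "bim N" "bim M'" "bim N'" and f: "bimod_hom R A M M' f" and g: "bimod_hom R A N N' g"
    and "x \<in> Obj A" "y \<in> Obj A" "z \<in> Obj A" "m \<in> cs M z y" "n \<in> cs N x z"
  shows "tmap M N M' N' f g x y (pure M N x y z m n) = pure M' N' x y z (f z y m) (g x z n)"
  using assms by (simp add: tens_map_def tens_lift_pure[OF _ _ _ _ _ tens_map_balanced])

lemma tens_map_hom:
  assumes "bim M" "bim N" "bim M'" "bim N'" and f: "bimod_hom R A M M' f" and g: "bimod_hom R A N N' g"
  shows "bimod_hom R A (ten M N) (ten M' N') (tmap M N M' N' f g)"
proof -
  have e: "tmap M N M' N' f g = (\<lambda>x y. tlift M N x y (Sp (ten M' N') x y)
    (\<lambda>z m n. pure M' N' x y z (f z y m) (g x z n)))"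
    by (auto simp: tens_map_def fun_eq_iff)
  show ?thesis unfolding e
    by (rule tens_lift_hom)
      (use assms in \<open>auto simp: tens_map_balanced bimod_hom_lact[OF f] bimod_hom_ract[OF g]
         lact_pure ract_pure bimod_hom_closed[OF f] bimod_hom_closed[OF g]\<close>)
qed

end

section \<open>The associators of the tensor product\<close>

context bimodule_category begin

lemma assoc_inner_balanced:
  assumes "bim M" "bim N" "bim P" "x \<in> Obj A" "y \<in> Obj A" "z \<in> Obj A" "p \<in> cs P x z"
  shows "balanced R A M N z y (tsp M (ten N P) x y)
    (\<lambda>w m n. pure M (ten N P) x y w m (pure N P x w z n p))"
  using assms
  by (intro balancedI)
    (auto intro!: linear_map_compose[OF pure_linear_left pure_linear_right[of M "ten N P", unfolded Sp_tensor]]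
       pure_linear_left simp: pure_shift lact_pure)

text \<open>\<open>assoc\<close> is a lift inside a lift, and this concerns the outer one. The inner
  lift is linear in \<open>s\<close> as every lift is, and in \<open>p\<close> as a lift that
  depends on a parameter. A scalar at \<open>z\<close> passes from \<open>s\<close> to
  \<open>p\<close> through the inner tensor \<open>n \<otimes> p\<close>.\<close>

lemma assoc_balanced:
  assumes M: "bim M" and N: "bim N" and P: "bim P" and xy: "x \<in> Obj A" "y \<in> Obj A"
  shows "balanced R A (ten M N) P x y (tsp M (ten N P) x y)
    (\<lambda>z s p. tlift M N z y (tsp M (ten N P) x y)
           (\<lambda>w m n. pure M (ten N P) x y w m (pure N P x w z n p)) s)"
proof (rule balancedI, unfold Sp_tensor)
  have T: "module R (tsp M (ten N P) x y)" using assms by simp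
  note ib = assoc_inner_balanced[OF M N P xy]
  { fix z s assume z: "z \<in> Obj A" and s: "s \<in> carrier (tsp M N z y)"
    show "linear_map R (Sp P x z) (tsp M (ten N P) x y)
      (\<lambda>p. tlift M N z y (tsp M (ten N P) x y)
           (\<lambda>w m n. pure M (ten N P) x y w m (pure N P x w z n p)) s)"
      by (rule tens_lift_linear_param[OF M N z xy(2) T _ ib[OF z] _ s])
        (use assms z in \<open>auto intro!: linear_map_compose[OF pure_linear_right pure_linear_right[of M "ten N P", unfolded Sp_tensor]]\<close>) }
  { fix z p assume z: "z \<in> Obj A" and p: "p \<in> cs P x z"
    show "linear_map R (tsp M N z y) (tsp M (ten N P) x y)
      (\<lambda>s. tlift M N z y (tsp M (ten N P) x y)
           (\<lambda>w m n. pure M (ten N P) x y w m (pure N P x w z n p)) s)"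
      by (rule tens_lift_linear[OF M N z xy(2) T ib[OF z p]]) }
  fix z s b p assume z: "z \<in> Obj A" and s: "s \<in> carrier (tsp M N z y)"
    and b: "b \<in> end_set A z" and p: "p \<in> cs P x z"
  have bp: "lact P x z b p \<in> cs P x z" using assms z b p by simp
  show "tlift M N z y (tsp M (ten N P) x y)
           (\<lambda>w m n. pure M (ten N P) x y w m (pure N P x w z n p)) (ract (ten M N) z y s b) =
    tlift M N z y (tsp M (ten N P) x y)
           (\<lambda>w m n. pure M (ten N P) x y w m (pure N P x w z n (lact P x z b p))) s"
    by (rule tens_agree[OF M N z xy(2) T linear_map_compose[OF bimodule.ract_linear[OF tensor_bimodule[OF M N] z xy(2) b, unfolded Sp_tensor]
            tens_lift_linear[OF M N z xy(2) T ib[OF z p]]]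
          tens_lift_linear[OF M N z xy(2) T ib[OF z bp]] _ s])
      (use assms z b p bp
        in \<open>simp_all add: ract_pure pure_shift tens_lift_pure[OF _ _ _ _ _ ib]\<close>)
qed

lemma assoc_pure:
  assumes M: "bim M" and N: "bim N" and P: "bim P" and xy: "x \<in> Obj A" "y \<in> Obj A" "z \<in> Obj A" "w \<in> Obj A"
    "m \<in> cs M w y" "n \<in> cs N z w" "p \<in> cs P x z"
  shows "assoc R A M N P x y (pure (ten M N) P x y z (pure M N z y w m n) p) =
    pure M (ten N P) x y w m (pure N P x w z n p)"
  using assms
  by (simp add: assoc_def Let_def tens_lift_pure[OF _ _ _ _ _ assoc_balanced]
      tens_lift_pure[OF _ _ _ _ _ assoc_inner_balanced])

lemma assoc_hom:
  assumes M: "bim M" and N: "bim N" and P: "bim P"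
  shows "bimod_hom R A (ten (ten M N) P) (ten M (ten N P)) (assoc R A M N P)"
proof -
  have e: "assoc R A M N P = (\<lambda>x y. tlift (ten M N) P x y (Sp (ten M (ten N P)) x y)
    (\<lambda>z s p. tlift M N z y (tsp M (ten N P) x y)
           (\<lambda>w m n. pure M (ten N P) x y w m (pure N P x w z n p)) s))"
    by (auto simp: assoc_def fun_eq_iff Let_def)
  show ?thesis unfolding e
  proof (rule tens_lift_hom, unfold Sp_tensor)
    fix x y z s p a assume xyz: "x \<in> Obj A" "y \<in> Obj A" "z \<in> Obj A" and s: "s \<in> carrier (tsp M N z y)"
      and p: "p \<in> cs P x z"
    have T: "module R (tsp M (ten N P) x y)" using assms xyz by simp
    note ib = assoc_inner_balanced[OF M N P xyz(1-3)]
    note tl = tens_lift_linear[OF M N xyz(3,2) T ib]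
    { assume a: "a \<in> end_set A y"
      note ll = bimodule.lact_linear[OF tensor_bimodule[OF M N] xyz(3,2) a, unfolded Sp_tensor]
            bimodule.lact_linear[OF tensor_bimodule[OF M tensor_bimodule[OF N P]] xyz(1,2) a, unfolded Sp_tensor]
      show "tlift M N z y (tsp M (ten N P) x y)
           (\<lambda>w m n. pure M (ten N P) x y w m (pure N P x w z n p)) (lact (ten M N) z y a s) =
         lact (ten M (ten N P)) x y a (tlift M N z y (tsp M (ten N P) x y)
           (\<lambda>w m n. pure M (ten N P) x y w m (pure N P x w z n p)) s)"
        by (rule tens_agree[OF M N xyz(3,2) T linear_map_compose[OF ll(1) tl[OF p]] linear_map_compose[OF tl[OF p] ll(2)] _ s])
         (use assms xyz a p in \<open>simp_all add: lact_pure tens_lift_pure[OF _ _ _ _ _ ib]\<close>) }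
    { assume a: "a \<in> end_set A x"
      note ll = bimodule.ract_linear[OF tensor_bimodule[OF M tensor_bimodule[OF N P]] xyz(1,2) a, unfolded Sp_tensor]
      have pa: "ract P x z p a \<in> cs P x z" using assms xyz p a by simp
      show "tlift M N z y (tsp M (ten N P) x y)
           (\<lambda>w m n. pure M (ten N P) x y w m (pure N P x w z n (ract P x z p a))) s =
         ract (ten M (ten N P)) x y (tlift M N z y (tsp M (ten N P) x y)
           (\<lambda>w m n. pure M (ten N P) x y w m (pure N P x w z n p)) s) a"
        by (rule tens_agree[OF M N xyz(3,2) T tl[OF pa] linear_map_compose[OF tl[OF p] ll] _ s])
         (use assms xyz a p pa in \<open>simp_all add: ract_pure tens_lift_pure[OF _ _ _ _ _ ib]\<close>) }
  qed (use assms assoc_balanced in auto)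
qed

lemma assoc_inv_inner_balanced:
  assumes "bim M" "bim N" "bim P" "x \<in> Obj A" "y \<in> Obj A" "w \<in> Obj A" "m \<in> cs M w y"
  shows "balanced R A N P x w (tsp (ten M N) P x y)
    (\<lambda>z n p. pure (ten M N) P x y z (pure M N z y w m n) p)"
proof (rule balancedI)
  show "linear_map R (Sp P x z) (tsp (ten M N) P x y)
      (pure (ten M N) P x y z (pure M N z y w m n))" if "z \<in> Obj A" "n \<in> cs N z w" for z n
    using assms that by (intro pure_linear_right) auto
  show "linear_map R (Sp N z w) (tsp (ten M N) P x y)
      (\<lambda>n. pure (ten M N) P x y z (pure M N z y w m n) p)" if "z \<in> Obj A" "p \<in> cs P x z" for z p
    using assms that
    by (intro linear_map_compose[OF pure_linear_right pure_linear_left[of "ten M N" P, unfolded Sp_tensor]]) auto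
  show "pure (ten M N) P x y z (pure M N z y w m (ract N z w n b)) p =
      pure (ten M N) P x y z (pure M N z y w m n) (lact P x z b p)"
    if "z \<in> Obj A" "n \<in> cs N z w" "b \<in> end_set A z" "p \<in> cs P x z" for z n b p
    using assms that pure_shift[of "ten M N" P x y z "pure M N z y w m n" b p] by (simp add: ract_pure)
qed

text \<open>Mirror image of \<open>assoc_balanced\<close>: here the scalar at \<open>w\<close>
  passes from \<open>m\<close> to \<open>s\<close> through the inner tensor
  \<open>m \<otimes> n\<close>.\<close>

lemma assoc_inv_balanced:
  assumes M: "bim M" and N: "bim N" and P: "bim P" and xy: "x \<in> Obj A" "y \<in> Obj A"
  shows "balanced R A M (ten N P) x y (tsp (ten M N) P x y)
    (\<lambda>w m s. tlift N P x w (tsp (ten M N) P x y)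
           (\<lambda>z n p. pure (ten M N) P x y z (pure M N z y w m n) p) s)"
proof (rule balancedI, unfold Sp_tensor)
  have T: "module R (tsp (ten M N) P x y)" using assms by simp
  note ib = assoc_inv_inner_balanced[OF M N P xy]
  { fix w m assume w: "w \<in> Obj A" and m: "m \<in> cs M w y"
    show "linear_map R (tsp N P x w) (tsp (ten M N) P x y)
      (\<lambda>s. tlift N P x w (tsp (ten M N) P x y)
           (\<lambda>z n p. pure (ten M N) P x y z (pure M N z y w m n) p) s)"
      by (rule tens_lift_linear[OF N P xy(1) w T ib[OF w m]]) }
  { fix w s assume w: "w \<in> Obj A" and s: "s \<in> carrier (tsp N P x w)"
    show "linear_map R (Sp M w y) (tsp (ten M N) P x y)
      (\<lambda>m. tlift N P x w (tsp (ten M N) P x y)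
           (\<lambda>z n p. pure (ten M N) P x y z (pure M N z y w m n) p) s)"
      by (rule tens_lift_linear_param[OF N P xy(1) w T _ ib[OF w] _ s])
        (use assms w in \<open>auto intro!: linear_map_compose[OF pure_linear_left pure_linear_left[of "ten M N" P, unfolded Sp_tensor]]\<close>) }
  fix w m b s assume w: "w \<in> Obj A" and s: "s \<in> carrier (tsp N P x w)"
    and b: "b \<in> end_set A w" and m: "m \<in> cs M w y"
  have mb: "ract M w y m b \<in> cs M w y" using assms w b m by simp
  show "tlift N P x w (tsp (ten M N) P x y)
           (\<lambda>z n p. pure (ten M N) P x y z (pure M N z y w (ract M w y m b) n) p) s =
    tlift N P x w (tsp (ten M N) P x y)
           (\<lambda>z n p. pure (ten M N) P x y z (pure M N z y w m n) p) (lact (ten N P) x w b s)"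
    by (rule tens_agree[OF N P xy(1) w T tens_lift_linear[OF N P xy(1) w T ib[OF w mb]]
          linear_map_compose[OF bimodule.lact_linear[OF tensor_bimodule[OF N P] xy(1) w b, unfolded Sp_tensor]
            tens_lift_linear[OF N P xy(1) w T ib[OF w m]]] _ s])
      (use assms w b m mb
        in \<open>simp_all add: lact_pure pure_shift tens_lift_pure[OF _ _ _ _ _ ib]\<close>)
qed

lemma assoc_inv_pure:
  assumes M: "bim M" and N: "bim N" and P: "bim P" and xy: "x \<in> Obj A" "y \<in> Obj A" "z \<in> Obj A" "w \<in> Obj A"
    "m \<in> cs M w y" "n \<in> cs N z w" "p \<in> cs P x z"
  shows "assoc_inv R A M N P x y (pure M (ten N P) x y w m (pure N P x w z n p)) =
    pure (ten M N) P x y z (pure M N z y w m n) p"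
  using assms
  by (simp add: assoc_inv_def Let_def tens_lift_pure[OF _ _ _ _ _ assoc_inv_balanced]
      tens_lift_pure[OF _ _ _ _ _ assoc_inv_inner_balanced])

lemma assoc_inv_hom:
  assumes M: "bim M" and N: "bim N" and P: "bim P"
  shows "bimod_hom R A (ten M (ten N P)) (ten (ten M N) P) (assoc_inv R A M N P)"
proof -
  have e: "assoc_inv R A M N P = (\<lambda>x y. tlift M (ten N P) x y (Sp (ten (ten M N) P) x y)
    (\<lambda>w m s. tlift N P x w (tsp (ten M N) P x y)
           (\<lambda>z n p. pure (ten M N) P x y z (pure M N z y w m n) p) s))"
    by (auto simp: assoc_inv_def fun_eq_iff Let_def)
  show ?thesis unfolding e
  proof (rule tens_lift_hom, unfold Sp_tensor)
    fix x y w m s a assume xyw: "x \<in> Obj A" "y \<in> Obj A" "w \<in> Obj A" and s: "s \<in> carrier (tsp N P x w)"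
      and m: "m \<in> cs M w y"
    have T: "module R (tsp (ten M N) P x y)" using assms xyw by simp
    note ib = assoc_inv_inner_balanced[OF M N P xyw(1-3)]
    note tl = tens_lift_linear[OF N P xyw(1,3) T ib]
    { assume a: "a \<in> end_set A y"
      have am: "lact M w y a m \<in> cs M w y" using assms xyw m a by simp
      note ll = bimodule.lact_linear[OF tensor_bimodule[OF tensor_bimodule[OF M N] P] xyw(1,2) a, unfolded Sp_tensor]
      show "tlift N P x w (tsp (ten M N) P x y)
           (\<lambda>z n p. pure (ten M N) P x y z (pure M N z y w (lact M w y a m) n) p) s =
         lact (ten (ten M N) P) x y a (tlift N P x w (tsp (ten M N) P x y)
           (\<lambda>z n p. pure (ten M N) P x y z (pure M N z y w m n) p) s)"
        by (rule tens_agree[OF N P xyw(1,3) T tl[OF am] linear_map_compose[OF tl[OF m] ll] _ s])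
         (use assms xyw a m am in \<open>simp_all add: lact_pure tens_lift_pure[OF _ _ _ _ _ ib]\<close>) }
    { assume a: "a \<in> end_set A x"
      note ll = bimodule.ract_linear[OF tensor_bimodule[OF N P] xyw(1,3) a, unfolded Sp_tensor]
            bimodule.ract_linear[OF tensor_bimodule[OF tensor_bimodule[OF M N] P] xyw(1,2) a, unfolded Sp_tensor]
      show "tlift N P x w (tsp (ten M N) P x y)
           (\<lambda>z n p. pure (ten M N) P x y z (pure M N z y w m n) p) (ract (ten N P) x w s a) =
         ract (ten (ten M N) P) x y (tlift N P x w (tsp (ten M N) P x y)
           (\<lambda>z n p. pure (ten M N) P x y z (pure M N z y w m n) p) s) a"
        by (rule tens_agree[OF N P xyw(1,3) T linear_map_compose[OF ll(1) tl[OF m]] linear_map_compose[OF tl[OF m] ll(2)] _ s])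
         (use assms xyw a m in \<open>simp_all add: ract_pure tens_lift_pure[OF _ _ _ _ _ ib]\<close>) }
  qed (use assms assoc_inv_balanced in auto)
qed

end

section \<open>Triple tensors, functoriality of the tensor product, and the unit
  isomorphisms\<close>

context bimodule_category begin

text \<open>Two applications of \<open>tens_agree\<close>: with the outer factor fixed, both maps
  are linear in the inner tensor. The associativity axioms live on triple tensors, hence this
  form.\<close>

lemma tens3_agree_left:
  assumes M: "bim M" and N: "bim N" and P: "bim P" and xy: "x \<in> Obj A" "y \<in> Obj A" and Q: "module R Q"
    and f: "linear_map R (tsp (ten M N) P x y) Q f"
    and g: "linear_map R (tsp (ten M N) P x y) Q g"
    and eq: "\<And>z w m n p. z \<in> Obj A \<Longrightarrow> w \<in> Obj A \<Longrightarrow> m \<in> cs M w y \<Longrightarrow> n \<in> cs N z w \<Longrightarrow>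
      p \<in> cs P x z \<Longrightarrow>
      f (pure (ten M N) P x y z (pure M N z y w m n) p) = g (pure (ten M N) P x y z (pure M N z y w m n) p)"
    and t: "t \<in> carrier (tsp (ten M N) P x y)"
  shows "f t = g t"
proof (rule tens_agree[OF tensor_bimodule[OF M N] P xy Q f g _ t], unfold Sp_tensor)
  fix z s p assume z: "z \<in> Obj A" and s: "s \<in> carrier (tsp M N z y)" and p: "p \<in> cs P x z"
  note l = pure_linear_left[OF tensor_bimodule[OF M N] P xy z p, unfolded Sp_tensor]
  show "f (pure (ten M N) P x y z s p) = g (pure (ten M N) P x y z s p)"
    by (rule tens_agree[OF M N z xy(2) Q linear_map_compose[OF l f] linear_map_compose[OF l g] _ s])
      (use z p eq in auto)
qed

lemma tens3_agree_right:
  assumes M: "bim M" and N: "bim N" and P: "bim P" and xy: "x \<in> Obj A" "y \<in> Obj A" and Q: "module R Q"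
    and f: "linear_map R (tsp M (ten N P) x y) Q f"
    and g: "linear_map R (tsp M (ten N P) x y) Q g"
    and eq: "\<And>z w m n p. z \<in> Obj A \<Longrightarrow> w \<in> Obj A \<Longrightarrow> m \<in> cs M w y \<Longrightarrow> n \<in> cs N z w \<Longrightarrow>
      p \<in> cs P x z \<Longrightarrow>
      f (pure M (ten N P) x y w m (pure N P x w z n p)) = g (pure M (ten N P) x y w m (pure N P x w z n p))"
    and t: "t \<in> carrier (tsp M (ten N P) x y)"
  shows "f t = g t"
proof (rule tens_agree[OF M tensor_bimodule[OF N P] xy Q f g _ t], unfold Sp_tensor)
  fix w m s assume w: "w \<in> Obj A" and s: "s \<in> carrier (tsp N P x w)" and m: "m \<in> cs M w y"
  note l = pure_linear_right[OF M tensor_bimodule[OF N P] xy w m, unfolded Sp_tensor]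
  show "f (pure M (ten N P) x y w m s) = g (pure M (ten N P) x y w m s)"
    by (rule tens_agree[OF N P xy(1) w Q linear_map_compose[OF l f] linear_map_compose[OF l g] _ s])
      (use w m eq in auto)
qed

lemma tens_map_compose:
  assumes "bim M" "bim N" "bim M'" "bim N'" "bim M''" "bim N''"
    and f: "bimod_hom R A M M' f" and g: "bimod_hom R A N N' g"
    and f': "bimod_hom R A M' M'' f'" and g': "bimod_hom R A N' N'' g'"
    and xy: "x \<in> Obj A" "y \<in> Obj A" and t: "t \<in> carrier (tsp M N x y)"
  shows "tmap M' N' M'' N'' f' g' x y (tmap M N M' N' f g x y t) =
    tmap M N M'' N'' (\<lambda>x y m. f' x y (f x y m)) (\<lambda>x y n. g' x y (g x y n)) x y t"
proof -
  note h = tens_map_hom[OF assms(1-4) f g] and h' = tens_map_hom[OF assms(3-6) f' g']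
    and h'' = tens_map_hom[OF assms(1,2,5,6) bimod_hom_compose[OF f f'] bimod_hom_compose[OF g g']]
  show ?thesis
    by (rule tens_agree[OF assms(1,2) xy tens_module[OF assms(5,6) xy]
          bimod_hom_linear[OF bimod_hom_compose[OF h h'] xy, unfolded Sp_tensor]
          bimod_hom_linear[OF h'' xy, unfolded Sp_tensor] _ t])
      (use assms in \<open>simp add: tens_map_pure bimod_hom_compose bimod_hom_closed[OF f] bimod_hom_closed[OF g]\<close>)
qed

text \<open>The maps are asked to be the identity on carriers, which is what mutually inverse
  morphisms give for their composites.\<close>

lemma tens_map_ident:
  assumes M: "bim M" and N: "bim N"
    and f: "bimod_hom R A M M f" and g: "bimod_hom R A N N g"
    and fi: "\<And>x y m. x \<in> Obj A \<Longrightarrow> y \<in> Obj A \<Longrightarrow> m \<in> cs M x y \<Longrightarrow> f x y m = m"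
    and gi: "\<And>x y n. x \<in> Obj A \<Longrightarrow> y \<in> Obj A \<Longrightarrow> n \<in> cs N x y \<Longrightarrow> g x y n = n"
    and xy: "x \<in> Obj A" "y \<in> Obj A" and t: "t \<in> carrier (tsp M N x y)"
  shows "tmap M N M N f g x y t = t"
  by (rule tens_agree[OF M N xy tens_module[OF M N xy]
        bimod_hom_linear[OF tens_map_hom[OF M N M N f g] xy, unfolded Sp_tensor] linear_map_id _ t])
    (use assms in \<open>simp add: tens_map_pure\<close>)

text \<open>Balancing is a condition at each \<open>z\<close> separately: for
  \<open>z \<noteq> y\<close> the map is constantly zero, and for \<open>z = y\<close> the condition
  is the action law \<open>lact_Comp\<close>.\<close>

lemma lunit_balanced:
  assumes M: "bim M" and xy: "x \<in> Obj A" "y \<in> Obj A"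
  shows "balanced R A (unit_bimod A) M x y (Sp M x y)
    (\<lambda>z a m. if z = y then lact M x y a m else \<zero>\<^bsub>Sp M x y\<^esub>)"
proof -
  have m: "module R (Sp M x y)" using assms by simp
  show ?thesis
  proof (rule balancedI, goal_cases)
    case (1 z a) then show ?case
      using bimodule.lact_linear[OF M xy] linear_map_const_zero[OF m] by (cases "z = y") auto
  next
    case (2 z n) then show ?case
      using bimodule.lact_linear'[OF M xy] linear_map_const_zero[OF m] by (cases "z = y") auto
  next
    case (3 z a b n) then show ?case
      using bimodule.lact_Comp[OF M xy] by auto
  qed
qed

lemma runit_balanced:
  assumes M: "bim M" and xy: "x \<in> Obj A" "y \<in> Obj A"
  shows "balanced R A M (unit_bimod A) x y (Sp M x y)
    (\<lambda>z m a. if z = x then ract M x y m a else \<zero>\<^bsub>Sp M x y\<^esub>)"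
proof -
  have m: "module R (Sp M x y)" using assms by simp
  show ?thesis
  proof (rule balancedI, goal_cases)
    case (1 z a) then show ?case
      using bimodule.ract_linear'[OF M xy] linear_map_const_zero[OF m] by (cases "z = x") auto
  next
    case (2 z n) then show ?case
      using bimodule.ract_linear[OF M xy] linear_map_const_zero[OF m] by (cases "z = x") auto
  next
    case (3 z a b n) then show ?case
      using bimodule.ract_Comp[OF M xy] by auto
  qed
qed

lemma lunit_pure:
  "\<lbrakk>bim M; x \<in> Obj A; y \<in> Obj A; a \<in> end_set A y; m \<in> cs M x y\<rbrakk> \<Longrightarrow>
     lunit R A M x y (pure (unit_bimod A) M x y y a m) = lact M x y a m"
  by (simp add: lunit_def tens_lift_pure[OF _ _ _ _ _ lunit_balanced])

lemma runit_pure: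
  "\<lbrakk>bim M; x \<in> Obj A; y \<in> Obj A; a \<in> end_set A x; m \<in> cs M x y\<rbrakk> \<Longrightarrow>
     runit R A M x y (pure M (unit_bimod A) x y x m a) = ract M x y m a"
  by (simp add: runit_def tens_lift_pure[OF _ _ _ _ _ runit_balanced])

lemma lunit_linear:
  "\<lbrakk>bim M; x \<in> Obj A; y \<in> Obj A\<rbrakk> \<Longrightarrow>
     linear_map R (tsp (unit_bimod A) M x y) (Sp M x y) (lunit R A M x y)"
  unfolding lunit_def by (rule tens_lift_linear) (auto intro: lunit_balanced)

lemma runit_linear:
  "\<lbrakk>bim M; x \<in> Obj A; y \<in> Obj A\<rbrakk> \<Longrightarrow>
     linear_map R (tsp M (unit_bimod A) x y) (Sp M x y) (runit R A M x y)"
  unfolding runit_def by (rule tens_lift_linear) (auto intro: runit_balanced)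

lemma lunit_inv_linear:
  "\<lbrakk>bim M; x \<in> Obj A; y \<in> Obj A\<rbrakk> \<Longrightarrow>
     linear_map R (Sp M x y) (tsp (unit_bimod A) M x y) (lunit_inv R A M x y)"
  unfolding lunit_inv_def by (rule pure_linear_right) (auto intro: Id_closed)

lemma runit_inv_linear:
  "\<lbrakk>bim M; x \<in> Obj A; y \<in> Obj A\<rbrakk> \<Longrightarrow>
     linear_map R (Sp M x y) (tsp M (unit_bimod A) x y) (runit_inv R A M x y)"
  unfolding runit_inv_def by (rule pure_linear_left) (auto intro: Id_closed)

section \<open>Monoids, elementwise\<close>

abbreviation mon :: "('o, 'k, 'a, 'm, 's) bimod_mon_scheme \<Rightarrow> bool" where "mon \<equiv> bimod_monoid R A"

text \<open>Composition in the category that \<open>category_of_monoid\<close> attaches to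
  \<open>D\<close>.\<close>

definition mul :: "('o, 'k, 'a, 'm, 's) bimod_mon_scheme \<Rightarrow> 'o \<Rightarrow> 'o \<Rightarrow> 'o \<Rightarrow> 'm \<Rightarrow> 'm \<Rightarrow> 'm" where
  "mul D x y z g f = Mu D x z (pure D D x z y g f)"

definition un :: "('o, 'k, 'a, 'm, 's) bimod_mon_scheme \<Rightarrow> 'o \<Rightarrow> 'm" where
  "un D x = Eta D x x (Id A x)"

lemma mon_bim [simp]: "mon D \<Longrightarrow> bim D" by (rule bimod_monoid.axioms(1))

context
  fixes D :: "('o, 'k, 'a, 'm, 's) bimod_mon_scheme"
  assumes D: "mon D"
begin

lemmas Mu_hom' = bimod_monoid.Mu_hom[OF D] and Eta_hom' = bimod_monoid.Eta_hom[OF D]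

lemma bimD: "bim D" using D by simp

lemma Mu_linear: "\<lbrakk>x \<in> Obj A; y \<in> Obj A\<rbrakk> \<Longrightarrow>
    linear_map R (tsp D D x y) (Sp D x y) (Mu D x y)"
  using bimod_hom_linear[OF Mu_hom'] by simp

lemma Eta_closed: "\<lbrakk>x \<in> Obj A; y \<in> Obj A; a \<in> carrier (Hom A x y)\<rbrakk> \<Longrightarrow>
    Eta D x y a \<in> cs D x y"
  using bimod_hom_closed[OF Eta_hom'] by simp

lemma un_closed: "x \<in> Obj A \<Longrightarrow> un D x \<in> cs D x x"
  unfolding un_def by (rule Eta_closed) (auto intro: Id_closed)

lemma mul_linear_right:
  "\<lbrakk>x \<in> Obj A; y \<in> Obj A; z \<in> Obj A; g \<in> cs D y z\<rbrakk> \<Longrightarrow>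
     linear_map R (Sp D x y) (Sp D x z) (mul D x y z g)"
  unfolding mul_def using linear_map_compose[OF pure_linear_right[OF bimD bimD] Mu_linear] by blast

lemma mul_closed:
  "\<lbrakk>x \<in> Obj A; y \<in> Obj A; z \<in> Obj A; g \<in> cs D y z; f \<in> cs D x y\<rbrakk> \<Longrightarrow>
     mul D x y z g f \<in> cs D x z"
  by (rule linear_map_closed[OF mul_linear_right])

text \<open>\<open>Mu_assoc\<close> evaluated at the pure tensor
  \<open>(h \<otimes> g) \<otimes> f\<close>.\<close>

lemma mul_assoc:
  assumes o: "w \<in> Obj A" "x \<in> Obj A" "y \<in> Obj A" "z \<in> Obj A" and h: "h \<in> cs D y z"
    and g: "g \<in> cs D x y" and f: "f \<in> cs D w x"
  shows "mul D w x z (mul D x y z h g) f = mul D w y z h (mul D w x y g f)"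
proof -
  have c: "pure (ten D D) D w z x (pure D D x z y h g) f \<in> carrier (Sp (ten (ten D D) D) w z)"
    using assms bimD by simp
  show ?thesis
    using bimod_monoid.Mu_assoc[OF D o(1,4) c] assms bimD
    by (simp add: tens_map_pure[OF _ _ _ _ Mu_hom' bimod_hom_id] assoc_pure tens_map_pure[OF _ _ _ _ bimod_hom_id Mu_hom'] mul_def)
qed

text \<open>The left unit axiom evaluated at \<open>a \<otimes> f\<close>; it lets the action of
  \<open>A\<close> be treated as a product.\<close>

lemma mul_Eta_left:
  assumes o: "x \<in> Obj A" "y \<in> Obj A" and "a \<in> end_set A y" "f \<in> cs D x y"
  shows "mul D x y y (Eta D y y a) f = lact D x y a f"
proof -
  have c: "pure (unit_bimod A) D x y y a f \<in> carrier (Sp (ten (unit_bimod A) D) x y)"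
    using assms bimD by simp
  show ?thesis
    using bimod_monoid.Mu_unit_left[OF D o c] assms bimD
    by (simp add: tens_map_pure[OF _ _ _ _ Eta_hom' bimod_hom_id] lunit_pure mul_def)
qed

lemma mul_Eta_right:
  assumes o: "x \<in> Obj A" "y \<in> Obj A" and "a \<in> end_set A x" "f \<in> cs D x y"
  shows "mul D x x y f (Eta D x x a) = ract D x y f a"
proof -
  have c: "pure D (unit_bimod A) x y x f a \<in> carrier (Sp (ten D (unit_bimod A)) x y)"
    using assms bimD by simp
  show ?thesis
    using bimod_monoid.Mu_unit_right[OF D o c] assms bimD
    by (simp add: tens_map_pure[OF _ _ _ _ bimod_hom_id Eta_hom'] runit_pure mul_def)
qed

lemma mul_un_left: "\<lbrakk>x \<in> Obj A; y \<in> Obj A; f \<in> cs D x y\<rbrakk> \<Longrightarrow>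
    mul D x y y (un D y) f = f"
  by (simp add: un_def mul_Eta_left Id_closed bimodule.lact_Id[OF bimD])

lemma mul_un_right: "\<lbrakk>x \<in> Obj A; y \<in> Obj A; f \<in> cs D x y\<rbrakk> \<Longrightarrow>
    mul D x x y f (un D x) = f"
  by (simp add: un_def mul_Eta_right Id_closed bimodule.ract_Id[OF bimD])

lemma Eta_lact: "\<lbrakk>x \<in> Obj A; a \<in> end_set A x\<rbrakk> \<Longrightarrow> lact D x x a (un D x) = Eta D x x a"
  using bimod_hom_lact[OF Eta_hom', of x x "Id A x" a] by (simp add: un_def Id_closed Comp_Id_right)

lemma Eta_ract: "\<lbrakk>x \<in> Obj A; a \<in> end_set A x\<rbrakk> \<Longrightarrow> ract D x x (un D x) a = Eta D x x a"
  using bimod_hom_ract[OF Eta_hom', of x x "Id A x" a] by (simp add: un_def Id_closed Comp_Id_left)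

text \<open>\<open>Eta\<close> commutes with the left action of \<open>A\<close>, and that action is
  multiplication by \<open>Eta D x x a\<close>.\<close>

lemma Eta_Comp:
  "\<lbrakk>x \<in> Obj A; a \<in> end_set A x; b \<in> end_set A x\<rbrakk> \<Longrightarrow>
     Eta D x x (Comp A x x x a b) = mul D x x x (Eta D x x a) (Eta D x x b)"
  using bimod_hom_lact[OF Eta_hom', of x x b a] by (simp add: mul_Eta_left Eta_closed)

end

lemma bimod_mon_hom_bimod: "bimod_mon_hom R A D E f \<Longrightarrow> bimod_hom R A D E f"
  by (simp add: bimod_mon_hom_def)

lemma bimod_mon_homD:
  assumes D: "mon D" and E: "mon E" and f: "bimod_mon_hom R A D E f" and o: "x \<in> Obj A" "y \<in> Obj A"
  shows "linear_map R (Sp D x y) (Sp E x y) (f x y)"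
    and "a \<in> carrier (Hom A x y) \<Longrightarrow> f x y (Eta D x y a) = Eta E x y a"
    and "x = y \<Longrightarrow> f x x (un D x) = un E x"
    and "\<lbrakk>z \<in> Obj A; g \<in> cs D y z; h \<in> cs D x y\<rbrakk> \<Longrightarrow>
       f x z (mul D x y z g h) = mul E x y z (f y z g) (f x y h)"
proof -
  have h: "bimod_hom R A D E f" by (rule bimod_mon_hom_bimod[OF f])
  then show "linear_map R (Sp D x y) (Sp E x y) (f x y)" by (rule bimod_hom_linear[OF _ o])
  show e: "a \<in> carrier (Hom A x y) \<Longrightarrow> f x y (Eta D x y a) = Eta E x y a" for a
    using f o by (simp add: bimod_mon_hom_def)
  show "x = y \<Longrightarrow> f x x (un D x) = un E x" using e Id_closed o by (simp add: un_def)
  show "f x z (mul D x y z g h) = mul E x y z (f y z g) (f x y h)"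
    if z: "z \<in> Obj A" and "g \<in> cs D y z" "h \<in> cs D x y" for z g h
  proof -
    have "pure D D x z y g h \<in> cs (ten D D) x z" using that o D by simp
    then have "f x z (Mu D x z (pure D D x z y g h)) = Mu E x z (tmap D D E E f f x z (pure D D x z y g h))"
      using f o z by (simp add: bimod_mon_hom_def)
    then show ?thesis using that o D E by (simp add: mul_def tens_map_pure[OF _ _ _ _ h h])
  qed
qed

end

section \<open>Consequences of \<open>A\<close> vanishing off the diagonal\<close>

context base_category begin

sublocale bimodule_category R A ..

lemma Hom_offdiag_zero: "\<lbrakk>x \<in> Obj A; y \<in> Obj A; x \<noteq> y; a \<in> carrier (Hom A x y)\<rbrakk> \<Longrightarrow>
    a = \<zero>\<^bsub>Hom A x y\<^esub>"
  using Hom_offdiag by blast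

text \<open>For \<open>z \<noteq> y\<close> the factor from \<open>A\<close> is zero; for
  \<open>z = y\<close> a tensor \<open>a \<otimes> m\<close> equals \<open>1 \<otimes> am\<close>.
  So the tensors with the identity of \<open>y\<close> in front already generate.\<close>

lemma unit_left_agree:
  assumes M: "bim M" and xy: "x \<in> Obj A" "y \<in> Obj A" and Q: "module R Q"
    and f: "linear_map R (tsp (unit_bimod A) M x y) Q f"
    and g: "linear_map R (tsp (unit_bimod A) M x y) Q g"
    and eq: "\<And>m. m \<in> cs M x y \<Longrightarrow>
      f (pure (unit_bimod A) M x y y (Id A y) m) = g (pure (unit_bimod A) M x y y (Id A y) m)"
    and t: "t \<in> carrier (tsp (unit_bimod A) M x y)"
  shows "f t = g t"
proof (rule tens_agree[OF unit_bimodule M xy Q f g _ t])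
  fix z a m assume z: "z \<in> Obj A" and a: "a \<in> cs (unit_bimod A) z y" and m: "m \<in> cs M x z"
  note T = tens_module[OF unit_bimodule M xy]
  show "f (pure (unit_bimod A) M x y z a m) = g (pure (unit_bimod A) M x y z a m)"
  proof (cases "z = y")
    case True
    \<comment> \<open>Writing \<open>a\<close> as the identity acted on by \<open>a\<close> makes
      \<open>pure_shift\<close> applicable.\<close>
    have "pure (unit_bimod A) M x y y (Comp A y y y (Id A y) a) m = pure (unit_bimod A) M x y y (Id A y) (lact M x y a m)"
      using pure_shift[OF unit_bimodule M xy xy(2), of "Id A y" a m] a m True xy by (simp add: Id_closed)
    then have "pure (unit_bimod A) M x y z a m = pure (unit_bimod A) M x y y (Id A y) (lact M x y a m)"
      using a True xy by (simp add: Comp_Id_left)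
    then show ?thesis using eq[of "lact M x y a m"] a m M xy True by simp
  next
    case False
    then have "pure (unit_bimod A) M x y z a m = \<zero>\<^bsub>tsp (unit_bimod A) M x y\<^esub>"
      using pure_zero(2)[OF unit_bimodule M xy z m] Hom_offdiag_zero[OF z xy(2) False] a by simp
    then show ?thesis using linear_map_zero[OF T Q f] linear_map_zero[OF T Q g] by simp
  qed
qed

lemma unit_right_agree:
  assumes M: "bim M" and xy: "x \<in> Obj A" "y \<in> Obj A" and Q: "module R Q"
    and f: "linear_map R (tsp M (unit_bimod A) x y) Q f"
    and g: "linear_map R (tsp M (unit_bimod A) x y) Q g"
    and eq: "\<And>m. m \<in> cs M x y \<Longrightarrow>
      f (pure M (unit_bimod A) x y x m (Id A x)) = g (pure M (unit_bimod A) x y x m (Id A x))"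
    and t: "t \<in> carrier (tsp M (unit_bimod A) x y)"
  shows "f t = g t"
proof (rule tens_agree[OF M unit_bimodule xy Q f g _ t])
  fix z a m assume z: "z \<in> Obj A" and m: "m \<in> cs M z y" and a: "a \<in> cs (unit_bimod A) x z"
  note T = tens_module[OF M unit_bimodule xy]
  show "f (pure M (unit_bimod A) x y z m a) = g (pure M (unit_bimod A) x y z m a)"
  proof (cases "z = x")
    case True
    have "pure M (unit_bimod A) x y x (ract M x y m a) (Id A x) = pure M (unit_bimod A) x y x m (Comp A x x x a (Id A x))"
      using pure_shift[OF M unit_bimodule xy xy(1), of m a "Id A x"] a m True xy by (simp add: Id_closed)
    then have "pure M (unit_bimod A) x y z m a = pure M (unit_bimod A) x y x (ract M x y m a) (Id A x)"
      using a True xy by (simp add: Comp_Id_right)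
    then show ?thesis using eq[of "ract M x y m a"] a m M xy True by simp
  next
    case False
    then have "pure M (unit_bimod A) x y z m a = \<zero>\<^bsub>tsp M (unit_bimod A) x y\<^esub>"
      using pure_zero(1)[OF M unit_bimodule xy z m] Hom_offdiag_zero[OF xy(1) z] a by force
    then show ?thesis using linear_map_zero[OF T Q f] linear_map_zero[OF T Q g] by simp
  qed
qed

text \<open>The source is the zero module. This settles the cases \<open>x \<noteq> y\<close> of
  statements about maps out of \<open>Hom A x y\<close>.\<close>

lemma Hom_offdiag_linear:
  assumes "x \<in> Obj A" "y \<in> Obj A" "x \<noteq> y" "module R M" "linear_map R (Hom A x y) M f" "a \<in> carrier (Hom A x y)"
  shows "f a = \<zero>\<^bsub>M\<^esub>"
  using linear_map_zero[OF Hom_module assms(4,5)] Hom_offdiag_zero assms by metis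

text \<open>For linear maps, compatibility with products and units on the diagonal entails compatibility
  with the actions, since \<open>A\<close> acts through \<open>\<eta>\<close>.\<close>

lemma bimod_mon_homI:
  assumes D: "mon D" and E: "mon E"
    and lin: "\<And>x y. x \<in> Obj A \<Longrightarrow> y \<in> Obj A \<Longrightarrow> linear_map R (Sp D x y) (Sp E x y) (f x y)"
    and eta: "\<And>x a. x \<in> Obj A \<Longrightarrow> a \<in> end_set A x \<Longrightarrow> f x x (Eta D x x a) = Eta E x x a"
    and mult: "\<And>x y z g h. x \<in> Obj A \<Longrightarrow> y \<in> Obj A \<Longrightarrow> z \<in> Obj A \<Longrightarrow> g \<in> cs D y z \<Longrightarrow>
      h \<in> cs D x y \<Longrightarrow> f x z (mul D x y z g h) = mul E x y z (f y z g) (f x y h)"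
  shows "bimod_mon_hom R A D E f"
proof -
  have h: "bimod_hom R A D E f" unfolding bimod_hom_def
  proof (intro ballI conjI)
    fix x y assume xy: "x \<in> Obj A" "y \<in> Obj A"
    show "linear_map R (Sp D x y) (Sp E x y) (f x y)" by (rule lin[OF xy])
    fix m a assume m: "m \<in> cs D x y"
    note fm = linear_map_closed[OF lin[OF xy] m]
    show "f x y (lact D x y a m) = lact E x y a (f x y m)" if a: "a \<in> end_set A y"
      using mult[OF xy xy(2) Eta_closed[OF D xy(2) xy(2) a] m] eta[OF xy(2) a]
        mul_Eta_left[OF D xy a m] mul_Eta_left[OF E xy a fm] by simp
    show "f x y (ract D x y m a) = ract E x y (f x y m) a" if a: "a \<in> end_set A x"
      using mult[OF xy(1) xy m Eta_closed[OF D xy(1) xy(1) a]] eta[OF xy(1) a]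
        mul_Eta_right[OF D xy a m] mul_Eta_right[OF E xy a fm] by simp
  qed
  show ?thesis unfolding bimod_mon_hom_def
  proof (intro ballI conjI h)
    fix x y assume xy: "x \<in> Obj A" "y \<in> Obj A"
    note mE = bimodule.Sp_module[OF mon_bim[OF E] xy]
    show "f x y (Eta D x y a) = Eta E x y a" if a: "a \<in> carrier (Hom A x y)" for a
    proof (cases "x = y")
      case True then show ?thesis using eta xy a by simp
    next
      case False
      have "linear_map R (Hom A x y) (Sp E x y) (\<lambda>a. f x y (Eta D x y a))"
        using linear_map_compose[OF bimod_hom_linear[OF Eta_hom'[OF D] xy] lin[OF xy]] by simp
      moreover have "linear_map R (Hom A x y) (Sp E x y) (Eta E x y)"
        using bimod_hom_linear[OF Eta_hom'[OF E] xy] by simp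
      ultimately show ?thesis using Hom_offdiag_linear[OF xy False mE _ a] by metis
    qed
    fix t assume t: "t \<in> cs (ten D D) x y"
    show "f x y (Mu D x y t) = Mu E x y (tmap D D E E f f x y t)"
    proof (rule tens_agree[OF _ _ xy mE linear_map_compose[OF Mu_linear[OF D xy] lin[OF xy]]
          linear_map_compose[OF bimod_hom_linear[OF tens_map_hom[OF _ _ _ _ h h] xy, unfolded Sp_tensor] Mu_linear[OF E xy]]
          _ t[unfolded Sp_tensor]])
      fix z m n assume "z \<in> Obj A" "m \<in> cs D z y" "n \<in> cs D x z"
      then show "f x y (Mu D x y (pure D D x y z m n)) = Mu E x y (tmap D D E E f f x y (pure D D x y z m n))"
        using mult[OF xy(1) _ xy(2)] D E xy by (simp add: tens_map_pure[OF _ _ _ _ h h] mul_def)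
    qed (use D E in auto)
  qed
qed

text \<open>The inverse is multiplicative because \<open>f\<close> carries the product of the
  preimages to the given product.\<close>

lemma bimod_mon_isoI:
  assumes D: "mon D" and E: "mon E" and f: "bimod_mon_hom R A D E f"
    and bij: "\<And>x y. x \<in> Obj A \<Longrightarrow> y \<in> Obj A \<Longrightarrow> bij_betw (f x y) (cs D x y) (cs E x y)"
  shows "bimod_mon_iso R A D E f"
proof -
  define g where "g x y = inv_into (cs D x y) (f x y)" for x y
  note lin = bimod_mon_homD(1)[OF D E f]
  have gl: "linear_map R (Sp E x y) (Sp D x y) (g x y)" if xy: "x \<in> Obj A" "y \<in> Obj A" for x y
    unfolding g_def by (rule linear_map_the_inv[OF bimodule.Sp_module[OF mon_bim[OF D] xy] lin[OF xy] bij[OF xy]])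
  have gf: "g x y (f x y m) = m" if "x \<in> Obj A" "y \<in> Obj A" "m \<in> cs D x y" for x y m
    using bij[OF that(1,2)] that(3) by (simp add: g_def bij_betw_def)
  have fg: "f x y (g x y n) = n" if "x \<in> Obj A" "y \<in> Obj A" "n \<in> cs E x y" for x y n
    using bij[OF that(1,2)] that(3) by (simp add: g_def bij_betw_def f_inv_into_f)
  have "bimod_mon_hom R A E D g"
  proof (rule bimod_mon_homI[OF E D gl])
    show "g x x (Eta E x x a) = Eta D x x a" if "x \<in> Obj A" "a \<in> end_set A x" for x a
      using gf[of x x "Eta D x x a"] bimod_mon_homD(2)[OF D E f, of x x a] that by (simp add: Eta_closed[OF D])
    fix x y z p q assume o: "x \<in> Obj A" "y \<in> Obj A" "z \<in> Obj A" and p: "p \<in> cs E y z" and q: "q \<in> cs E x y"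
    note c = linear_map_closed[OF gl[OF o(2,3)] p] linear_map_closed[OF gl[OF o(1,2)] q]
    have "f x z (mul D x y z (g y z p) (g x y q)) = mul E x y z p q"
      using bimod_mon_homD(4)[OF D E f o c] fg o p q by simp
    then show "g x z (mul E x y z p q) = mul D x y z (g y z p) (g x y q)"
      using gf[OF o(1,3) mul_closed[OF D o c]] by simp
  qed
  then show ?thesis using f gf fg unfolding bimod_mon_iso_def by blast
qed

lemma bimod_mon_hom_compose:
  assumes D: "mon D" and E: "mon E" and F: "mon F"
    and f: "bimod_mon_hom R A D E f" and g: "bimod_mon_hom R A E F g"
  shows "bimod_mon_hom R A D F (\<lambda>x y m. g x y (f x y m))"
proof (rule bimod_mon_homI[OF D F])
  note f' = bimod_mon_homD[OF D E f] and g' = bimod_mon_homD[OF E F g]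
  show "linear_map R (Sp D x y) (Sp F x y) (\<lambda>m. g x y (f x y m))" if "x \<in> Obj A" "y \<in> Obj A" for x y
    using linear_map_compose[OF f'(1) g'(1)] that by blast
  show "g x x (f x x (Eta D x x a)) = Eta F x x a" if "x \<in> Obj A" "a \<in> end_set A x" for x a
    using that by (simp add: f'(2) g'(2))
  show "g x z (f x z (mul D x y z p q)) = mul F x y z (g y z (f y z p)) (g x y (f x y q))"
    if "x \<in> Obj A" "y \<in> Obj A" "z \<in> Obj A" "p \<in> cs D y z" "q \<in> cs D x y" for x y z p q
    using that by (simp add: f'(4) g'(4) linear_map_closed[OF f'(1)])
qed

lemma bimod_mon_iso_trans:
  assumes D: "mon D" and E: "mon E" and F: "mon F"
    and f: "bimod_mon_iso R A D E f" and g: "bimod_mon_iso R A E F g"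
  shows "bimod_mon_iso R A D F (\<lambda>x y m. g x y (f x y m))"
proof -
  obtain f' where f': "bimod_mon_hom R A E D f'"
    "\<forall>x\<in>Obj A. \<forall>y\<in>Obj A. (\<forall>m\<in>cs D x y. f' x y (f x y m) = m) \<and> (\<forall>n\<in>cs E x y. f x y (f' x y n) = n)"
    using f unfolding bimod_mon_iso_def by auto
  obtain g' where g': "bimod_mon_hom R A F E g'"
    "\<forall>x\<in>Obj A. \<forall>y\<in>Obj A. (\<forall>m\<in>cs E x y. g' x y (g x y m) = m) \<and> (\<forall>n\<in>cs F x y. g x y (g' x y n) = n)"
    using g unfolding bimod_mon_iso_def by auto
  have fh: "bimod_mon_hom R A D E f" "bimod_mon_hom R A E F g" using f g by (auto simp: bimod_mon_iso_def)
  note c = linear_map_closed[OF bimod_mon_homD(1)[OF D E fh(1)]] linear_map_closed[OF bimod_mon_homD(1)[OF F E g'(1)]]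
  show ?thesis unfolding bimod_mon_iso_def
    using bimod_mon_hom_compose[OF D E F fh] bimod_mon_hom_compose[OF F E D g'(1) f'(1)] f'(2) g'(2) c
    by (intro conjI exI[of _ "\<lambda>x y m. f' x y (g' x y m)"]) auto
qed

end

section \<open>Linear categories over \<open>A\<close> and their subcategories\<close>

text \<open>Weaker than \<open>stratified\<close>: the results on subcategories must apply to the
  twisted tensor product while its stratification is still being proved.\<close>

locale over_category = base_category R A leq + C: linear_category R C
  for R :: "('k, 'r) ring_scheme" (structure) and A :: "('o, 'k, 'a, 'z) lincat_scheme"
    and leq :: "'o \<Rightarrow> 'o \<Rightarrow> bool" and C :: "('o, 'k, 'a, 'm, 's) strat_scheme" +
  assumes Obj_C: "Obj C = Obj A" and Incl_functor: "linear_functor R A C (Incl C)"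
begin

abbreviation PM :: "('o \<Rightarrow> 'o \<Rightarrow> 'm set) \<Rightarrow> ('o, 'k, 'a, 'm) bimod_mon" where "PM \<equiv> part_monoid R A C"

text \<open>A subcategory on which \<open>A\<close> acts by composition. The condition on
  \<open>Incl\<close> is placed on the diagonal, as the other values are zero.\<close>

definition part :: "('o \<Rightarrow> 'o \<Rightarrow> 'm set) \<Rightarrow> bool" where
  "part S \<longleftrightarrow> wide_linear_subcategory R C S \<and> (\<forall>x\<in>Obj A. \<forall>a\<in>end_set A x. Incl C x x a \<in> S x x)"

lemma Sp_PM [simp]: "Sp (PM S) x y = (Hom C x y)\<lparr>carrier := S x y\<rparr>"
  and lact_PM [simp]: "lact (PM S) x y a m = Comp C x y y (Incl C y y a) m"
  and ract_PM [simp]: "ract (PM S) x y m b = Comp C x x y m (Incl C x x b)"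
  and Eta_PM [simp]: "Eta (PM S) = Incl C"
  and Mu_PM: "Mu (PM S) = comp_map R A C S S"
  by (auto simp: part_monoid_def part_bimod_def)

text \<open>A tensor product depends only on the bimodule fields, so \<open>stratified\<close>,
  phrased with \<open>part_bimod\<close>, can be read with \<open>part_monoid\<close>.\<close>

lemma tens_sp_part: "tsp (part_bimod C S) (part_bimod C S') = tsp (PM S) (PM S')"
  by (intro ext) (simp add: tens_sp_def tens_at_def[abs_def] part_monoid_def)

lemma comp_map_eq:
  "comp_map R A C S S' x y = tlift (PM S) (PM S') x y (Hom C x y) (\<lambda>z g f. Comp C x z y g f)"
  by (intro ext) (simp add: comp_map_def tens_lift_def tens_at_def[abs_def] part_monoid_def)

lemma HomC: "\<lbrakk>x \<in> Obj A; y \<in> Obj A\<rbrakk> \<Longrightarrow> module R (Hom C x y)"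
  by (rule C.Hom_module) (simp_all add: Obj_C)

lemma C_closed: "\<lbrakk>x \<in> Obj A; y \<in> Obj A; z \<in> Obj A; g \<in> carrier (Hom C y z); f \<in> carrier (Hom C x y)\<rbrakk> \<Longrightarrow>
    Comp C x y z g f \<in> carrier (Hom C x z)"
  by (rule C.Comp_closed) (simp_all add: Obj_C)

lemma C_assoc:
  "\<lbrakk>w \<in> Obj A; x \<in> Obj A; y \<in> Obj A; z \<in> Obj A; h \<in> carrier (Hom C y z); g \<in> carrier (Hom C x y); f \<in> carrier (Hom C w x)\<rbrakk> \<Longrightarrow>
     Comp C w x z (Comp C x y z h g) f = Comp C w y z h (Comp C w x y g f)"
  by (rule C.Comp_assoc) (simp_all add: Obj_C)

lemma C_left: "\<lbrakk>x \<in> Obj A; y \<in> Obj A; z \<in> Obj A; f \<in> carrier (Hom C x y)\<rbrakk> \<Longrightarrow>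
    linear_map R (Hom C y z) (Hom C x z) (\<lambda>g. Comp C x y z g f)"
  by (rule C.Comp_linear_left) (simp_all add: Obj_C)

lemma C_right: "\<lbrakk>x \<in> Obj A; y \<in> Obj A; z \<in> Obj A; g \<in> carrier (Hom C y z)\<rbrakk> \<Longrightarrow>
    linear_map R (Hom C x y) (Hom C x z) (Comp C x y z g)"
  using C.Comp_linear_right[of x y z g] by (simp add: Obj_C)

lemma C_Id_left: "\<lbrakk>x \<in> Obj A; y \<in> Obj A; f \<in> carrier (Hom C x y)\<rbrakk> \<Longrightarrow>
    Comp C x y y (Id C y) f = f"
  by (rule C.Comp_Id_left) (simp_all add: Obj_C)

lemma C_Id_right: "\<lbrakk>x \<in> Obj A; y \<in> Obj A; f \<in> carrier (Hom C x y)\<rbrakk> \<Longrightarrow>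
    Comp C x x y f (Id C x) = f"
  by (rule C.Comp_Id_right) (simp_all add: Obj_C)

lemma Incl_linear: "\<lbrakk>x \<in> Obj A; y \<in> Obj A\<rbrakk> \<Longrightarrow>
    linear_map R (Hom A x y) (Hom C x y) (Incl C x y)"
  and Incl_Id: "x \<in> Obj A \<Longrightarrow> Incl C x x (Id A x) = Id C x"
  and Incl_Comp: "\<lbrakk>x \<in> Obj A; y \<in> Obj A; z \<in> Obj A; g \<in> carrier (Hom A y z); f \<in> carrier (Hom A x y)\<rbrakk> \<Longrightarrow>
     Incl C x z (Comp A x y z g f) = Comp C x y z (Incl C y z g) (Incl C x y f)"
  using Incl_functor by (auto simp: linear_functor_def)

lemma Incl_closed: "\<lbrakk>x \<in> Obj A; y \<in> Obj A; a \<in> carrier (Hom A x y)\<rbrakk> \<Longrightarrow>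
    Incl C x y a \<in> carrier (Hom C x y)"
  by (rule linear_map_closed[OF Incl_linear])

text \<open>Restricting the carrier leaves the operations of \<open>Hom C x y\<close> unchanged, so
  only the range remains to be checked.\<close>

lemma linear_PM_iff:
  "linear_map R M ((Hom C x y)\<lparr>carrier := T\<rparr>) f \<longleftrightarrow> linear_map R M (Hom C x y) f \<and> f ` carrier M \<subseteq> T"
  if "T \<subseteq> carrier (Hom C x y)"
  using that by (auto simp: linear_map_def)

lemma linear_from_PM:
  "\<lbrakk>linear_map R (Hom C x y) M f; T \<subseteq> carrier (Hom C x y)\<rbrakk> \<Longrightarrow>
     linear_map R ((Hom C x y)\<lparr>carrier := T\<rparr>) M f"
  unfolding linear_map_def by (simp add: subset_eq Pi_iff)

lemma partD:
  assumes "part S"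
  shows "\<lbrakk>x \<in> Obj A; y \<in> Obj A\<rbrakk> \<Longrightarrow> submodule (S x y) R (Hom C x y)"
    and "\<lbrakk>x \<in> Obj A; y \<in> Obj A\<rbrakk> \<Longrightarrow> S x y \<subseteq> carrier (Hom C x y)"
    and "\<lbrakk>x \<in> Obj A; y \<in> Obj A; f \<in> S x y\<rbrakk> \<Longrightarrow> f \<in> carrier (Hom C x y)"
    and "x \<in> Obj A \<Longrightarrow> Id C x \<in> S x x"
    and "\<lbrakk>x \<in> Obj A; y \<in> Obj A; z \<in> Obj A; g \<in> S y z; f \<in> S x y\<rbrakk> \<Longrightarrow>
       Comp C x y z g f \<in> S x z"
    and "\<lbrakk>x \<in> Obj A; a \<in> end_set A x\<rbrakk> \<Longrightarrow> Incl C x x a \<in> S x x"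
proof -
  note w = assms[unfolded part_def wide_linear_subcategory_def Obj_C]
  show s: "\<lbrakk>x \<in> Obj A; y \<in> Obj A\<rbrakk> \<Longrightarrow>
     submodule (S x y) R (Hom C x y)" for x y using w by blast
  then show sub: "\<lbrakk>x \<in> Obj A; y \<in> Obj A\<rbrakk> \<Longrightarrow>
     S x y \<subseteq> carrier (Hom C x y)" for x y
    using module.submoduleE(1)[OF HomC] by blast
  then show "\<lbrakk>x \<in> Obj A; y \<in> Obj A; f \<in> S x y\<rbrakk> \<Longrightarrow>
     f \<in> carrier (Hom C x y)" by blast
qed (use assms[unfolded part_def wide_linear_subcategory_def Obj_C] in blast)+

text \<open>\<open>A\<close> acts by composition with images under \<open>Incl\<close>, so the
  bimodule axioms come from bilinearity, associativity and the unit laws in \<open>C\<close>, and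
  from functoriality of \<open>Incl\<close>.\<close>

lemma PM_bim [simp]:
  assumes S: "part S"
  shows "bim (PM S)"
proof (rule bimodule.intro, unfold Sp_PM lact_PM ract_PM)
  note p = partD[OF S]
  fix x y assume xy: "x \<in> Obj A" "y \<in> Obj A"
  note I = Incl_closed[OF xy(1,1)] Incl_closed[OF xy(2,2)]
  show "module R ((Hom C x y)\<lparr>carrier := S x y\<rparr>)"
    by (rule submodule.submodule_is_module[OF p(1)[OF xy] HomC[OF xy]])
  fix a assume a: "a \<in> end_set A y"
  show "linear_map R ((Hom C x y)\<lparr>carrier := S x y\<rparr>) ((Hom C x y)\<lparr>carrier := S x y\<rparr>) (Comp C x y y (Incl C y y a))"
    by (subst linear_PM_iff[OF p(2)[OF xy]])
      (use linear_from_PM[OF C_right[OF xy xy(2) I(2)[OF a]] p(2)[OF xy]] p(5)[OF xy xy(2) p(6)[OF xy(2) a]] in auto)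
next
  note p = partD[OF S]
  fix x y assume xy: "x \<in> Obj A" "y \<in> Obj A"
  note I = Incl_closed[OF xy(1,1)] Incl_closed[OF xy(2,2)]
  fix b assume b: "b \<in> end_set A x"
  show "linear_map R ((Hom C x y)\<lparr>carrier := S x y\<rparr>) ((Hom C x y)\<lparr>carrier := S x y\<rparr>) (\<lambda>m. Comp C x x y m (Incl C x x b))"
    by (subst linear_PM_iff[OF p(2)[OF xy]])
      (use linear_from_PM[OF C_left[OF xy(1) xy I(1)[OF b]] p(2)[OF xy]] p(5)[OF xy(1) xy _ p(6)[OF xy(1) b]] in auto)
next
  note p = partD[OF S]
  fix x y m assume xy: "x \<in> Obj A" "y \<in> Obj A" and "m \<in> carrier ((Hom C x y)\<lparr>carrier := S x y\<rparr>)"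
  then have m: "m \<in> S x y" "m \<in> carrier (Hom C x y)" using p(3) by auto
  note I = Incl_closed[OF xy(1,1)] Incl_closed[OF xy(2,2)]
  show "linear_map R (Hom A y y) ((Hom C x y)\<lparr>carrier := S x y\<rparr>) (\<lambda>a. Comp C x y y (Incl C y y a) m)"
    by (subst linear_PM_iff[OF p(2)[OF xy]])
      (use linear_map_compose[OF Incl_linear[OF xy(2,2)] C_left[OF xy xy(2) m(2)]] p(5)[OF xy xy(2) p(6)[OF xy(2)] m(1)] in auto)
  show "linear_map R (Hom A x x) ((Hom C x y)\<lparr>carrier := S x y\<rparr>) (\<lambda>b. Comp C x x y m (Incl C x x b))"
    by (subst linear_PM_iff[OF p(2)[OF xy]])
      (use linear_map_compose[OF Incl_linear[OF xy(1,1)] C_right[OF xy(1) xy m(2)]] p(5)[OF xy(1) xy m(1) p(6)[OF xy(1)]] in auto)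
  show "Comp C x y y (Incl C y y (Id A y)) m = m" "Comp C x x y m (Incl C x x (Id A x)) = m"
    using xy m by (simp_all add: Incl_Id C_Id_left C_Id_right)
  show "Comp C x y y (Incl C y y (Comp A y y y a a')) m = Comp C x y y (Incl C y y a) (Comp C x y y (Incl C y y a') m)"
    if "a \<in> end_set A y" "a' \<in> end_set A y" for a a'
    using xy m that I by (simp add: Incl_Comp C_assoc)
  show "Comp C x x y m (Incl C x x (Comp A x x x b b')) = Comp C x x y (Comp C x x y m (Incl C x x b)) (Incl C x x b')"
    if "b \<in> end_set A x" "b' \<in> end_set A x" for b b'
    using xy m that I by (simp add: Incl_Comp C_assoc)
  show "Comp C x x y (Comp C x y y (Incl C y y a) m) (Incl C x x b) = Comp C x y y (Incl C y y a) (Comp C x x y m (Incl C x x b))"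
    if "a \<in> end_set A y" "b \<in> end_set A x" for a b
    using xy m that I by (simp add: C_assoc)
qed

context
  fixes S S' assumes S: "part S" and S': "part S'"
begin

text \<open>Balancing over \<open>A\<close> is associativity in \<open>C\<close>, since an element
  of \<open>A\<close> acts on either factor by composition with its image.\<close>

lemma comp_balanced:
  assumes xy: "x \<in> Obj A" "y \<in> Obj A"
  shows "balanced R A (PM S) (PM S') x y (Hom C x y) (\<lambda>z g f. Comp C x z y g f)"
  by (rule balancedI)
    (use xy partD[OF S] partD[OF S'] linear_from_PM[OF C_right] linear_from_PM[OF C_left] in \<open>auto simp: C_assoc Incl_closed\<close>)

lemma comp_map_linear:
  "\<lbrakk>x \<in> Obj A; y \<in> Obj A\<rbrakk> \<Longrightarrow>
     linear_map R (tsp (PM S) (PM S') x y) (Hom C x y) (comp_map R A C S S' x y)"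
  unfolding comp_map_eq
  by (rule tens_lift_linear) (use S S' comp_balanced HomC in auto)

lemma comp_map_pure:
  "\<lbrakk>x \<in> Obj A; y \<in> Obj A; z \<in> Obj A; g \<in> S z y; f \<in> S' x z\<rbrakk> \<Longrightarrow>
     comp_map R A C S S' x y (pure (PM S) (PM S') x y z g f) = Comp C x z y g f"
  unfolding comp_map_eq
  by (subst tens_lift_pure) (use S S' comp_balanced HomC in auto)

lemma comp_map_lact:
  assumes xy: "x \<in> Obj A" "y \<in> Obj A" and a: "a \<in> end_set A y" and t: "t \<in> carrier (tsp (PM S) (PM S') x y)"
  shows "comp_map R A C S S' x y (lact (ten (PM S) (PM S')) x y a t) =
    Comp C x y y (Incl C y y a) (comp_map R A C S S' x y t)"
proof -
  note I = Incl_closed[OF xy(2,2) a]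
  note l = bimodule.lact_linear[OF tensor_bimodule[OF PM_bim[OF S] PM_bim[OF S']] xy a, unfolded Sp_tensor]
  show ?thesis
    by (rule tens_agree[OF PM_bim[OF S] PM_bim[OF S'] xy HomC[OF xy] linear_map_compose[OF l comp_map_linear[OF xy]]
          linear_map_compose[OF comp_map_linear[OF xy] C_right[OF xy xy(2) I]] _ t])
      (use S S' xy a I partD[OF S] partD[OF S'] in \<open>simp add: lact_pure comp_map_pure C_assoc\<close>)
qed

lemma comp_map_ract:
  assumes xy: "x \<in> Obj A" "y \<in> Obj A" and b: "b \<in> end_set A x" and t: "t \<in> carrier (tsp (PM S) (PM S') x y)"
  shows "comp_map R A C S S' x y (ract (ten (PM S) (PM S')) x y t b) =
    Comp C x x y (comp_map R A C S S' x y t) (Incl C x x b)"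
proof -
  note I = Incl_closed[OF xy(1,1) b]
  note l = bimodule.ract_linear[OF tensor_bimodule[OF PM_bim[OF S] PM_bim[OF S']] xy b, unfolded Sp_tensor]
  show ?thesis
    by (rule tens_agree[OF PM_bim[OF S] PM_bim[OF S'] xy HomC[OF xy] linear_map_compose[OF l comp_map_linear[OF xy]]
          linear_map_compose[OF comp_map_linear[OF xy] C_left[OF xy(1) xy I]] _ t])
      (use S S' xy b I partD[OF S] partD[OF S'] in \<open>simp add: ract_pure comp_map_pure C_assoc\<close>)
qed

end

text \<open>\<open>comp_map\<close> is a lift into all of \<open>Hom C x y\<close>. Lifting the same
  composition into the submodule \<open>S x y\<close> gives a linear map with equal values at pure
  tensors, hence the same map.\<close>

lemma comp_map_part:
  assumes S: "part S" and xy: "x \<in> Obj A" "y \<in> Obj A" and t: "t \<in> carrier (tsp (PM S) (PM S) x y)"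
  shows "comp_map R A C S S x y t \<in> S x y"
proof -
  have b: "balanced R A (PM S) (PM S) x y (Sp (PM S) x y) (\<lambda>z g f. Comp C x z y g f)"
    by (rule balancedI)
      (use xy partD[OF S] linear_from_PM[OF C_right] linear_from_PM[OF C_left]
        in \<open>auto simp: C_assoc Incl_closed linear_PM_iff\<close>)
  have m: "module R (Sp (PM S) x y)" by (rule bimodule.Sp_module[OF PM_bim[OF S] xy])
  note tl = tens_lift_linear[OF PM_bim[OF S] PM_bim[OF S] xy m b]
  have tl': "linear_map R (tsp (PM S) (PM S) x y) (Hom C x y) (tlift (PM S) (PM S) x y (Sp (PM S) x y) (\<lambda>z g f. Comp C x z y g f))"
    using tl by (simp add: linear_PM_iff[OF partD(2)[OF S xy]])
  have "comp_map R A C S S x y t = tlift (PM S) (PM S) x y (Sp (PM S) x y) (\<lambda>z g f. Comp C x z y g f) t"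
    by (rule tens_agree[OF PM_bim[OF S] PM_bim[OF S] xy HomC[OF xy] comp_map_linear[OF S S xy] tl' _ t])
      (use S xy in \<open>simp add: comp_map_pure tens_lift_pure[OF _ _ _ _ m b] del: Sp_PM, simp add: comp_map_pure\<close>)
  then show ?thesis using linear_map_closed[OF tl t] by simp
qed

text \<open>At pure tensors the monoid axioms are the associativity and unit laws of
  \<open>C\<close>; for the unit axioms, \<open>unit_left_agree\<close> and
  \<open>unit_right_agree\<close> leave only tensors with an identity.\<close>

lemma PM_mon [simp]:
  assumes S: "part S"
  shows "mon (PM S)"
proof -
  note B = PM_bim[OF S] and p = partD[OF S]
  have Mu: "bimod_hom R A (ten (PM S) (PM S)) (PM S) (Mu (PM S))"
    unfolding bimod_hom_def Mu_PM
    using comp_map_lact[OF S S] comp_map_ract[OF S S] comp_map_linear[OF S S] comp_map_part[OF S]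
    by (auto simp: linear_PM_iff[OF p(2)])
  have Eta: "bimod_hom R A (unit_bimod A) (PM S) (Eta (PM S))"
    unfolding bimod_hom_def
  proof (intro ballI conjI)
    fix x y assume xy: "x \<in> Obj A" "y \<in> Obj A"
    \<comment> \<open>Off the diagonal the value is zero, which every submodule contains.\<close>
    have "Incl C x y a \<in> S x y" if a: "a \<in> carrier (Hom A x y)" for a
    proof (cases "x = y")
      case False
      have "Incl C x y a = \<zero>\<^bsub>Hom C x y\<^esub>" by (rule Hom_offdiag_linear[OF xy False HomC[OF xy] Incl_linear[OF xy] a])
      then show ?thesis using subgroup.one_closed[OF submodule.axioms(1)[OF p(1)[OF xy]]] by simp
    qed (use p(6) xy a in auto)
    then show "linear_map R (Sp (unit_bimod A) x y) (Sp (PM S) x y) (Eta (PM S) x y)"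
      using Incl_linear[OF xy] by (auto simp: linear_PM_iff[OF p(2)[OF xy]])
    show "Eta (PM S) x y (lact (unit_bimod A) x y a m) = lact (PM S) x y a (Eta (PM S) x y m)"
      if "m \<in> cs (unit_bimod A) x y" "a \<in> end_set A y" for m a
      using that xy by (simp add: Incl_Comp)
    show "Eta (PM S) x y (ract (unit_bimod A) x y m b) = ract (PM S) x y (Eta (PM S) x y m) b"
      if "m \<in> cs (unit_bimod A) x y" "b \<in> end_set A x" for m b
      using that xy by (simp add: Incl_Comp)
  qed
  note BB = tensor_bimodule[OF B B]
  note mm = bimod_hom_linear[OF Mu, unfolded Sp_tensor]
  show ?thesis
  proof (rule bimod_monoid.intro[OF B], rule bimod_monoid_axioms.intro[OF Mu Eta])
    fix x y assume xy: "x \<in> Obj A" "y \<in> Obj A"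
    have mS: "module R (Sp (PM S) x y)" by (rule bimodule.Sp_module[OF B xy])
    show "Mu (PM S) x y (tmap (ten (PM S) (PM S)) (PM S) (PM S) (PM S) (Mu (PM S)) idm x y t) =
      Mu (PM S) x y (tmap (PM S) (ten (PM S) (PM S)) (PM S) (PM S) idm (Mu (PM S)) x y (assoc R A (PM S) (PM S) (PM S) x y t))"
      if t: "t \<in> carrier (Sp (ten (ten (PM S) (PM S)) (PM S)) x y)" for t
    proof (rule tens3_agree_left[OF B B B xy mS _ _ _ t[unfolded Sp_tensor]])
      show "linear_map R (tsp (ten (PM S) (PM S)) (PM S) x y) (Sp (PM S) x y)
        (\<lambda>t. Mu (PM S) x y (tmap (ten (PM S) (PM S)) (PM S) (PM S) (PM S) (Mu (PM S)) idm x y t))"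
        by (rule linear_map_compose[OF bimod_hom_linear[OF tens_map_hom[OF BB B B B Mu bimod_hom_id] xy, unfolded Sp_tensor] mm[OF xy]])
      show "linear_map R (tsp (ten (PM S) (PM S)) (PM S) x y) (Sp (PM S) x y)
        (\<lambda>t. Mu (PM S) x y (tmap (PM S) (ten (PM S) (PM S)) (PM S) (PM S) idm (Mu (PM S)) x y (assoc R A (PM S) (PM S) (PM S) x y t)))"
        by (rule linear_map_compose[OF bimod_hom_linear[OF bimod_hom_compose[OF assoc_hom[OF B B B]
                tens_map_hom[OF B BB B B bimod_hom_id Mu]] xy, unfolded Sp_tensor] mm[OF xy]])
    qed (use xy B BB p in \<open>simp add: tens_map_pure[OF _ _ _ _ Mu bimod_hom_id] assoc_pure
          tens_map_pure[OF _ _ _ _ bimod_hom_id Mu], simp add: Mu_PM comp_map_pure[OF S S] C_assoc\<close>)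
    note U = unit_bimodule
    have Id: "Id A x \<in> end_set A x" "Id A y \<in> end_set A y" using xy by (auto intro: Id_closed)
    show "Mu (PM S) x y (tmap (unit_bimod A) (PM S) (PM S) (PM S) (Eta (PM S)) idm x y u) = lunit R A (PM S) x y u"
      if u: "u \<in> carrier (Sp (ten (unit_bimod A) (PM S)) x y)" for u
      by (rule unit_left_agree[OF B xy mS linear_map_compose[OF bimod_hom_linear[OF tens_map_hom[OF U B B B Eta bimod_hom_id] xy, unfolded Sp_tensor] mm[OF xy]]
            lunit_linear[OF B xy] _ u[unfolded Sp_tensor]])
        (use xy B U Id p in \<open>simp add: tens_map_pure[OF _ _ _ _ Eta bimod_hom_id] lunit_pure del: Eta_PM, simp add: Mu_PM comp_map_pure[OF S S]\<close>)
    show "Mu (PM S) x y (tmap (PM S) (unit_bimod A) (PM S) (PM S) idm (Eta (PM S)) x y u) = runit R A (PM S) x y u"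
      if u: "u \<in> carrier (Sp (ten (PM S) (unit_bimod A)) x y)" for u
      by (rule unit_right_agree[OF B xy mS linear_map_compose[OF bimod_hom_linear[OF tens_map_hom[OF B U B B bimod_hom_id Eta] xy, unfolded Sp_tensor] mm[OF xy]]
            runit_linear[OF B xy] _ u[unfolded Sp_tensor]])
        (use xy B U Id p in \<open>simp add: tens_map_pure[OF _ _ _ _ bimod_hom_id Eta] runit_pure del: Eta_PM, simp add: Mu_PM comp_map_pure[OF S S]\<close>)
  qed
qed

lemma mul_PM:
  "\<lbrakk>part S; x \<in> Obj A; y \<in> Obj A; z \<in> Obj A; g \<in> S y z; f \<in> S x y\<rbrakk> \<Longrightarrow>
     mul (PM S) x y z g f = Comp C x y z g f"
  by (simp add: mul_def Mu_PM comp_map_pure)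

lemma un_PM: "x \<in> Obj A \<Longrightarrow> un (PM S) x = Id C x"
  by (simp add: un_def Incl_Id)

end

section \<open>Twists, elementwise\<close>

locale monoid_pair = base_category R A leq
  for R :: "('k, 'r) ring_scheme" (structure) and A :: "('o, 'k, 'a, 'z) lincat_scheme"
    and leq :: "'o \<Rightarrow> 'o \<Rightarrow> bool" +
  fixes P :: "('o, 'k, 'a, 'p, 's) bimod_mon_scheme" and N :: "('o, 'k, 'a, 'n, 't) bimod_mon_scheme"
  assumes P: "bimod_monoid R A P" and N: "bimod_monoid R A N"
begin

abbreviation "PP \<equiv> ten P P"
abbreviation "NN \<equiv> ten N N"
abbreviation "PN \<equiv> ten P N"
abbreviation "NP \<equiv> ten N P"
abbreviation "SPN \<equiv> tsp P N"
abbreviation "pPN \<equiv> pure P N"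

lemma bP [simp]: "bim P" and bN [simp]: "bim N" using P N by simp_all

lemmas mP = bimodule.Sp_module[OF bP] and mN = bimodule.Sp_module[OF bN] and mPN = tens_module[OF bP bN]

text \<open>Multiplication of \<open>P \<otimes> N\<close> from the left by \<open>P\<close> and from the right by \<open>N\<close>.\<close>

definition lmul where
  "lmul x y u = tmap PP N P N (Mu P) idm x y (assoc_inv R A P P N x y u)"

definition rmul where
  "rmul x y u = tmap P NN P N idm (Mu N) x y (assoc R A P N N x y u)"

text \<open>\<open>lmul\<close> and \<open>rmul\<close> are maps of tensors, kept in the exact shape
  in which they occur inside \<open>twist\<close>; \<open>left_P\<close> and \<open>right_N\<close>
  are their values on an element and a tensor.\<close>

definition left_P where "left_P x y z p s = lmul x z (pure P PN x z y p s)"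
definition right_N where "right_N x y z s n = rmul x z (pure PN N x z y s n)"

lemma lmul_hom: "bimod_hom R A (ten P PN) PN lmul"
  unfolding lmul_def
  by (rule bimod_hom_compose[OF assoc_inv_hom tens_map_hom[OF _ _ _ _ Mu_hom'[OF P] bimod_hom_id]]) simp_all

lemma rmul_hom: "bimod_hom R A (ten PN N) PN rmul"
  unfolding rmul_def
  by (rule bimod_hom_compose[OF assoc_hom tens_map_hom[OF _ _ _ _ bimod_hom_id Mu_hom'[OF N]]]) simp_all

lemma left_P_linear_right:
  "\<lbrakk>x \<in> Obj A; y \<in> Obj A; z \<in> Obj A; p \<in> cs P y z\<rbrakk> \<Longrightarrow>
     linear_map R (SPN x y) (SPN x z) (left_P x y z p)"
  unfolding left_P_def
  using linear_map_compose[OF pure_linear_right[of P PN, unfolded Sp_tensor] bimod_hom_linear[OF lmul_hom, unfolded Sp_tensor]]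
  by simp

lemma right_N_linear_left:
  "\<lbrakk>x \<in> Obj A; y \<in> Obj A; z \<in> Obj A; n \<in> cs N x y\<rbrakk> \<Longrightarrow>
     linear_map R (SPN y z) (SPN x z) (\<lambda>s. right_N x y z s n)"
  unfolding right_N_def
  using linear_map_compose[OF pure_linear_left[of PN N, unfolded Sp_tensor] bimod_hom_linear[OF rmul_hom, unfolded Sp_tensor]]
  by simp

lemma left_P_pure:
  "\<lbrakk>x \<in> Obj A; w \<in> Obj A; y \<in> Obj A; z \<in> Obj A; p \<in> cs P y z; p' \<in> cs P w y; n \<in> cs N x w\<rbrakk> \<Longrightarrow>
     left_P x y z p (pPN x y w p' n) = pPN x z w (mul P w y z p p') n"
  by (simp add: left_P_def lmul_def assoc_inv_pure tens_map_pure[OF _ _ _ _ Mu_hom'[OF P] bimod_hom_id] mul_def)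

lemma right_N_pure:
  "\<lbrakk>x \<in> Obj A; w \<in> Obj A; y \<in> Obj A; z \<in> Obj A; p \<in> cs P w z; n' \<in> cs N y w; n \<in> cs N x y\<rbrakk> \<Longrightarrow>
     right_N x y z (pPN y z w p n') n = pPN x z w p (mul N x y w n' n)"
  by (simp add: right_N_def rmul_def assoc_pure tens_map_pure[OF _ _ _ _ bimod_hom_id Mu_hom'[OF N]] mul_def)

end

text \<open>A morphism \<tau> without the twist axioms: the setting serves both a given twist and
  the map \<open>tw\<close> of a stratified category, whose twist axioms are proved in it.\<close>

locale exchange = monoid_pair R A leq P N
  for R :: "('k, 'r) ring_scheme" (structure) and A :: "('o, 'k, 'a, 'z) lincat_scheme"
    and leq :: "'o \<Rightarrow> 'o \<Rightarrow> bool" and P :: "('o, 'k, 'a, 'p, 's) bimod_mon_scheme"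
    and N :: "('o, 'k, 'a, 'n, 't) bimod_mon_scheme" +
  fixes \<tau> :: "'o \<Rightarrow> 'o \<Rightarrow> ('o, 'k, 'n, 'p) tens \<Rightarrow> ('o, 'k, 'p, 'n) tens"
  assumes \<tau>_hom: "bimod_hom R A (ten N P) (ten P N) \<tau>"
begin

text \<open>The exchange of a factor from \<open>N\<close> with one from \<open>P\<close>, and the resulting left multiplication
  by \<open>N\<close> and right multiplication by \<open>P\<close> on \<open>P \<otimes> N\<close>.\<close>

definition exch where "exch x y z n p = \<tau> x z (pure N P x z y n p)"
definition left_N where
  "left_N x y z n s = rmul x z (tmap NP N PN N \<tau> idm x z (assoc_inv R A N P N x z (pure N PN x z y n s)))"
definition right_P where
  "right_P x y z s p = lmul x z (tmap P NP P PN idm \<tau> x z (assoc R A P N P x z (pure PN P x z y s p)))"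

lemma left_N_hom: "bimod_hom R A (ten N PN) PN
  (\<lambda>x z u. rmul x z (tmap NP N PN N \<tau> idm x z (assoc_inv R A N P N x z u)))"
  by (rule bimod_hom_compose[OF bimod_hom_compose[OF assoc_inv_hom tens_map_hom[OF _ _ _ _ \<tau>_hom bimod_hom_id]] rmul_hom]) simp_all

lemma right_P_hom: "bimod_hom R A (ten PN P) PN
  (\<lambda>x z u. lmul x z (tmap P NP P PN idm \<tau> x z (assoc R A P N P x z u)))"
  by (rule bimod_hom_compose[OF bimod_hom_compose[OF assoc_hom tens_map_hom[OF _ _ _ _ bimod_hom_id \<tau>_hom]] lmul_hom]) simp_all

lemma exch_closed:
  "\<lbrakk>x \<in> Obj A; y \<in> Obj A; z \<in> Obj A; n \<in> cs N y z; p \<in> cs P x y\<rbrakk> \<Longrightarrow>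
     exch x y z n p \<in> carrier (SPN x z)"
  unfolding exch_def by (rule bimod_hom_closed[OF \<tau>_hom, unfolded Sp_tensor]) simp_all

lemma left_N_linear_right:
  "\<lbrakk>x \<in> Obj A; y \<in> Obj A; z \<in> Obj A; n \<in> cs N y z\<rbrakk> \<Longrightarrow>
     linear_map R (SPN x y) (SPN x z) (left_N x y z n)"
  unfolding left_N_def
  using linear_map_compose[OF pure_linear_right[of N PN, unfolded Sp_tensor] bimod_hom_linear[OF left_N_hom, unfolded Sp_tensor]]
  by simp

lemma right_P_linear_left:
  "\<lbrakk>x \<in> Obj A; y \<in> Obj A; z \<in> Obj A; p \<in> cs P x y\<rbrakk> \<Longrightarrow>
     linear_map R (SPN y z) (SPN x z) (\<lambda>s. right_P x y z s p)"
  unfolding right_P_def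
  using linear_map_compose[OF pure_linear_left[of PN P, unfolded Sp_tensor] bimod_hom_linear[OF right_P_hom, unfolded Sp_tensor]]
  by simp

lemmas left_N_closed = linear_map_closed[OF left_N_linear_right] and right_P_closed = linear_map_closed[OF right_P_linear_left]

lemma left_N_pure:
  "\<lbrakk>x \<in> Obj A; w \<in> Obj A; y \<in> Obj A; z \<in> Obj A; n \<in> cs N y z; p \<in> cs P w y; n' \<in> cs N x w\<rbrakk> \<Longrightarrow>
     left_N x y z n (pPN x y w p n') = right_N x w z (exch w y z n p) n'"
  by (simp add: left_N_def right_N_def assoc_inv_pure tens_map_pure[OF _ _ _ _ \<tau>_hom bimod_hom_id] exch_def)

lemma right_P_pure:
  "\<lbrakk>x \<in> Obj A; w \<in> Obj A; y \<in> Obj A; z \<in> Obj A; p \<in> cs P w z; n \<in> cs N y w; p' \<in> cs P x y\<rbrakk> \<Longrightarrow>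
     right_P x y z (pPN y z w p n) p' = left_P x w z p (exch x y w n p')"
  by (simp add: right_P_def left_P_def assoc_pure tens_map_pure[OF _ _ _ _ bimod_hom_id \<tau>_hom] exch_def)

text \<open>The twist axioms at pure tensors. The nested composites in \<open>twist\<close> become
  actions on values of \<open>exch\<close>; the product axioms read
  \<open>\<tau>(nn' \<otimes> p) = n\<tau>(n' \<otimes> p)\<close> and
  \<open>\<tau>(n \<otimes> pp') = \<tau>(n \<otimes> p)p'\<close>.\<close>

definition twist_elem where
  "twist_elem \<longleftrightarrow>
    (\<forall>w\<in>Obj A. \<forall>x\<in>Obj A. \<forall>y\<in>Obj A. \<forall>z\<in>Obj A. \<forall>n\<in>cs N y z. \<forall>n'\<in>cs N x y. \<forall>p\<in>cs P w x.
      exch w x z (mul N x y z n n') p = left_N w y z n (exch w x y n' p)) \<and>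
    (\<forall>x\<in>Obj A. \<forall>y\<in>Obj A. \<forall>p\<in>cs P x y. exch x y y (un N y) p = pPN x y x p (un N x)) \<and>
    (\<forall>w\<in>Obj A. \<forall>x\<in>Obj A. \<forall>y\<in>Obj A. \<forall>z\<in>Obj A. \<forall>n\<in>cs N y z. \<forall>p\<in>cs P x y. \<forall>p'\<in>cs P w x.
      exch w y z n (mul P w x y p p') = right_P w x z (exch x y z n p) p') \<and>
    (\<forall>x\<in>Obj A. \<forall>y\<in>Obj A. \<forall>n\<in>cs N x y. exch x x y n (un P x) = pPN x y y (un P y) n)"

lemma tens_map_Mu_N:
  "\<lbrakk>w \<in> Obj A; x \<in> Obj A; y \<in> Obj A; z \<in> Obj A; n \<in> cs N y z; n' \<in> cs N x y; p \<in> cs P w x\<rbrakk> \<Longrightarrow>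
     \<tau> w z (tmap NN P N P (Mu N) idm w z (pure NN P w z x (pure N N x z y n n') p)) = exch w x z (mul N x y z n n') p"
  by (simp add: tens_map_pure[OF _ _ _ _ Mu_hom'[OF N] bimod_hom_id] exch_def mul_def)

lemma tens_map_Mu_P:
  "\<lbrakk>w \<in> Obj A; x \<in> Obj A; y \<in> Obj A; z \<in> Obj A; n \<in> cs N y z; p \<in> cs P x y; p' \<in> cs P w x\<rbrakk> \<Longrightarrow>
     \<tau> w z (tmap N PP N P idm (Mu P) w z (pure N PP w z y n (pure P P w y x p p'))) = exch w y z n (mul P w x y p p')"
  by (simp add: tens_map_pure[OF _ _ _ _ bimod_hom_id Mu_hom'[OF P]] exch_def mul_def)

text \<open>Once \<tau> has been applied to \<open>n' \<otimes> p\<close>, the remaining composite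
  is by definition \<open>left_N\<close> at \<open>n\<close>, so the value of \<tau> need not be a
  pure tensor.\<close>

lemma twist_side_N:
  "\<lbrakk>w \<in> Obj A; x \<in> Obj A; y \<in> Obj A; z \<in> Obj A; n \<in> cs N y z; n' \<in> cs N x y; p \<in> cs P w x\<rbrakk> \<Longrightarrow>
     rmul w z (tmap NP N PN N \<tau> idm w z (assoc_inv R A N P N w z
     (tmap N NP N PN idm \<tau> w z (assoc R A N N P w z (pure NN P w z x (pure N N x z y n n') p))))) =
   left_N w y z n (exch w x y n' p)"
  by (simp add: assoc_pure tens_map_pure[OF _ _ _ _ bimod_hom_id \<tau>_hom] left_N_def exch_def)

lemma twist_side_P:
  "\<lbrakk>w \<in> Obj A; x \<in> Obj A; y \<in> Obj A; z \<in> Obj A; n \<in> cs N y z; p \<in> cs P x y; p' \<in> cs P w x\<rbrakk> \<Longrightarrow>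
     lmul w z (tmap P NP P PN idm \<tau> w z (assoc R A P N P w z
     (tmap NP P PN P \<tau> idm w z (assoc_inv R A N P P w z (pure N PP w z y n (pure P P w y x p p')))))) =
   right_P w x z (exch x y z n p) p'"
  by (simp add: assoc_inv_pure tens_map_pure[OF _ _ _ _ \<tau>_hom bimod_hom_id] right_P_def exch_def)

text \<open>One direction evaluates the axioms at pure tensors. For the other, both sides of each
  axiom are linear, so agreement at pure tensors suffices, and in the unit axioms agreement at
  tensors with an identity.\<close>

lemma twist_iff: "twist R A P N \<tau> \<longleftrightarrow> twist_elem"
proof
  assume tw: "twist R A P N \<tau>"
  note tw' = tw[unfolded twist_def Let_def, THEN conjunct2, THEN bspec, THEN bspec, folded rmul_def lmul_def]
  note t1 = tw'[THEN conjunct1, THEN bspec] and t2 = tw'[THEN conjunct2, THEN conjunct1, THEN bspec]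
    and t3 = tw'[THEN conjunct2, THEN conjunct2, THEN conjunct1, THEN bspec]
    and t4 = tw'[THEN conjunct2, THEN conjunct2, THEN conjunct2, THEN bspec]
  show twist_elem unfolding twist_elem_def
  proof (intro conjI ballI)
    fix w x y z n n' p assume o: "w \<in> Obj A" "x \<in> Obj A" "y \<in> Obj A" "z \<in> Obj A"
      and e: "n \<in> cs N y z" "n' \<in> cs N x y" "p \<in> cs P w x"
    have c: "pure NN P w z x (pure N N x z y n n') p \<in> cs (ten NN P) w z" using o e by simp
    show "exch w x z (mul N x y z n n') p = left_N w y z n (exch w x y n' p)"
      using t1[OF o(1,4) c] unfolding tens_map_Mu_N[OF o e] twist_side_N[OF o e] .
  next
    fix w x y z n p p' assume o: "w \<in> Obj A" "x \<in> Obj A" "y \<in> Obj A" "z \<in> Obj A"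
      and e: "n \<in> cs N y z" "p \<in> cs P x y" "p' \<in> cs P w x"
    have c: "pure N PP w z y n (pure P P w y x p p') \<in> cs (ten N PP) w z" using o e by simp
    show "exch w y z n (mul P w x y p p') = right_P w x z (exch x y z n p) p'"
      using t3[OF o(1,4) c] unfolding tens_map_Mu_P[OF o e] twist_side_P[OF o e] .
  next
    fix x y p assume o: "x \<in> Obj A" "y \<in> Obj A" and p: "p \<in> cs P x y"
    have c: "pure (unit_bimod A) P x y y (Id A y) p \<in> carrier (Sp (ten (unit_bimod A) P) x y)"
      using o p by (simp add: Id_closed)
    show "exch x y y (un N y) p = pPN x y x p (un N x)"
      using t2[OF o c] o p
      by (simp add: tens_map_pure[OF _ _ _ _ Eta_hom'[OF N] bimod_hom_id] tens_map_pure[OF _ _ _ _ bimod_hom_id Eta_hom'[OF N]]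
          Id_closed lunit_pure runit_inv_def bimodule.lact_Id[OF bP] un_def exch_def)
  next
    fix x y n assume o: "x \<in> Obj A" "y \<in> Obj A" and n: "n \<in> cs N x y"
    have c: "pure N (unit_bimod A) x y x n (Id A x) \<in> carrier (Sp (ten N (unit_bimod A)) x y)"
      using o n by (simp add: Id_closed)
    show "exch x x y n (un P x) = pPN x y y (un P y) n"
      using t4[OF o c] o n
      by (simp add: tens_map_pure[OF _ _ _ _ Eta_hom'[OF P] bimod_hom_id] tens_map_pure[OF _ _ _ _ bimod_hom_id Eta_hom'[OF P]]
          Id_closed runit_pure lunit_inv_def bimodule.ract_Id[OF bN] un_def exch_def)
  qed
next
  assume tw: twist_elem
  note t1 = tw[unfolded twist_elem_def, THEN conjunct1, rule_format]
    and t2 = tw[unfolded twist_elem_def, THEN conjunct2, THEN conjunct1, rule_format]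
    and t3 = tw[unfolded twist_elem_def, THEN conjunct2, THEN conjunct2, THEN conjunct1, rule_format]
    and t4 = tw[unfolded twist_elem_def, THEN conjunct2, THEN conjunct2, THEN conjunct2, rule_format]
  let ?U = "unit_bimod A"
  note \<tau>l = bimod_hom_linear[OF \<tau>_hom, unfolded Sp_tensor]
  show "twist R A P N \<tau>"
    unfolding twist_def Let_def lmul_def[symmetric] rmul_def[symmetric]
  proof (intro conjI ballI)
    show "bimod_hom R A NP PN \<tau>" by (rule \<tau>_hom)
    fix x y assume xy: "x \<in> Obj A" "y \<in> Obj A"
    have h1: "bimod_hom R A (ten NN P) PN (\<lambda>x y t. \<tau> x y (tmap NN P N P (Mu N) idm x y t))"
      by (rule bimod_hom_compose[OF tens_map_hom[OF _ _ _ _ Mu_hom'[OF N] bimod_hom_id] \<tau>_hom]) simp_all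
    have h1': "bimod_hom R A (ten NN P) PN (\<lambda>x y t. rmul x y (tmap NP N PN N \<tau> idm x y (assoc_inv R A N P N x y
     (tmap N NP N PN idm \<tau> x y (assoc R A N N P x y t)))))"
      by (rule bimod_hom_compose[OF bimod_hom_compose[OF assoc_hom tens_map_hom[OF _ _ _ _ bimod_hom_id \<tau>_hom]] left_N_hom]) simp_all
    have h3: "bimod_hom R A (ten N PP) PN (\<lambda>x y t. \<tau> x y (tmap N PP N P idm (Mu P) x y t))"
      by (rule bimod_hom_compose[OF tens_map_hom[OF _ _ _ _ bimod_hom_id Mu_hom'[OF P]] \<tau>_hom]) simp_all
    have h3': "bimod_hom R A (ten N PP) PN (\<lambda>x y t. lmul x y (tmap P NP P PN idm \<tau> x y (assoc R A P N P x y
     (tmap NP P PN P \<tau> idm x y (assoc_inv R A N P P x y t)))))"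
      by (rule bimod_hom_compose[OF bimod_hom_compose[OF assoc_inv_hom tens_map_hom[OF _ _ _ _ \<tau>_hom bimod_hom_id]] right_P_hom]) simp_all
    show "\<tau> x y (tmap NN P N P (Mu N) idm x y t) = rmul x y (tmap NP N PN N \<tau> idm x y (assoc_inv R A N P N x y
     (tmap N NP N PN idm \<tau> x y (assoc R A N N P x y t))))" if t: "t \<in> cs (ten NN P) x y" for t
      by (rule tens3_agree_left[OF bN bN bP xy mPN[OF xy] bimod_hom_linear[OF h1 xy, unfolded Sp_tensor] bimod_hom_linear[OF h1' xy, unfolded Sp_tensor] _ t[unfolded Sp_tensor]])
        (simp only: tens_map_Mu_N[OF xy(1) _ _ xy(2)] twist_side_N[OF xy(1) _ _ xy(2)] t1[OF xy(1) _ _ xy(2)])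
    show "\<tau> x y (tmap N PP N P idm (Mu P) x y t) = lmul x y (tmap P NP P PN idm \<tau> x y (assoc R A P N P x y
     (tmap NP P PN P \<tau> idm x y (assoc_inv R A N P P x y t))))" if t: "t \<in> cs (ten N PP) x y" for t
      by (rule tens3_agree_right[OF bN bP bP xy mPN[OF xy] bimod_hom_linear[OF h3 xy, unfolded Sp_tensor] bimod_hom_linear[OF h3' xy, unfolded Sp_tensor] _ t[unfolded Sp_tensor]])
        (simp only: tens_map_Mu_P[OF xy(1) _ _ xy(2)] twist_side_P[OF xy(1) _ _ xy(2)] t3[OF xy(1) _ _ xy(2)])
    have k2: "linear_map R (tsp ?U P x y) (SPN x y) (\<lambda>t. \<tau> x y (tmap ?U P N P (Eta N) idm x y t))"
      by (rule linear_map_compose[OF bimod_hom_linear[OF tens_map_hom[OF _ _ _ _ Eta_hom'[OF N] bimod_hom_id] xy, unfolded Sp_tensor] \<tau>l[OF xy]]) simp_all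
    have k2': "linear_map R (tsp ?U P x y) (SPN x y) (\<lambda>t. tmap P ?U P N idm (Eta N) x y (runit_inv R A P x y (lunit R A P x y t)))"
      by (rule linear_map_compose[OF linear_map_compose[OF lunit_linear[OF bP xy] runit_inv_linear[OF bP xy]]
            bimod_hom_linear[OF tens_map_hom[OF _ _ _ _ bimod_hom_id Eta_hom'[OF N]] xy, unfolded Sp_tensor]]) simp_all
    have k4: "linear_map R (tsp N ?U x y) (SPN x y) (\<lambda>t. \<tau> x y (tmap N ?U N P idm (Eta P) x y t))"
      by (rule linear_map_compose[OF bimod_hom_linear[OF tens_map_hom[OF _ _ _ _ bimod_hom_id Eta_hom'[OF P]] xy, unfolded Sp_tensor] \<tau>l[OF xy]]) simp_all
    have k4': "linear_map R (tsp N ?U x y) (SPN x y) (\<lambda>t. tmap ?U N P N (Eta P) idm x y (lunit_inv R A N x y (runit R A N x y t)))"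
      by (rule linear_map_compose[OF linear_map_compose[OF runit_linear[OF bN xy] lunit_inv_linear[OF bN xy]]
            bimod_hom_linear[OF tens_map_hom[OF _ _ _ _ Eta_hom'[OF P] bimod_hom_id] xy, unfolded Sp_tensor]]) simp_all
    show "\<tau> x y (tmap ?U P N P (Eta N) idm x y t) =
        tmap P ?U P N idm (Eta N) x y (runit_inv R A P x y (lunit R A P x y t))"
      if t: "t \<in> cs (ten ?U P) x y" for t
      by (rule unit_left_agree[OF bP xy mPN[OF xy] k2 k2' _ t[unfolded Sp_tensor]])
        (use xy t2[unfolded exch_def un_def] in \<open>simp add: tens_map_pure[OF _ _ _ _ Eta_hom'[OF N] bimod_hom_id] tens_map_pure[OF _ _ _ _ bimod_hom_id Eta_hom'[OF N]]
          Id_closed lunit_pure runit_inv_def bimodule.lact_Id[OF bP]\<close>)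
    show "\<tau> x y (tmap N ?U N P idm (Eta P) x y t) =
        tmap ?U N P N (Eta P) idm x y (lunit_inv R A N x y (runit R A N x y t))"
      if t: "t \<in> cs (ten N ?U) x y" for t
      by (rule unit_right_agree[OF bN xy mPN[OF xy] k4 k4' _ t[unfolded Sp_tensor]])
        (use xy t4[unfolded exch_def un_def] in \<open>simp add: tens_map_pure[OF _ _ _ _ Eta_hom'[OF P] bimod_hom_id] tens_map_pure[OF _ _ _ _ bimod_hom_id Eta_hom'[OF P]]
          Id_closed runit_pure lunit_inv_def bimodule.ract_Id[OF bN]\<close>)
  qed
qed

end

section \<open>The triple of a stratified linear category\<close>

text \<open>\<open>stratified\<close> regrouped over \<open>over_category\<close>, so that the
  results on parts apply to \<open>Pos\<close> and \<open>Neg\<close>.\<close>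

locale stratified_category = over_category R A leq C
  for R :: "('k, 'r) ring_scheme" (structure) and A :: "('o, 'k, 'a, 'z) lincat_scheme"
    and leq :: "'o \<Rightarrow> 'o \<Rightarrow> bool" and C :: "('o, 'k, 'a, 'm, 's) strat_scheme" +
  assumes stratified: "stratified R A leq C"
begin

lemmas Pos_zero = stratified.Pos_zero[OF stratified, unfolded Obj_C]
  and Neg_zero = stratified.Neg_zero[OF stratified, unfolded Obj_C]
  and Pos_Neg_diag = stratified.Pos_Neg_diag[OF stratified, unfolded Obj_C]
  and Incl_bij = stratified.Incl_bij[OF stratified, unfolded Obj_C]
  and Comp_iso = stratified.Comp_iso[OF stratified, unfolded Obj_C]

lemma part_Pos [simp]: "part (Pos C)"
  using stratified.Pos_sub[OF stratified] Incl_bij by (auto simp: part_def bij_betw_def)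

text \<open>\<open>Incl_bij\<close> speaks of \<open>Pos\<close>; that \<open>Neg\<close> contains
  the image of \<open>A\<close> comes by way of \<open>Pos_Neg_diag\<close>.\<close>

lemma part_Neg [simp]: "part (Neg C)"
  using stratified.Neg_sub[OF stratified] Incl_bij Pos_Neg_diag by (auto simp: part_def bij_betw_def)

abbreviation "Pc \<equiv> PM (Pos C)"
abbreviation "Nc \<equiv> PM (Neg C)"
abbreviation "cPN \<equiv> comp_map R A C (Pos C) (Neg C)"
abbreviation "cNP \<equiv> comp_map R A C (Neg C) (Pos C)"
abbreviation "tw \<equiv> Tw (triple_of_strat R A C)"

lemma Pc_carrier: "cs Pc x y = Pos C x y" and Nc_carrier: "cs Nc x y = Neg C x y"
  by simp_all

lemma cPN_linear: "\<lbrakk>x \<in> Obj A; y \<in> Obj A\<rbrakk> \<Longrightarrow>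
    linear_map R (tsp Pc Nc x y) (Hom C x y) (cPN x y)"
  by (rule comp_map_linear) simp_all

lemma cNP_linear: "\<lbrakk>x \<in> Obj A; y \<in> Obj A\<rbrakk> \<Longrightarrow>
    linear_map R (tsp Nc Pc x y) (Hom C x y) (cNP x y)"
  by (rule comp_map_linear) simp_all

lemma cPN_bij: "\<lbrakk>x \<in> Obj A; y \<in> Obj A\<rbrakk> \<Longrightarrow>
    bij_betw (cPN x y) (carrier (tsp Pc Nc x y)) (carrier (Hom C x y))"
  using Comp_iso[of x y] by (simp add: tens_sp_part)

lemma cPN_inj:
  "\<lbrakk>x \<in> Obj A; y \<in> Obj A; s \<in> carrier (tsp Pc Nc x y); t \<in> carrier (tsp Pc Nc x y); cPN x y s = cPN x y t\<rbrakk> \<Longrightarrow>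
     s = t"
  using cPN_bij by (auto simp: bij_betw_def inj_on_def)

lemma tw_eq: "tw x y t = inv_into (carrier (tsp Pc Nc x y)) (cPN x y) (cNP x y t)"
  by (simp add: triple_of_strat_def tens_sp_part)

text \<open>Surjectivity of \<open>cPN\<close> makes the \<open>inv_into\<close> in
  \<open>triple_of_strat\<close> a true preimage.\<close>

lemma cPN_tw:
  assumes "x \<in> Obj A" "y \<in> Obj A" "t \<in> carrier (tsp Nc Pc x y)"
  shows "tw x y t \<in> carrier (tsp Pc Nc x y)" "cPN x y (tw x y t) = cNP x y t"
proof -
  have "cNP x y t \<in> cPN x y ` carrier (tsp Pc Nc x y)"
    using cPN_bij[OF assms(1,2)] linear_map_closed[OF cNP_linear[OF assms(1,2)] assms(3)] by (simp add: bij_betw_def)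
  then show "tw x y t \<in> carrier (tsp Pc Nc x y)" "cPN x y (tw x y t) = cNP x y t"
    unfolding tw_eq by (rule inv_into_into, rule f_inv_into_f)
qed

text \<open>Linearity is that of the inverse of a linear bijection. Compatibility with the actions
  is tested after \<open>cPN\<close>, since \<open>cPN\<close> and \<open>cNP\<close> both turn the
  actions of \<open>A\<close> into composition in \<open>C\<close>.\<close>

lemma tw_hom: "bimod_hom R A (ten Nc Pc) (ten Pc Nc) tw"
  unfolding bimod_hom_def Sp_tensor
proof (intro ballI conjI)
  fix x y assume xy: "x \<in> Obj A" "y \<in> Obj A"
  have b: "bim (ten Nc Pc)" "bim (ten Pc Nc)" by simp_all
  show "linear_map R (tsp Nc Pc x y) (tsp Pc Nc x y) (tw x y)"
    unfolding tw_eq[abs_def]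
    by (rule linear_map_compose[OF cNP_linear[OF xy] linear_map_the_inv[OF _ cPN_linear[OF xy] cPN_bij[OF xy]]]) (use xy in simp)
  fix t a assume t: "t \<in> carrier (tsp Nc Pc x y)"
  note ct = cPN_tw[OF xy t]
  { assume a: "a \<in> end_set A y"
    note l = bimodule.lact_closed[OF b(1) xy a, unfolded Sp_tensor, OF t] bimodule.lact_closed[OF b(2) xy a, unfolded Sp_tensor, OF ct(1)]
    show "tw x y (lact (ten Nc Pc) x y a t) = lact (ten Pc Nc) x y a (tw x y t)"
      by (rule cPN_inj[OF xy cPN_tw(1)[OF xy l(1)] l(2)])
        (simp add: cPN_tw(2)[OF xy l(1)] comp_map_lact xy a t ct) }
  { assume a: "a \<in> end_set A x"
    note l = bimodule.ract_closed[OF b(1) xy a, unfolded Sp_tensor, OF t] bimodule.ract_closed[OF b(2) xy a, unfolded Sp_tensor, OF ct(1)]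
    show "tw x y (ract (ten Nc Pc) x y t a) = ract (ten Pc Nc) x y (tw x y t) a"
      by (rule cPN_inj[OF xy cPN_tw(1)[OF xy l(1)] l(2)])
        (simp add: cPN_tw(2)[OF xy l(1)] comp_map_ract xy a t ct) }
qed

sublocale E: exchange R A leq Pc Nc tw
  by (intro exchange.intro exchange_axioms.intro monoid_pair.intro monoid_pair_axioms.intro
      base_category_axioms PM_mon part_Pos part_Neg tw_hom)

lemmas cPN_pure = comp_map_pure[OF part_Pos part_Neg] and cNP_pure = comp_map_pure[OF part_Neg part_Pos]

lemmas PosD = partD[OF part_Pos] and NegD = partD[OF part_Neg]

lemma cPN_exch:
  "\<lbrakk>x \<in> Obj A; y \<in> Obj A; z \<in> Obj A; n \<in> Neg C y z; p \<in> Pos C x y\<rbrakk> \<Longrightarrow>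
     cPN x z (E.exch x y z n p) = Comp C x y z n p"
  by (simp add: E.exch_def cPN_tw cNP_pure)

text \<open>The first of four translations by which \<open>cPN\<close> turns the formal actions on
  \<open>Pos \<otimes> Neg\<close> into composition in \<open>C\<close>. At pure tensors it is
  associativity.\<close>

lemma cPN_left_P:
  assumes o: "x \<in> Obj A" "y \<in> Obj A" "z \<in> Obj A" and p: "p \<in> Pos C y z" and s: "s \<in> carrier (tsp Pc Nc x y)"
  shows "cPN x z (E.left_P x y z p s) = Comp C x y z p (cPN x y s)"
proof -
  have p': "p \<in> cs Pc y z" "p \<in> carrier (Hom C y z)" using p PosD(3) o by auto
  show ?thesis
    by (rule tens_agree[OF E.bP E.bN o(1,2) HomC[OF o(1,3)] linear_map_compose[OF E.left_P_linear_right[OF o p'(1)] cPN_linear[OF o(1,3)]]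
          linear_map_compose[OF cPN_linear[OF o(1,2)] C_right[OF o p'(2)]] _ s])
      (use o p p' PosD NegD in \<open>simp add: E.left_P_pure mul_PM cPN_pure C_assoc\<close>)
qed

lemma cPN_right_N:
  assumes o: "x \<in> Obj A" "y \<in> Obj A" "z \<in> Obj A" and n: "n \<in> Neg C x y" and s: "s \<in> carrier (tsp Pc Nc y z)"
  shows "cPN x z (E.right_N x y z s n) = Comp C x y z (cPN y z s) n"
proof -
  have n': "n \<in> cs Nc x y" "n \<in> carrier (Hom C x y)" using n NegD(3) o by auto
  show ?thesis
    by (rule tens_agree[OF E.bP E.bN o(2,3) HomC[OF o(1,3)] linear_map_compose[OF E.right_N_linear_left[OF o n'(1)] cPN_linear[OF o(1,3)]]
          linear_map_compose[OF cPN_linear[OF o(2,3)] C_left[OF o n'(2)]] _ s])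
      (use o n n' PosD NegD in \<open>simp add: E.right_N_pure mul_PM cPN_pure C_assoc\<close>)
qed

text \<open>On \<open>p \<otimes> n'\<close> the action gives
  \<open>\<tau>(n \<otimes> p)n'\<close>, which \<open>cPN\<close> sends to \<open>(np)n'\<close> by
  \<open>cPN_right_N\<close> and \<open>cPN_exch\<close>.\<close>

lemma cPN_left_N:
  assumes o: "x \<in> Obj A" "y \<in> Obj A" "z \<in> Obj A" and n: "n \<in> Neg C y z" and s: "s \<in> carrier (tsp Pc Nc x y)"
  shows "cPN x z (E.left_N x y z n s) = Comp C x y z n (cPN x y s)"
proof -
  have n': "n \<in> cs Nc y z" "n \<in> carrier (Hom C y z)" using n NegD(3) o by auto
  show ?thesis
    by (rule tens_agree[OF E.bP E.bN o(1,2) HomC[OF o(1,3)] linear_map_compose[OF E.left_N_linear_right[OF o n'(1)] cPN_linear[OF o(1,3)]]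
          linear_map_compose[OF cPN_linear[OF o(1,2)] C_right[OF o n'(2)]] _ s])
      (use o n n' PosD NegD in \<open>simp add: E.left_N_pure cPN_right_N E.exch_closed cPN_exch cPN_pure C_assoc\<close>)
qed

lemma cPN_right_P:
  assumes o: "x \<in> Obj A" "y \<in> Obj A" "z \<in> Obj A" and p: "p \<in> Pos C x y" and s: "s \<in> carrier (tsp Pc Nc y z)"
  shows "cPN x z (E.right_P x y z s p) = Comp C x y z (cPN y z s) p"
proof -
  have p': "p \<in> cs Pc x y" "p \<in> carrier (Hom C x y)" using p PosD(3) o by auto
  show ?thesis
    by (rule tens_agree[OF E.bP E.bN o(2,3) HomC[OF o(1,3)] linear_map_compose[OF E.right_P_linear_left[OF o p'(1)] cPN_linear[OF o(1,3)]]
          linear_map_compose[OF cPN_linear[OF o(2,3)] C_left[OF o p'(2)]] _ s])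
      (use o p p' PosD NegD in \<open>simp add: E.right_P_pure cPN_left_P E.exch_closed cPN_exch cPN_pure C_assoc\<close>)
qed

lemma twist_tw: "twist R A Pc Nc tw"
  unfolding E.twist_iff E.twist_elem_def
proof (intro conjI ballI, unfold Pc_carrier Nc_carrier, goal_cases)
  case (1 w x y z n n' p)
  show ?case
    by (rule cPN_inj[OF 1(1) 1(4)]) (use 1 NegD PosD in \<open>simp_all add: mul_PM E.exch_closed E.left_N_closed cPN_left_N cPN_exch C_assoc\<close>)
next
  case (2 x y p)
  show ?case
    by (rule cPN_inj[OF 2(1) 2(2)]) (use 2 NegD PosD in \<open>simp_all add: un_PM E.exch_closed cPN_exch cPN_pure C_Id_left C_Id_right\<close>)
next
  case (3 w x y z n p p')
  show ?case
    by (rule cPN_inj[OF 3(1) 3(4)]) (use 3 NegD PosD in \<open>simp_all add: mul_PM E.exch_closed E.right_P_closed cPN_right_P cPN_exch C_assoc\<close>)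
next
  case (4 x y n)
  show ?case
    by (rule cPN_inj[OF 4(1) 4(2)]) (use 4 NegD PosD in \<open>simp_all add: un_PM E.exch_closed cPN_exch cPN_pure C_Id_left C_Id_right\<close>)
qed

theorem triple_of_strat_twisted: "twisted_triple R A leq (triple_of_strat R A C)"
proof -
  have "strongly_upward R A leq Pc"
    using Pos_zero Incl_bij by (simp add: strongly_upward_def)
  moreover have "strongly_downward R A leq Nc"
    using Neg_zero Incl_bij Pos_Neg_diag by (simp add: strongly_downward_def)
  ultimately show ?thesis
    using twist_tw by (simp add: twisted_triple_def triple_of_strat_def)
qed

end

section \<open>The twisted tensor product\<close>

locale twisted = exchange R A leq "Up T" "Down T" "Tw T"
  for R :: "('k, 'r) ring_scheme" (structure) and A :: "('o, 'k, 'a, 'z) lincat_scheme"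
    and leq :: "'o \<Rightarrow> 'o \<Rightarrow> bool" and T :: "('o, 'k, 'a, 'p, 'n) triple" +
  assumes twisted: "twisted_triple R A leq T"
begin

abbreviation "\<P> \<equiv> Up T"
abbreviation "\<N> \<equiv> Down T"

lemma upward: "strongly_upward R A leq \<P>" and downward: "strongly_downward R A leq \<N>"
  and twist: "twist R A \<P> \<N> (Tw T)"
  using twisted by (auto simp: twisted_triple_def)

lemma exch_mul_N:
  "\<lbrakk>w \<in> Obj A; x \<in> Obj A; y \<in> Obj A; z \<in> Obj A; n \<in> cs \<N> y z; n' \<in> cs \<N> x y; p \<in> cs \<P> w x\<rbrakk> \<Longrightarrow>
     exch w x z (mul \<N> x y z n n') p = left_N w y z n (exch w x y n' p)"
  and exch_un_N: "\<lbrakk>x \<in> Obj A; y \<in> Obj A; p \<in> cs \<P> x y\<rbrakk> \<Longrightarrow>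
     exch x y y (un \<N> y) p = pPN x y x p (un \<N> x)"
  and exch_mul_P: "\<lbrakk>w \<in> Obj A; x \<in> Obj A; y \<in> Obj A; z \<in> Obj A; n \<in> cs \<N> y z; p \<in> cs \<P> x y; p' \<in> cs \<P> w x\<rbrakk> \<Longrightarrow>
     exch w y z n (mul \<P> w x y p p') = right_P w x z (exch x y z n p) p'"
  and exch_un_P: "\<lbrakk>x \<in> Obj A; y \<in> Obj A; n \<in> cs \<N> x y\<rbrakk> \<Longrightarrow>
     exch x x y n (un \<P> x) = pPN x y y (un \<P> y) n"
  using twist unfolding twist_iff twist_elem_def by blast+

abbreviation "TM \<equiv> twisted_monoid R A T"
abbreviation "TC \<equiv> twisted_tensor_product R A T"
abbreviation "tcomp \<equiv> Comp TC"

lemma Sp_TM [simp]: "Sp TM = SPN"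
  by (simp add: twisted_monoid_def Let_def)

text \<open>Pure tensors inspect only the bimodule fields, and these \<open>twisted_monoid\<close>
  takes from \<open>PN\<close>.\<close>

lemma pure_TM: "pure TM TM = pure PN PN"
  by (intro ext) (simp add: twisted_monoid_def Let_def pure_tens_def tens_at_def)

lemma TC_simps [simp]: "Obj TC = Obj A" "Hom TC = SPN"
  by (simp_all add: twisted_tensor_product_def category_of_monoid_def)

lemma Mu_TM_hom: "bimod_hom R A (ten PN PN) PN (Mu TM)"
proof -
  have e: "Mu TM = (\<lambda>x y t. tmap PP NN \<P> \<N> (Mu \<P>) (Mu \<N>) x y
           (assoc_inv R A \<P> \<P> NN x y
             (tmap \<P> (ten PN \<N>) \<P> (ten \<P> NN) idm (assoc R A \<P> \<N> \<N>) x y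
               (tmap \<P> (ten NP \<N>) \<P> (ten PN \<N>) idm
                   (tmap NP \<N> PN \<N> (Tw T) idm) x y
                 (tmap \<P> (ten \<N> PN) \<P> (ten NP \<N>) idm (assoc_inv R A \<N> \<P> \<N>) x y
                   (assoc R A \<P> \<N> PN x y t))))))"
    by (simp add: twisted_monoid_def Let_def)
  show ?thesis unfolding e
    by (rule bimod_hom_compose[OF bimod_hom_compose[OF bimod_hom_compose[OF bimod_hom_compose[OF bimod_hom_compose[OF
        assoc_hom tens_map_hom[OF _ _ _ _ bimod_hom_id assoc_inv_hom]]
        tens_map_hom[OF _ _ _ _ bimod_hom_id tens_map_hom[OF _ _ _ _ \<tau>_hom bimod_hom_id]]]
        tens_map_hom[OF _ _ _ _ bimod_hom_id assoc_hom]] assoc_inv_hom]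
        tens_map_hom[OF _ _ _ _ Mu_hom'[OF P] Mu_hom'[OF N]]]) simp_all
qed

lemma tcomp_eq: "tcomp x y z g f = Mu TM x z (pure PN PN x z y g f)"
  by (simp add: twisted_tensor_product_def category_of_monoid_def pure_TM)

lemma tcomp_linear_right:
  "\<lbrakk>x \<in> Obj A; y \<in> Obj A; z \<in> Obj A; g \<in> carrier (SPN y z)\<rbrakk> \<Longrightarrow>
     linear_map R (SPN x y) (SPN x z) (tcomp x y z g)"
  unfolding tcomp_eq[abs_def]
  using linear_map_compose[OF pure_linear_right[of PN PN, unfolded Sp_tensor] bimod_hom_linear[OF Mu_TM_hom, unfolded Sp_tensor]]
  by simp

lemma tcomp_linear_left:
  "\<lbrakk>x \<in> Obj A; y \<in> Obj A; z \<in> Obj A; f \<in> carrier (SPN x y)\<rbrakk> \<Longrightarrow>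
     linear_map R (SPN y z) (SPN x z) (\<lambda>g. tcomp x y z g f)"
  unfolding tcomp_eq[abs_def]
  using linear_map_compose[OF pure_linear_left[of PN PN, unfolded Sp_tensor] bimod_hom_linear[OF Mu_TM_hom, unfolded Sp_tensor]]
  by simp

lemmas tcomp_closed = linear_map_closed[OF tcomp_linear_right]

text \<open>The product of \<open>twisted_monoid\<close> ends with both multiplications at once,
  whereas the actions apply them singly. At pure tensors the two factors do not interact, so the
  multiplication of the second can be done first, under the left factor \<open>p\<close>.\<close>

lemma Mu_Mu:
  assumes xy: "x \<in> Obj A" "y \<in> Obj A" and z: "z \<in> Obj A" and p: "p \<in> cs \<P> z y"
    and v: "v \<in> carrier (tsp \<P> NN x z)"
  shows "tmap PP NN \<P> \<N> (Mu \<P>) (Mu \<N>) x y (assoc_inv R A \<P> \<P> NN x y (pure \<P> (ten \<P> NN) x y z p v)) =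
    lmul x y (pure \<P> PN x y z p (tmap \<P> NN \<P> \<N> idm (Mu \<N>) x z v))"
proof -
  have b: "bim NN" "bim (ten \<P> NN)" by simp_all
  have h: "bimod_hom R A (ten \<P> (ten \<P> NN)) PN
    (\<lambda>x y t. tmap PP NN \<P> \<N> (Mu \<P>) (Mu \<N>) x y (assoc_inv R A \<P> \<P> NN x y t))"
    by (rule bimod_hom_compose[OF assoc_inv_hom tens_map_hom[OF _ _ _ _ Mu_hom'[OF P] Mu_hom'[OF N]]]) simp_all
  have h': "bimod_hom R A (ten \<P> NN) PN (tmap \<P> NN \<P> \<N> idm (Mu \<N>))"
    by (rule tens_map_hom[OF _ _ _ _ bimod_hom_id Mu_hom'[OF N]]) simp_all
  show ?thesis
    by (rule tens_agree[OF bP b(1) xy(1) z mPN[OF xy]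
        linear_map_compose[OF pure_linear_right[OF bP b(2) xy z p, unfolded Sp_tensor] bimod_hom_linear[OF h xy, unfolded Sp_tensor]]
        linear_map_compose[OF bimod_hom_linear[OF h' xy(1) z, unfolded Sp_tensor] left_P_linear_right[OF xy(1) z xy(2) p, unfolded left_P_def]] _ v])
      (use xy z p in \<open>simp add: assoc_inv_pure tens_map_pure[OF _ _ _ _ Mu_hom'[OF P] Mu_hom'[OF N]]
        tens_map_pure[OF _ _ _ _ bimod_hom_id Mu_hom'[OF N]] lmul_def
        tens_map_pure[OF _ _ _ _ Mu_hom'[OF P] bimod_hom_id] bimod_hom_closed[OF Mu_hom'[OF N], unfolded Sp_tensor]\<close>)
qed

text \<open>The inner maps of the product leave the left factor \<open>p\<close> alone, and on the
  rest they perform the composite in \<open>left_N\<close> up to its final multiplication, which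
  \<open>Mu_Mu\<close> splits off.\<close>

lemma tcomp_pure:
  assumes o: "x \<in> Obj A" "w \<in> Obj A" "y \<in> Obj A" "z \<in> Obj A" and p: "p \<in> cs \<P> w z"
    and n: "n \<in> cs \<N> y w" and s: "s \<in> carrier (SPN x y)"
  shows "tcomp x y z (pPN y z w p n) s = left_P x w z p (left_N x y w n s)"
proof -
  let ?u = "pure \<N> PN x w y n s"
  let ?v = "assoc_inv R A \<N> \<P> \<N> x w ?u"
  let ?v' = "tmap NP \<N> PN \<N> (Tw T) idm x w ?v"
  have u: "?u \<in> carrier (tsp \<N> PN x w)" using o n s by simp
  have v: "?v \<in> carrier (tsp NP \<N> x w)"
    using bimod_hom_closed[OF assoc_inv_hom[OF bN bP bN] o(1,2), unfolded Sp_tensor] u by simp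
  have h: "bimod_hom R A (ten NP \<N>) (ten PN \<N>) (tmap NP \<N> PN \<N> (Tw T) idm)"
    by (rule tens_map_hom[OF _ _ _ _ \<tau>_hom bimod_hom_id]) simp_all
  have v': "?v' \<in> carrier (tsp PN \<N> x w)"
    using bimod_hom_closed[OF h o(1,2), unfolded Sp_tensor] v by simp
  have v'': "assoc R A \<P> \<N> \<N> x w ?v' \<in> carrier (tsp \<P> NN x w)"
    using bimod_hom_closed[OF assoc_hom[OF bP bN bN] o(1,2), unfolded Sp_tensor] v' by simp
  have "tcomp x y z (pPN y z w p n) s =
    tmap PP NN \<P> \<N> (Mu \<P>) (Mu \<N>) x z (assoc_inv R A \<P> \<P> NN x z (pure \<P> (ten \<P> NN) x z w p (assoc R A \<P> \<N> \<N> x w ?v')))"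
    using o p n s u v v'
    by (simp add: tcomp_eq twisted_monoid_def Let_def assoc_pure tens_map_pure[OF _ _ _ _ bimod_hom_id assoc_inv_hom]
        tens_map_pure[OF _ _ _ _ bimod_hom_id h] tens_map_pure[OF _ _ _ _ bimod_hom_id assoc_hom])
  also have "\<dots> = left_P x w z p (left_N x y w n s)"
    by (simp add: Mu_Mu[OF o(1,4,2) p v''] left_P_def left_N_def rmul_def)
  finally show ?thesis .
qed

text \<open>The two multiplications act on different tensor factors.\<close>

lemma left_P_right_N:
  assumes o: "w \<in> Obj A" "x \<in> Obj A" "y \<in> Obj A" "z \<in> Obj A" and p: "p \<in> cs \<P> y z"
    and n: "n \<in> cs \<N> w x" and s: "s \<in> carrier (SPN x y)"
  shows "left_P w y z p (right_N w x y s n) = right_N w x z (left_P x y z p s) n"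
  by (rule tens_agree[OF bP bN o(2,3) mPN[OF o(1,4)]
      linear_map_compose[OF right_N_linear_left[OF o(1,2,3) n] left_P_linear_right[OF o(1,3,4) p]]
      linear_map_compose[OF left_P_linear_right[OF o(2,3,4) p] right_N_linear_left[OF o(1,2,4) n]] _ s])
    (use o p n in \<open>simp add: left_P_pure right_N_pure mul_closed[OF P] mul_closed[OF N]\<close>)

lemma right_N_right_N:
  assumes o: "w \<in> Obj A" "x \<in> Obj A" "y \<in> Obj A" "z \<in> Obj A" and n: "n \<in> cs \<N> x y"
    and n': "n' \<in> cs \<N> w x" and s: "s \<in> carrier (SPN y z)"
  shows "right_N w x z (right_N x y z s n) n' = right_N w y z s (mul \<N> w x y n n')"
  by (rule tens_agree[OF bP bN o(3,4) mPN[OF o(1,4)]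
      linear_map_compose[OF right_N_linear_left[OF o(2,3,4) n] right_N_linear_left[OF o(1,2,4) n']]
      right_N_linear_left[OF o(1,3,4) mul_closed[OF N o(1,2,3) n n']] _ s])
    (use o n n' in \<open>simp add: right_N_pure mul_closed[OF N] mul_assoc[OF N]\<close>)

lemma left_P_left_P:
  assumes o: "w \<in> Obj A" "x \<in> Obj A" "y \<in> Obj A" "z \<in> Obj A" and p: "p \<in> cs \<P> y z"
    and p': "p' \<in> cs \<P> x y" and s: "s \<in> carrier (SPN w x)"
  shows "left_P w y z p (left_P w x y p' s) = left_P w x z (mul \<P> x y z p p') s"
  by (rule tens_agree[OF bP bN o(1,2) mPN[OF o(1,4)]
      linear_map_compose[OF left_P_linear_right[OF o(1,2,3) p'] left_P_linear_right[OF o(1,3,4) p]]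
      left_P_linear_right[OF o(1,2,4) mul_closed[OF P o(2,3,4) p p']] _ s])
    (use o p p' in \<open>simp add: left_P_pure mul_closed[OF P] mul_assoc[OF P]\<close>)

text \<open>On \<open>p \<otimes> n''\<close> both sides are
  \<open>\<tau>(n \<otimes> p)(n''n')\<close>.\<close>

lemma left_N_right_N:
  assumes o: "w \<in> Obj A" "x \<in> Obj A" "y \<in> Obj A" "z \<in> Obj A" and n: "n \<in> cs \<N> y z"
    and n': "n' \<in> cs \<N> w x" and s: "s \<in> carrier (SPN x y)"
  shows "left_N w y z n (right_N w x y s n') = right_N w x z (left_N x y z n s) n'"
  by (rule tens_agree[OF bP bN o(2,3) mPN[OF o(1,4)]
      linear_map_compose[OF right_N_linear_left[OF o(1,2,3) n'] left_N_linear_right[OF o(1,3,4) n]]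
      linear_map_compose[OF left_N_linear_right[OF o(2,3,4) n] right_N_linear_left[OF o(1,2,4) n']] _ s])
    (use o n n' in \<open>simp add: left_N_pure right_N_pure right_N_right_N exch_closed mul_closed[OF N]\<close>)

text \<open>On \<open>p \<otimes> n''\<close> the left side is
  \<open>n(\<tau>(n' \<otimes> p)n'') = (n\<tau>(n' \<otimes> p))n''\<close>, and the twist axiom
  for products in the downward monoid identifies the bracket with
  \<open>\<tau>(nn' \<otimes> p)\<close>.\<close>

lemma left_N_left_N:
  assumes o: "w \<in> Obj A" "x \<in> Obj A" "y \<in> Obj A" "z \<in> Obj A" and n: "n \<in> cs \<N> y z"
    and n': "n' \<in> cs \<N> x y" and s: "s \<in> carrier (SPN w x)"
  shows "left_N w y z n (left_N w x y n' s) = left_N w x z (mul \<N> x y z n n') s"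
  by (rule tens_agree[OF bP bN o(1,2) mPN[OF o(1,4)]
      linear_map_compose[OF left_N_linear_right[OF o(1,2,3) n'] left_N_linear_right[OF o(1,3,4) n]]
      left_N_linear_right[OF o(1,2,4) mul_closed[OF N o(2,3,4) n n']] _ s])
    (use o n n' in \<open>simp add: left_N_pure left_N_right_N exch_closed mul_closed[OF N] exch_mul_N\<close>)

lemma tcomp_left_P:
  assumes o: "w \<in> Obj A" "x \<in> Obj A" "y \<in> Obj A" "z \<in> Obj A" and p: "p \<in> cs \<P> y z"
    and f: "f \<in> carrier (SPN x y)" and h: "h \<in> carrier (SPN w x)"
  shows "tcomp w x z (left_P x y z p f) h = left_P w y z p (tcomp w x y f h)"
  by (rule tens_agree[OF bP bN o(2,3) mPN[OF o(1,4)]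
      linear_map_compose[OF left_P_linear_right[OF o(2,3,4) p] tcomp_linear_left[OF o(1,2,4) h]]
      linear_map_compose[OF tcomp_linear_left[OF o(1,2,3) h] left_P_linear_right[OF o(1,3,4) p]] _ f])
    (use o p h in \<open>simp add: left_P_pure tcomp_pure left_P_left_P left_N_closed mul_closed[OF P]\<close>)

lemma tcomp_right_N:
  assumes o: "w \<in> Obj A" "x \<in> Obj A" "y \<in> Obj A" "z \<in> Obj A" and n: "n \<in> cs \<N> x y"
    and s: "s \<in> carrier (SPN y z)" and h: "h \<in> carrier (SPN w x)"
  shows "tcomp w x z (right_N x y z s n) h = tcomp w y z s (left_N w x y n h)"
  by (rule tens_agree[OF bP bN o(3,4) mPN[OF o(1,4)]
      linear_map_compose[OF right_N_linear_left[OF o(2,3,4) n] tcomp_linear_left[OF o(1,2,4) h]]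
      tcomp_linear_left[OF o(1,3,4) left_N_closed[OF o(1,2,3) n h]] _ s])
    (use o n h in \<open>simp add: right_N_pure tcomp_pure left_N_left_N left_N_closed mul_closed[OF N]\<close>)

text \<open>On \<open>s = p' \<otimes> n'\<close> both sides are
  \<open>p'\<tau>(n' \<otimes> p)n\<close>, the outer multiplications commuting. This brings in
  \<open>right_P\<close>, in whose terms the twist axiom for products in the upward monoid is
  stated.\<close>

lemma tcomp_pure_right:
  assumes o: "x \<in> Obj A" "v \<in> Obj A" "y \<in> Obj A" "z \<in> Obj A" and s: "s \<in> carrier (SPN y z)"
    and p: "p \<in> cs \<P> v y" and n: "n \<in> cs \<N> x v"
  shows "tcomp x y z s (pPN x y v p n) = right_N x v z (right_P v y z s p) n"
proof -
  have c: "pPN x y v p n \<in> carrier (SPN x y)" using o p n by simp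
  show ?thesis
    by (rule tens_agree[OF bP bN o(3,4) mPN[OF o(1,4)] tcomp_linear_left[OF o(1,3,4) c]
        linear_map_compose[OF right_P_linear_left[OF o(2,3,4) p] right_N_linear_left[OF o(1,2,4) n]] _ s])
      (use o p n in \<open>simp add: tcomp_pure left_N_pure right_P_pure left_P_right_N exch_closed\<close>)
qed

text \<open>On \<open>u = p' \<otimes> n'\<close> the left side is
  \<open>\<tau>(n \<otimes> pp')n'\<close>, which is \<open>(\<tau>(n \<otimes> p)p')n'\<close> by
  the twist axiom; \<open>tcomp_pure_right\<close> reads this as a product.\<close>

lemma left_N_left_P:
  assumes o: "w \<in> Obj A" "x \<in> Obj A" "y \<in> Obj A" "z \<in> Obj A" and n: "n \<in> cs \<N> y z"
    and p: "p \<in> cs \<P> x y" and u: "u \<in> carrier (SPN w x)"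
  shows "left_N w y z n (left_P w x y p u) = tcomp w x z (exch x y z n p) u"
  by (rule tens_agree[OF bP bN o(1,2) mPN[OF o(1,4)]
      linear_map_compose[OF left_P_linear_right[OF o(1,2,3) p] left_N_linear_right[OF o(1,3,4) n]]
      tcomp_linear_right[OF o(1,2,4) exch_closed[OF o(2,3,4) n p]] _ u])
    (use o n p in \<open>simp add: left_P_pure left_N_pure tcomp_pure_right exch_closed mul_closed[OF P] exch_mul_P\<close>)

text \<open>On \<open>f = p \<otimes> n'\<close> one has \<open>n(p(n'h)) = \<tau>(n \<otimes>
  p)(n'h) = (\<tau>(n \<otimes> p)n')h\<close>, by \<open>left_N_left_P\<close> and
  \<open>tcomp_right_N\<close>.\<close>

lemma left_N_tcomp:
  assumes o: "w \<in> Obj A" "x \<in> Obj A" "y \<in> Obj A" "z \<in> Obj A" and n: "n \<in> cs \<N> y z"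
    and f: "f \<in> carrier (SPN x y)" and h: "h \<in> carrier (SPN w x)"
  shows "left_N w y z n (tcomp w x y f h) = tcomp w x z (left_N x y z n f) h"
  by (rule tens_agree[OF bP bN o(2,3) mPN[OF o(1,4)]
      linear_map_compose[OF tcomp_linear_left[OF o(1,2,3) h] left_N_linear_right[OF o(1,3,4) n]]
      linear_map_compose[OF left_N_linear_right[OF o(2,3,4) n] tcomp_linear_left[OF o(1,2,4) h]] _ f])
    (use o n h in \<open>simp add: tcomp_pure left_N_pure left_N_left_P left_N_closed tcomp_right_N exch_closed\<close>)

text \<open>With \<open>g = p \<otimes> n\<close> both sides become \<open>p(n(fh))\<close>, the
  left one by \<open>tcomp_left_P\<close> and \<open>left_N_tcomp\<close>.\<close>

lemma tcomp_assoc: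
  assumes o: "w \<in> Obj A" "x \<in> Obj A" "y \<in> Obj A" "z \<in> Obj A" and g: "g \<in> carrier (SPN y z)"
    and f: "f \<in> carrier (SPN x y)" and h: "h \<in> carrier (SPN w x)"
  shows "tcomp w x z (tcomp x y z g f) h = tcomp w y z g (tcomp w x y f h)"
  by (rule tens_agree[OF bP bN o(3,4) mPN[OF o(1,4)]
      linear_map_compose[OF tcomp_linear_left[OF o(2,3,4) f] tcomp_linear_left[OF o(1,2,4) h]]
      tcomp_linear_left[OF o(1,3,4) tcomp_closed[OF o(1,2,3) f h]] _ g])
    (use o f h in \<open>simp add: tcomp_pure tcomp_closed tcomp_left_P left_N_closed left_N_tcomp\<close>)

section \<open>The copies of the two monoids inside the twisted tensor product\<close>

definition inP where "inP x y p = pPN x y x p (un \<N> x)"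
definition inN where "inN x y n = pPN x y y (un \<P> y) n"

lemma un_P_closed [simp]: "x \<in> Obj A \<Longrightarrow> un \<P> x \<in> cs \<P> x x"
  and un_N_closed [simp]: "x \<in> Obj A \<Longrightarrow> un \<N> x \<in> cs \<N> x x"
  by (rule un_closed[OF P], simp) (rule un_closed[OF N], simp)

lemma inP_linear: "\<lbrakk>x \<in> Obj A; y \<in> Obj A\<rbrakk> \<Longrightarrow>
    linear_map R (Sp \<P> x y) (SPN x y) (inP x y)"
  unfolding inP_def by (rule pure_linear_left) simp_all

lemma inN_linear: "\<lbrakk>x \<in> Obj A; y \<in> Obj A\<rbrakk> \<Longrightarrow>
    linear_map R (Sp \<N> x y) (SPN x y) (inN x y)"
  unfolding inN_def by (rule pure_linear_right) simp_all

lemmas inP_closed = linear_map_closed[OF inP_linear] and inN_closed = linear_map_closed[OF inN_linear]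

lemma left_N_un: "\<lbrakk>x \<in> Obj A; y \<in> Obj A; s \<in> carrier (SPN x y)\<rbrakk> \<Longrightarrow>
    left_N x y y (un \<N> y) s = s"
  by (rule tens_agree[OF bP bN _ _ mPN left_N_linear_right linear_map_id])
    (simp_all add: left_N_pure exch_un_N right_N_pure mul_un_left[OF N])

lemma left_P_un: "\<lbrakk>x \<in> Obj A; y \<in> Obj A; s \<in> carrier (SPN x y)\<rbrakk> \<Longrightarrow>
    left_P x y y (un \<P> y) s = s"
  by (rule tens_agree[OF bP bN _ _ mPN left_P_linear_right linear_map_id])
    (simp_all add: left_P_pure mul_un_left[OF P])

lemma right_N_un: "\<lbrakk>x \<in> Obj A; y \<in> Obj A; s \<in> carrier (SPN x y)\<rbrakk> \<Longrightarrow>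
    right_N x x y s (un \<N> x) = s"
  by (rule tens_agree[OF bP bN _ _ mPN right_N_linear_left linear_map_id])
    (simp_all add: right_N_pure mul_un_right[OF N])

lemma right_P_un: "\<lbrakk>x \<in> Obj A; y \<in> Obj A; s \<in> carrier (SPN x y)\<rbrakk> \<Longrightarrow>
    right_P x x y s (un \<P> x) = s"
  by (rule tens_agree[OF bP bN _ _ mPN right_P_linear_left linear_map_id])
    (simp_all add: right_P_pure exch_un_P left_P_pure mul_un_right[OF P])

lemma tcomp_inP_left: "\<lbrakk>w \<in> Obj A; x \<in> Obj A; y \<in> Obj A; p \<in> cs \<P> x y; s \<in> carrier (SPN w x)\<rbrakk> \<Longrightarrow>
    tcomp w x y (inP x y p) s = left_P w x y p s"
  by (simp add: inP_def tcomp_pure left_N_un)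

lemma tcomp_inN_right: "\<lbrakk>w \<in> Obj A; x \<in> Obj A; y \<in> Obj A; n \<in> cs \<N> w x; s \<in> carrier (SPN x y)\<rbrakk> \<Longrightarrow>
    tcomp w x y s (inN w x n) = right_N w x y s n"
  by (simp add: inN_def tcomp_pure_right right_P_un)

lemma tcomp_inP_inP: "\<lbrakk>w \<in> Obj A; x \<in> Obj A; y \<in> Obj A; p \<in> cs \<P> x y; p' \<in> cs \<P> w x\<rbrakk> \<Longrightarrow>
    tcomp w x y (inP x y p) (inP w x p') = inP w y (mul \<P> w x y p p')"
  by (simp add: tcomp_inP_left inP_closed, simp add: inP_def left_P_pure)

lemma tcomp_inN_inN: "\<lbrakk>w \<in> Obj A; x \<in> Obj A; y \<in> Obj A; n \<in> cs \<N> x y; n' \<in> cs \<N> w x\<rbrakk> \<Longrightarrow>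
    tcomp w x y (inN x y n) (inN w x n') = inN w y (mul \<N> w x y n n')"
  by (simp add: tcomp_inN_right inN_closed, simp add: inN_def right_N_pure)

text \<open>Every pure tensor is thus a product of embedded elements, which is the factorisation
  demanded of a stratified category.\<close>

lemma tcomp_inP_im: "\<lbrakk>w \<in> Obj A; x \<in> Obj A; y \<in> Obj A; p \<in> cs \<P> x y; n \<in> cs \<N> w x\<rbrakk> \<Longrightarrow>
    tcomp w x y (inP x y p) (inN w x n) = pPN w y x p n"
  by (simp add: tcomp_inP_left inN_closed, simp add: inN_def left_P_pure mul_un_right[OF P])

text \<open>Recovers the twist from composition, and so identifies the triple of the twisted tensor
  product with the original one.\<close>

lemma tcomp_inN_inP: "\<lbrakk>w \<in> Obj A; x \<in> Obj A; y \<in> Obj A; n \<in> cs \<N> x y; p \<in> cs \<P> w x\<rbrakk> \<Longrightarrow>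
    tcomp w x y (inN x y n) (inP w x p) = exch w x y n p"
  by (simp add: inN_def tcomp_pure inP_closed left_P_un left_N_closed, simp add: inP_def left_N_pure right_N_un exch_closed)

text \<open>\<open>lunit_inv\<close> places \<open>a\<close> in the second tensor factor with an
  identity in the first, so the inclusion of \<open>A\<close> appears on the downward side.\<close>

lemma Incl_TC: "\<lbrakk>x \<in> Obj A; y \<in> Obj A; a \<in> carrier (Hom A x y)\<rbrakk> \<Longrightarrow>
    Incl TC x y a = inN x y (Eta \<N> x y a)"
  by (simp add: twisted_tensor_product_def category_of_monoid_def twisted_monoid_def Let_def lunit_inv_def Id_closed
      tens_map_pure[OF _ _ _ _ Eta_hom'[OF P] Eta_hom'[OF N]] inN_def un_def)

lemma Id_TC: "x \<in> Obj A \<Longrightarrow> Id TC x = pPN x x x (un \<P> x) (un \<N> x)"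
  using Incl_TC[of x x "Id A x"]
  by (simp add: twisted_tensor_product_def category_of_monoid_def Id_closed inN_def un_def)

lemma Id_TC_inN: "x \<in> Obj A \<Longrightarrow> Id TC x = inN x x (un \<N> x)" and Id_TC_inP: "x \<in> Obj A \<Longrightarrow> Id TC x = inP x x (un \<P> x)"
  by (simp_all add: Id_TC inN_def inP_def)

text \<open>A scalar may be moved across the tensor of the two units. Hence both copies contain the
  same image of the endomorphisms of \<open>x\<close> in \<open>A\<close>.\<close>

lemma inN_inP_Eta: "\<lbrakk>x \<in> Obj A; a \<in> end_set A x\<rbrakk> \<Longrightarrow>
    inN x x (Eta \<N> x x a) = inP x x (Eta \<P> x x a)"
  using pure_shift[OF bP bN, of x x x "un \<P> x" a "un \<N> x"]
  by (simp add: inN_def inP_def Eta_lact[OF N] Eta_ract[OF P])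

lemma Pos_TC: "Pos TC x y = inP x y ` cs \<P> x y" and Neg_TC: "Neg TC x y = inN x y ` cs \<N> x y"
  by (simp_all add: twisted_tensor_product_def category_of_monoid_def inP_def inN_def un_def)

lemma TC_category: "linear_category R TC"
proof (intro linear_category.intro linear_category_axioms.intro, unfold TC_simps)
  show "cring R" by (rule is_cring)
  fix x y assume xy: "x \<in> Obj A" "y \<in> Obj A"
  show "module R (SPN x y)" by (rule mPN[OF xy])
  fix f assume f: "f \<in> carrier (SPN x y)"
  show "tcomp x y y (Id TC y) f = f"
    using xy f by (simp add: Id_TC_inP tcomp_inP_left left_P_un)
  show "tcomp x x y f (Id TC x) = f"
    using xy f by (simp add: Id_TC_inN tcomp_inN_right right_N_un)
qed (auto simp: tcomp_closed tcomp_assoc Id_TC intro: tcomp_linear_left tcomp_linear_right)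

lemma TC_over: "over_category R A leq TC"
proof (intro over_category.intro over_category_axioms.intro base_category_axioms TC_category)
  show "Obj TC = Obj A" by simp
  show "linear_functor R A TC (Incl TC)"
    unfolding linear_functor_def
  proof (intro conjI ballI, simp, unfold TC_simps)
    have lin: "linear_map R (Hom A x y) (SPN x y) (Incl TC x y)" if xy: "x \<in> Obj A" "y \<in> Obj A" for x y
      by (rule linear_map_cong[OF linear_map_compose[OF bimod_hom_linear[OF Eta_hom'[OF N] xy, unfolded Sp_unit] inN_linear[OF xy]] Hom_module[OF xy] Incl_TC[OF xy]])
    show "linear_map R (Hom A x y) (SPN x y) (Incl TC x y)" if "x \<in> Obj A" "y \<in> Obj A" for x y using lin that .
    show "Incl TC x x (Id A x) = Id TC x" if "x \<in> Obj A" for x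
      using that by (simp add: Incl_TC Id_closed Id_TC_inN un_def)
    fix x y z g f assume o: "x \<in> Obj A" "y \<in> Obj A" "z \<in> Obj A" and g: "g \<in> carrier (Hom A y z)" and f: "f \<in> carrier (Hom A x y)"
    have ic: "Incl TC y z g \<in> carrier (SPN y z)" "Incl TC x y f \<in> carrier (SPN x y)"
      using linear_map_closed[OF lin] o g f by auto
    note mz = mPN[OF o(1,3)]
    \<comment> \<open>Unless \<open>x = y = z\<close>, one of \<open>f\<close> and \<open>g\<close>
      lies in a zero module, and both sides are linear in it. On the diagonal everything takes place
      in the copy of the downward monoid.\<close>
    show "Incl TC x z (Comp A x y z g f) = tcomp x y z (Incl TC y z g) (Incl TC x y f)"
    proof (cases "x = y")
      case False
      have "Incl TC x z (Comp A x y z g f) = \<zero>\<^bsub>SPN x z\<^esub>"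
        by (rule Hom_offdiag_linear[OF o(1,2) False mz linear_map_compose[OF Comp_linear_right[OF o g] lin[OF o(1,3)]] f])
      moreover have "tcomp x y z (Incl TC y z g) (Incl TC x y f) = \<zero>\<^bsub>SPN x z\<^esub>"
        by (rule Hom_offdiag_linear[OF o(1,2) False mz linear_map_compose[OF lin[OF o(1,2)] tcomp_linear_right[OF o ic(1)]] f])
      ultimately show ?thesis by simp
    next
      case xy: True
      show ?thesis
      proof (cases "y = z")
        case False
        have "Incl TC x z (Comp A x y z g f) = \<zero>\<^bsub>SPN x z\<^esub>"
          by (rule Hom_offdiag_linear[OF o(2,3) False mz linear_map_compose[OF Comp_linear_left[OF o f] lin[OF o(1,3)]] g])
        moreover have "tcomp x y z (Incl TC y z g) (Incl TC x y f) = \<zero>\<^bsub>SPN x z\<^esub>"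
          by (rule Hom_offdiag_linear[OF o(2,3) False mz linear_map_compose[OF lin[OF o(2,3)] tcomp_linear_left[OF o ic(2)]] g])
        ultimately show ?thesis by simp
      next
        case True
        then show ?thesis using o g f xy
          by (simp add: Incl_TC Comp_closed Eta_Comp[OF N] tcomp_inN_inN Eta_closed[OF N])
      qed
    qed
  qed
qed

end

sublocale twisted \<subseteq> O: over_category R A leq TC
  by (rule TC_over)

section \<open>Retractions of the units, injectivity of the embeddings, and stratification of the
  product\<close>

context base_category begin

text \<open>Inverse to \<open>Eta\<close> on the diagonal. Elsewhere the target is a zero module, so
  the value zero is forced, and the whole family can be a morphism to the unit bimodule.\<close>

definition Eta_inv :: "('o, 'k, 'a, 'm, 's) bimod_mon_scheme \<Rightarrow> 'o \<Rightarrow> 'o \<Rightarrow> 'm \<Rightarrow> 'a" where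
  "Eta_inv D x y n = (if x = y then inv_into (end_set A x) (Eta D x x) n else \<zero>\<^bsub>Hom A x y\<^esub>)"

lemma Eta_inv_hom:
  assumes D: "mon D" and bij: "\<And>x. x \<in> Obj A \<Longrightarrow> bij_betw (Eta D x x) (end_set A x) (cs D x x)"
  shows "bimod_hom R A D (unit_bimod A) (Eta_inv D)"
    and "x \<in> Obj A \<Longrightarrow> Eta_inv D x x (un D x) = Id A x"
proof -
  have inv: "Eta_inv D x x (Eta D x x a) = a" if "x \<in> Obj A" "a \<in> end_set A x" for x a
    using bij[OF that(1)] that(2) by (simp add: Eta_inv_def bij_betw_def)
  have rep: "\<exists>a\<in>end_set A x. m = Eta D x x a" if "x \<in> Obj A" "m \<in> cs D x x" for x m
    using bij[OF that(1)] that(2) by (auto simp: bij_betw_def)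
  show "x \<in> Obj A \<Longrightarrow> Eta_inv D x x (un D x) = Id A x" unfolding un_def by (rule inv) (simp_all add: Id_closed)
  show "bimod_hom R A D (unit_bimod A) (Eta_inv D)"
    unfolding bimod_hom_def
  proof (intro ballI conjI)
    fix x y assume xy: "x \<in> Obj A" "y \<in> Obj A"
    note Eh = Eta_hom'[OF D]
    show "linear_map R (Sp D x y) (Sp (unit_bimod A) x y) (Eta_inv D x y)"
    proof (cases "x = y")
      case True
      have "linear_map R (Sp D x x) (Hom A x x) (inv_into (end_set A x) (Eta D x x))"
        using linear_map_the_inv[OF Hom_module[OF xy(1,1)] bimod_hom_linear[OF Eh xy(1,1), unfolded Sp_unit] bij[OF xy(1)]] .
      then show ?thesis using True by (simp add: Eta_inv_def[abs_def])
    next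
      case False then show ?thesis
        using linear_map_const_zero[OF Hom_module[OF xy]] by (simp add: Eta_inv_def[abs_def])
    qed
    fix m a assume m: "m \<in> cs D x y"
    { assume a: "a \<in> end_set A y"
      show "Eta_inv D x y (lact D x y a m) = lact (unit_bimod A) x y a (Eta_inv D x y m)"
      proof (cases "x = y")
        case True
        then obtain b where "b \<in> end_set A x" "m = Eta D x x b" using rep xy m by auto
        then show ?thesis using True a xy bimod_hom_lact[OF Eh xy(1,1), of b a, symmetric] by (simp add: inv Comp_closed)
      next
        case False
        then show ?thesis using linear_map_zero[OF _ _ Comp_linear_right[OF xy xy(2) a]] xy
          by (simp add: Eta_inv_def Hom_module)
      qed }
    { assume a: "a \<in> end_set A x"
      show "Eta_inv D x y (ract D x y m a) = ract (unit_bimod A) x y (Eta_inv D x y m) a"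
      proof (cases "x = y")
        case True
        then obtain b where "b \<in> end_set A x" "m = Eta D x x b" using rep xy m by auto
        then show ?thesis using True a xy bimod_hom_ract[OF Eh xy(1,1), of b a, symmetric] by (simp add: inv Comp_closed)
      next
        case False
        then show ?thesis using linear_map_zero[OF _ _ Comp_linear_left[OF xy(1) xy a]] xy
          by (simp add: Eta_inv_def Hom_module)
      qed }
  qed
qed

end

lemma (in cring) linear_image_submodule:
  assumes M: "module R M" and N: "module R N" and f: "linear_map R M N f"
  shows "submodule (f ` carrier M) R N"
proof -
  interpret M: module R M by fact
  interpret N: module R N by fact
  have n: "\<ominus>\<^bsub>N\<^esub> f u = f (\<ominus>\<^bsub>M\<^esub> u)" if "u \<in> carrier M" for u
    using linear_map_add[OF f M.M.a_inv_closed[OF that] that] that linear_map_zero[OF M N f]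
      N.M.minus_equality[of "f (\<ominus>\<^bsub>M\<^esub> u)" "f u"] by (simp add: M.M.l_neg linear_map_closed[OF f])
  show ?thesis
  proof (rule N.submoduleI)
    show "\<zero>\<^bsub>N\<^esub> \<in> f ` carrier M" using linear_map_zero[OF M N f] by (metis M.M.zero_closed imageI)
    show "\<ominus>\<^bsub>N\<^esub> a \<in> f ` carrier M" if "a \<in> f ` carrier M" for a using that n by auto
    show "a \<oplus>\<^bsub>N\<^esub> b \<in> f ` carrier M" if "a \<in> f ` carrier M" "b \<in> f ` carrier M" for a b
      using that by (auto simp flip: linear_map_add[OF f])
    show "r \<odot>\<^bsub>N\<^esub> a \<in> f ` carrier M" if "r \<in> carrier R" "a \<in> f ` carrier M" for r a
      using that by (auto simp flip: linear_map_smult[OF f])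
  qed (auto simp: linear_map_closed[OF f])
qed

context twisted begin

lemma bij_P: "x \<in> Obj A \<Longrightarrow> bij_betw (Eta \<P> x x) (end_set A x) (cs \<P> x x)"
  and bij_N: "x \<in> Obj A \<Longrightarrow> bij_betw (Eta \<N> x x) (end_set A x) (cs \<N> x x)"
  using upward downward by (auto simp: strongly_upward_def strongly_downward_def)

text \<open>A left inverse is the composite
  \<open>P \<otimes> N \<rightarrow> P \<otimes> A \<rightarrow> P\<close>, which sends
  \<open>p \<otimes> 1\<close> to \<open>p\<close>; it exists because the unit of the other monoid
  is bijective on the diagonal.\<close>

lemma inP_inj: "\<lbrakk>x \<in> Obj A; y \<in> Obj A\<rbrakk> \<Longrightarrow> inj_on (inP x y) (cs \<P> x y)"
proof (rule inj_on_inverseI)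
  fix p assume xy: "x \<in> Obj A" "y \<in> Obj A" and p: "p \<in> cs \<P> x y"
  show "runit R A \<P> x y (tmap \<P> \<N> \<P> (unit_bimod A) idm (Eta_inv \<N>) x y (inP x y p)) = p"
    using xy p by (simp add: inP_def tens_map_pure[OF _ _ _ _ bimod_hom_id Eta_inv_hom(1)[OF N bij_N]]
        Eta_inv_hom(2)[OF N bij_N] runit_pure Id_closed bimodule.ract_Id[OF bP])
qed

lemma inN_inj: "\<lbrakk>x \<in> Obj A; y \<in> Obj A\<rbrakk> \<Longrightarrow> inj_on (inN x y) (cs \<N> x y)"
proof (rule inj_on_inverseI)
  fix n assume xy: "x \<in> Obj A" "y \<in> Obj A" and n: "n \<in> cs \<N> x y"
  show "lunit R A \<N> x y (tmap \<P> \<N> (unit_bimod A) \<N> (Eta_inv \<P>) idm x y (inN x y n)) = n"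
    using xy n by (simp add: inN_def tens_map_pure[OF _ _ _ _ Eta_inv_hom(1)[OF P bij_P] bimod_hom_id]
        Eta_inv_hom(2)[OF P bij_P] lunit_pure Id_closed bimodule.lact_Id[OF bN])
qed

lemma Pos_sub: "wide_linear_subcategory R TC (Pos TC)"
  unfolding wide_linear_subcategory_def TC_simps Pos_TC
proof (intro conjI ballI)
  show "submodule (inP x y ` cs \<P> x y) R (SPN x y)" if "x \<in> Obj A" "y \<in> Obj A" for x y
    using linear_image_submodule[OF mP mPN inP_linear] that by simp
  show "Id TC x \<in> inP x x ` cs \<P> x x" if "x \<in> Obj A" for x
    using that by (simp add: Id_TC_inP)
  show "tcomp x y z g f \<in> inP x z ` cs \<P> x z"
    if "x \<in> Obj A" "y \<in> Obj A" "z \<in> Obj A" "g \<in> inP y z ` cs \<P> y z" "f \<in> inP x y ` cs \<P> x y" for x y z g f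
    using that by (auto simp: tcomp_inP_inP mul_closed[OF P])
qed

lemma Neg_sub: "wide_linear_subcategory R TC (Neg TC)"
  unfolding wide_linear_subcategory_def TC_simps Neg_TC
proof (intro conjI ballI)
  show "submodule (inN x y ` cs \<N> x y) R (SPN x y)" if "x \<in> Obj A" "y \<in> Obj A" for x y
    using linear_image_submodule[OF mN mPN inN_linear] that by simp
  show "Id TC x \<in> inN x x ` cs \<N> x x" if "x \<in> Obj A" for x
    using that by (simp add: Id_TC_inN)
  show "tcomp x y z g f \<in> inN x z ` cs \<N> x z"
    if "x \<in> Obj A" "y \<in> Obj A" "z \<in> Obj A" "g \<in> inN y z ` cs \<N> y z" "f \<in> inN x y ` cs \<N> x y" for x y z g f
    using that by (auto simp: tcomp_inN_inN mul_closed[OF N])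
qed

lemma Incl_TC_inP: "\<lbrakk>x \<in> Obj A; a \<in> end_set A x\<rbrakk> \<Longrightarrow>
    Incl TC x x a = inP x x (Eta \<P> x x a)"
  by (simp add: Incl_TC inN_inP_Eta)

lemma part_Pos [simp]: "O.part (Pos TC)"
  using Pos_sub by (auto simp: O.part_def Pos_TC Incl_TC_inP Eta_closed[OF P])

lemma part_Neg [simp]: "O.part (Neg TC)"
  using Neg_sub by (auto simp: O.part_def Neg_TC Incl_TC Eta_closed[OF N])

abbreviation "Pt \<equiv> O.PM (Pos TC)"
abbreviation "Nt \<equiv> O.PM (Neg TC)"

lemma inP_hom: "bimod_mon_hom R A \<P> Pt inP"
proof (rule bimod_mon_homI[OF P O.PM_mon[OF part_Pos]])
  show "linear_map R (Sp \<P> x y) (Sp Pt x y) (inP x y)" if "x \<in> Obj A" "y \<in> Obj A" for x y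
    unfolding O.Sp_PM O.linear_PM_iff[OF O.partD(2)[OF part_Pos that]]
    using inP_linear[OF that] by (simp add: Pos_TC)
  show "inP x z (mul \<P> x y z g h) = mul Pt x y z (inP y z g) (inP x y h)"
    if "x \<in> Obj A" "y \<in> Obj A" "z \<in> Obj A" "g \<in> cs \<P> y z" "h \<in> cs \<P> x y" for x y z g h
    using that by (simp add: O.mul_PM tcomp_inP_inP Pos_TC)
qed (simp add: Incl_TC_inP)

lemma inN_hom: "bimod_mon_hom R A \<N> Nt inN"
proof (rule bimod_mon_homI[OF N O.PM_mon[OF part_Neg]])
  show "linear_map R (Sp \<N> x y) (Sp Nt x y) (inN x y)" if "x \<in> Obj A" "y \<in> Obj A" for x y
    unfolding O.Sp_PM O.linear_PM_iff[OF O.partD(2)[OF part_Neg that]]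
    using inN_linear[OF that] by (simp add: Neg_TC)
  show "inN x z (mul \<N> x y z g h) = mul Nt x y z (inN y z g) (inN x y h)"
    if "x \<in> Obj A" "y \<in> Obj A" "z \<in> Obj A" "g \<in> cs \<N> y z" "h \<in> cs \<N> x y" for x y z g h
    using that by (simp add: O.mul_PM tcomp_inN_inN Neg_TC)
qed (simp add: Incl_TC)

lemmas inP_bhom = bimod_mon_hom_bimod[OF inP_hom]
  and inN_bhom = bimod_mon_hom_bimod[OF inN_hom]

lemma bPt: "bim Pt" and bNt: "bim Nt" by simp_all

text \<open>Built to invert the composition map \<open>ct\<close>: each factor of a tensor is
  replaced by its embedded copy.\<close>

abbreviation "\<kappa> \<equiv> tmap \<P> \<N> Pt Nt inP inN"
abbreviation "ct \<equiv> comp_map R A TC (Pos TC) (Neg TC)"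

lemma \<kappa>_hom: "bimod_hom R A PN (ten Pt Nt) \<kappa>"
  by (rule tens_map_hom[OF bP bN bPt bNt inP_bhom inN_bhom])

lemma \<kappa>_linear: "\<lbrakk>x \<in> Obj A; y \<in> Obj A\<rbrakk> \<Longrightarrow>
    linear_map R (SPN x y) (tsp Pt Nt x y) (\<kappa> x y)"
  using bimod_hom_linear[OF \<kappa>_hom] by simp

lemma ct_linear: "\<lbrakk>x \<in> Obj A; y \<in> Obj A\<rbrakk> \<Longrightarrow>
    linear_map R (tsp Pt Nt x y) (SPN x y) (ct x y)"
  using O.comp_map_linear[OF part_Pos part_Neg] by simp

lemma \<kappa>_pure:
  "\<lbrakk>x \<in> Obj A; y \<in> Obj A; z \<in> Obj A; p \<in> cs \<P> z y; n \<in> cs \<N> x z\<rbrakk> \<Longrightarrow>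
     \<kappa> x y (pPN x y z p n) = pure Pt Nt x y z (inP z y p) (inN x z n)"
  by (rule tens_map_pure[OF bP bN bPt bNt inP_bhom inN_bhom])

lemma ct_\<kappa>: "\<lbrakk>x \<in> Obj A; y \<in> Obj A; s \<in> carrier (SPN x y)\<rbrakk> \<Longrightarrow>
    ct x y (\<kappa> x y s) = s"
  by (rule tens_agree[OF bP bN _ _ mPN linear_map_compose[OF \<kappa>_linear ct_linear] linear_map_id])
    (simp_all add: \<kappa>_pure O.comp_map_pure Pos_TC Neg_TC tcomp_inP_im)

lemma \<kappa>_ct: "\<lbrakk>x \<in> Obj A; y \<in> Obj A; s \<in> carrier (tsp Pt Nt x y)\<rbrakk> \<Longrightarrow>
    \<kappa> x y (ct x y s) = s"
  by (rule tens_agree[OF bPt bNt _ _ tens_module[OF bPt bNt] linear_map_compose[OF ct_linear \<kappa>_linear] linear_map_id])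
    (auto simp: Pos_TC Neg_TC O.comp_map_pure tcomp_inP_im \<kappa>_pure)

lemma ct_bij: "\<lbrakk>x \<in> Obj A; y \<in> Obj A\<rbrakk> \<Longrightarrow>
    bij_betw (ct x y) (carrier (tsp Pt Nt x y)) (carrier (SPN x y))"
  by (rule bij_betw_byWitness[where f' = "\<kappa> x y"])
    (auto simp: \<kappa>_ct ct_\<kappa> linear_map_closed[OF ct_linear] linear_map_closed[OF \<kappa>_linear])

theorem TC_stratified: "stratified R A leq TC"
proof (intro stratified.intro stratified_axioms.intro base_category_axioms TC_category Pos_sub Neg_sub, unfold TC_simps)
  show "linear_functor R A TC (Incl TC)" by (rule O.Incl_functor)
  show "Pos TC x y = {\<zero>\<^bsub>SPN x y\<^esub>}" if "x \<in> Obj A" "y \<in> Obj A" "\<not> leq x y" for x y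
    using upward linear_map_zero[OF mP mPN inP_linear] that by (simp add: Pos_TC strongly_upward_def)
  show "Neg TC x y = {\<zero>\<^bsub>SPN x y\<^esub>}" if "x \<in> Obj A" "y \<in> Obj A" "\<not> leq y x" for x y
    using downward linear_map_zero[OF mN mPN inN_linear] that by (simp add: Neg_TC strongly_downward_def)
  have P_im: "Incl TC x x ` end_set A x = Pos TC x x" if "x \<in> Obj A" for x
    unfolding Pos_TC bij_betw_imp_surj_on[OF bij_P[OF that], symmetric] image_image
    by (rule image_cong) (simp_all add: Incl_TC_inP that)
  \<comment> \<open>Both sides are the image of the endomorphisms of \<open>x\<close> in
    \<open>A\<close>.\<close>
  show "Pos TC x x = Neg TC x x" if x: "x \<in> Obj A" for x
  proof -
    have "Neg TC x x = Incl TC x x ` end_set A x"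
      unfolding Neg_TC bij_betw_imp_surj_on[OF bij_N[OF x], symmetric] image_image
      by (rule image_cong) (simp_all add: Incl_TC x)
    then show ?thesis using P_im[OF x] by simp
  qed
  show "bij_betw (Incl TC x x) (end_set A x) (Pos TC x x)" if x: "x \<in> Obj A" for x
  proof -
    have "inj_on (\<lambda>a. inP x x (Eta \<P> x x a)) (end_set A x)"
      using comp_inj_on[of "Eta \<P> x x" "end_set A x" "inP x x"] bij_P[OF x] inP_inj[OF x x]
      by (simp add: bij_betw_def o_def)
    then have "inj_on (Incl TC x x) (end_set A x)" using x by (auto simp: inj_on_def Incl_TC_inP)
    then show ?thesis using P_im[OF x] by (simp add: bij_betw_def)
  qed
  show "linear_map R (Sp (ten (part_bimod TC (Pos TC)) (part_bimod TC (Neg TC))) x z) (SPN x z) (ct x z) \<and>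
      bij_betw (ct x z) (carrier (Sp (ten (part_bimod TC (Pos TC)) (part_bimod TC (Neg TC))) x z)) (carrier (SPN x z))"
    if "x \<in> Obj A" "z \<in> Obj A" for x z
    using ct_linear[OF that] ct_bij[OF that] by (simp add: O.tens_sp_part)
qed simp

sublocale S: stratified_category R A leq TC
  by (intro stratified_category.intro stratified_category_axioms.intro TC_over TC_stratified)

text \<open>The isomorphism is \<open>(inP, inN)\<close>. Compatibility with the twists is tested
  after the injective map \<open>ct\<close>: one side returns the value of \<open>Tw T\<close>, the
  other composes \<open>inN\<close> of \<open>n\<close> with \<open>inP\<close> of \<open>p\<close>,
  which gives the same by \<open>tcomp_inN_inP\<close>.\<close>

theorem triple_of_twisted_product: "triple_isomorphic R A T (triple_of_strat R A TC)"
proof -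
  have UD: "Up (triple_of_strat R A TC) = Pt" "Down (triple_of_strat R A TC) = Nt"
    by (simp_all add: triple_of_strat_def)
  have "bimod_mon_iso R A \<P> Pt inP"
    by (rule bimod_mon_isoI[OF P O.PM_mon[OF part_Pos] inP_hom]) (simp add: bij_betw_def inP_inj Pos_TC)
  moreover have "bimod_mon_iso R A \<N> Nt inN"
    by (rule bimod_mon_isoI[OF N O.PM_mon[OF part_Neg] inN_hom]) (simp add: bij_betw_def inN_inj Neg_TC)
  moreover have "\<kappa> x y (Tw T x y t) = S.tw x y (tmap \<N> \<P> Nt Pt inN inP x y t)"
    if xy: "x \<in> Obj A" "y \<in> Obj A" and t: "t \<in> carrier (tsp \<N> \<P> x y)" for x y t
  proof -
    have h: "bimod_hom R A NP (ten Nt Pt) (tmap \<N> \<P> Nt Pt inN inP)"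
      by (rule tens_map_hom[OF bN bP bNt bPt inN_bhom inP_bhom])
    note l = bimod_hom_linear[OF h xy, unfolded Sp_tensor] bimod_hom_linear[OF \<tau>_hom xy, unfolded Sp_tensor]
    note c = linear_map_closed[OF l(1) t] linear_map_closed[OF l(2) t]
    have "ct x y (\<kappa> x y (Tw T x y t)) = S.cNP x y (tmap \<N> \<P> Nt Pt inN inP x y t)"
      unfolding ct_\<kappa>[OF xy c(2)]
      by (rule tens_agree[OF bN bP xy mPN[OF xy] l(2) linear_map_compose[OF l(1) S.cNP_linear[OF xy, unfolded TC_simps]] _ t])
        (use xy in \<open>simp add: tens_map_pure[OF bN bP bNt bPt inN_bhom inP_bhom] O.comp_map_pure Pos_TC Neg_TC tcomp_inN_inP exch_def\<close>)
    then show ?thesis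
      using S.cPN_tw[OF xy c(1)] by (intro S.cPN_inj[OF xy linear_map_closed[OF \<kappa>_linear[OF xy] c(2)]]) simp_all
  qed
  ultimately show ?thesis unfolding triple_isomorphic_def UD Sp_tensor by blast
qed

end

section \<open>Isomorphisms\<close>

text \<open>Products \<open>pn\<close> span \<open>Hom C x y\<close> because \<open>cPN\<close> is
  onto. This does for \<open>C\<close> what \<open>tens_agree\<close> does for tensors.\<close>

lemma (in stratified_category) Hom_agree:
  assumes xy: "x \<in> Obj A" "y \<in> Obj A" and Q: "module R Q"
    and f: "linear_map R (Hom C x y) Q f" and g: "linear_map R (Hom C x y) Q g"
    and eq: "\<And>z p n. z \<in> Obj A \<Longrightarrow> p \<in> Pos C z y \<Longrightarrow> n \<in> Neg C x z \<Longrightarrow> f (Comp C x z y p n) = g (Comp C x z y p n)"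
    and h: "h \<in> carrier (Hom C x y)"
  shows "f h = g h"
proof -
  obtain s where s: "s \<in> carrier (tsp Pc Nc x y)" "h = cPN x y s"
    using cPN_bij[OF xy] h by (auto simp: bij_betw_def)
  have "f (cPN x y s) = g (cPN x y s)"
    by (rule tens_agree[OF E.bP E.bN xy Q linear_map_compose[OF cPN_linear[OF xy] f]
        linear_map_compose[OF cPN_linear[OF xy] g] _ s(1)])
      (use xy in \<open>simp add: cPN_pure eq\<close>)
  then show ?thesis by (simp add: s)
qed

context base_category begin

lemma stratified_categoryI:
  assumes "stratified R A leq C"
  shows "stratified_category R A leq C"
  by (intro stratified_category.intro stratified_category_axioms.intro over_category.intro over_category_axioms.intro
      base_category_axioms assms stratified.axioms(2)[OF assms] stratified.Obj_eq[OF assms] stratified.Incl_functor[OF assms])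

lemma twistedI:
  assumes "twisted_triple R A leq T"
  shows "twisted R A leq T"
proof -
  have "bimod_monoid R A (Up T)" "bimod_monoid R A (Down T)"
    "bimod_hom R A (ten (Down T) (Up T)) (ten (Up T) (Down T)) (Tw T)"
    using assms by (auto simp: twisted_triple_def strongly_upward_def strongly_downward_def twist_def Let_def)
  then show ?thesis
    by (intro twisted.intro twisted_axioms.intro exchange.intro exchange_axioms.intro monoid_pair.intro
        monoid_pair_axioms.intro base_category_axioms assms)
qed

text \<open>\<open>triple_isomorphic\<close> without the inverses, so that a map of triples can be
  passed to the categories one direction at a time.\<close>

definition triple_hom ::
  "('o, 'k, 'a, 'p, 'n) triple \<Rightarrow> ('o, 'k, 'a, 'p', 'n') triple \<Rightarrow>
   ('o \<Rightarrow> 'o \<Rightarrow> 'p \<Rightarrow> 'p') \<Rightarrow> ('o \<Rightarrow> 'o \<Rightarrow> 'n \<Rightarrow> 'n') \<Rightarrow> bool" where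
  "triple_hom T T' f g \<longleftrightarrow>
     bimod_mon_hom R A (Up T) (Up T') f \<and> bimod_mon_hom R A (Down T) (Down T') g \<and>
     (\<forall>x\<in>Obj A. \<forall>y\<in>Obj A. \<forall>t\<in>carrier (tsp (Down T) (Up T) x y).
        tmap (Up T) (Down T) (Up T') (Down T') f g x y (Tw T x y t) =
        Tw T' x y (tmap (Down T) (Up T) (Down T') (Up T') g f x y t))"

text \<open>Stated on carriers, since functions are unconstrained outside them.\<close>

definition inverse_on ::
  "('o \<Rightarrow> 'o \<Rightarrow> 'm set) \<Rightarrow> ('o \<Rightarrow> 'o \<Rightarrow> 'm' set) \<Rightarrow> ('o \<Rightarrow> 'o \<Rightarrow> 'm \<Rightarrow> 'm') \<Rightarrow> ('o \<Rightarrow> 'o \<Rightarrow> 'm' \<Rightarrow> 'm) \<Rightarrow> bool" where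
  "inverse_on M M' f f' \<longleftrightarrow>
     (\<forall>x\<in>Obj A. \<forall>y\<in>Obj A. (\<forall>m\<in>M x y. f' x y (f x y m) = m) \<and> (\<forall>m\<in>M' x y. f x y (f' x y m) = m))"

lemma bimod_mon_iso_iff:
  "bimod_mon_iso R A D E f \<longleftrightarrow>
     bimod_mon_hom R A D E f \<and> (\<exists>g. bimod_mon_hom R A E D g \<and> inverse_on (cs D) (cs E) f g)"
  by (simp add: bimod_mon_iso_def inverse_on_def)

lemma triple_isomorphicI:
  "\<lbrakk>triple_hom T T' f g; bimod_mon_hom R A (Up T') (Up T) f'; bimod_mon_hom R A (Down T') (Down T) g'; inverse_on (cs (Up T)) (cs (Up T')) f f'; inverse_on (cs (Down T)) (cs (Down T')) g g'\<rbrakk> \<Longrightarrow>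
     triple_isomorphic R A T T'"
  unfolding triple_isomorphic_def bimod_mon_iso_iff triple_hom_def Sp_tensor by blast

text \<open>\<open>triple_isomorphic\<close> asks compatibility with the twists of \<open>f\<close>
  and \<open>g\<close> alone. The inverses inherit it: write \<open>t\<close> as the image of its
  preimage, use compatibility there, and apply \<open>f' \<otimes> g'\<close>.\<close>

lemma triple_isomorphicE:
  assumes T: "twisted_triple R A leq T" and T': "twisted_triple R A leq T'" and iso: "triple_isomorphic R A T T'"
  obtains f g f' g' where "triple_hom T T' f g" "triple_hom T' T f' g'"
    "inverse_on (cs (Up T)) (cs (Up T')) f f'" "inverse_on (cs (Down T)) (cs (Down T')) g g'"
proof -
  interpret X: twisted R A leq T by (rule twistedI[OF T])
  interpret Y: twisted R A leq T' by (rule twistedI[OF T'])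
  obtain f g f' g' where h: "triple_hom T T' f g"
    and h': "bimod_mon_hom R A (Up T') (Up T) f'" "bimod_mon_hom R A (Down T') (Down T) g'"
    and inv: "inverse_on (cs (Up T)) (cs (Up T')) f f'" "inverse_on (cs (Down T)) (cs (Down T')) g g'"
    using iso unfolding triple_isomorphic_def bimod_mon_iso_iff triple_hom_def Sp_tensor by blast
  note b = bimod_mon_hom_bimod[OF h[unfolded triple_hom_def, THEN conjunct1]]
    bimod_mon_hom_bimod[OF h[unfolded triple_hom_def, THEN conjunct2, THEN conjunct1]]
    bimod_mon_hom_bimod[OF h'(1)] bimod_mon_hom_bimod[OF h'(2)]
  have "triple_hom T' T f' g'" unfolding triple_hom_def
  proof (intro conjI ballI h')
    fix x y t assume xy: "x \<in> Obj A" "y \<in> Obj A" and t: "t \<in> carrier (tsp (Down T') (Up T') x y)"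
    let ?u = "tmap (Down T') (Up T') (Down T) (Up T) g' f' x y t"
    have u: "?u \<in> carrier (tsp (Down T) (Up T) x y)"
      using bimod_hom_closed[OF tens_map_hom[OF Y.bN Y.bP X.bN X.bP b(4,3)] xy, unfolded Sp_tensor, OF t] .
    have 1: "tmap (Down T) (Up T) (Down T') (Up T') g f x y ?u = t"
      unfolding tens_map_compose[OF Y.bN Y.bP X.bN X.bP Y.bN Y.bP b(4,3,2,1) xy t]
      by (rule tens_map_ident[OF Y.bN Y.bP bimod_hom_compose[OF b(4,2)] bimod_hom_compose[OF b(3,1)] _ _ xy t])
        (use inv in \<open>auto simp: inverse_on_def\<close>)
    have tu: "Tw T x y ?u \<in> carrier (X.SPN x y)"
      using bimod_hom_closed[OF X.\<tau>_hom xy, unfolded Sp_tensor, OF u] .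
    have 2: "Tw T' x y t = tmap (Up T) (Down T) (Up T') (Down T') f g x y (Tw T x y ?u)"
      using h[unfolded triple_hom_def, THEN conjunct2, THEN conjunct2, rule_format, OF xy u] 1 by simp
    show "tmap (Up T') (Down T') (Up T) (Down T) f' g' x y (Tw T' x y t) = Tw T x y ?u"
      unfolding 2 tens_map_compose[OF X.bP X.bN Y.bP Y.bN X.bP X.bN b xy tu]
      by (rule tens_map_ident[OF X.bP X.bN bimod_hom_compose[OF b(1,3)] bimod_hom_compose[OF b(2,4)] _ _ xy tu])
        (use inv in \<open>auto simp: inverse_on_def\<close>)
  qed
  then show thesis using that h inv by blast
qed

lemma triple_isomorphic_sym:
  assumes T: "twisted_triple R A leq T" and T': "twisted_triple R A leq T'" and iso: "triple_isomorphic R A T T'"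
  shows "triple_isomorphic R A T' T"
proof -
  obtain f g f' g' where h: "triple_hom T T' f g" "triple_hom T' T f' g'"
    "inverse_on (cs (Up T)) (cs (Up T')) f f'" "inverse_on (cs (Down T)) (cs (Down T')) g g'"
    by (rule triple_isomorphicE[OF assms])
  show ?thesis
    by (rule triple_isomorphicI[OF h(2), of f g]) (use h in \<open>auto simp: triple_hom_def inverse_on_def\<close>)
qed

lemma triple_isomorphic_trans:
  assumes T: "twisted_triple R A leq T" and T': "twisted_triple R A leq T'" and T'': "twisted_triple R A leq T''"
    and iso: "triple_isomorphic R A T T'" and iso': "triple_isomorphic R A T' T''"
  shows "triple_isomorphic R A T T''"
proof -
  interpret X: twisted R A leq T by (rule twistedI[OF T])
  interpret Y: twisted R A leq T' by (rule twistedI[OF T'])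
  interpret Z: twisted R A leq T'' by (rule twistedI[OF T''])
  obtain f g where fg: "bimod_mon_iso R A (Up T) (Up T') f" "bimod_mon_iso R A (Down T) (Down T') g"
    and c: "\<And>x y t. x \<in> Obj A \<Longrightarrow> y \<in> Obj A \<Longrightarrow> t \<in> carrier (tsp (Down T) (Up T) x y) \<Longrightarrow>
        tmap (Up T) (Down T) (Up T') (Down T') f g x y (Tw T x y t) =
        Tw T' x y (tmap (Down T) (Up T) (Down T') (Up T') g f x y t)"
    using iso unfolding triple_isomorphic_def Sp_tensor by blast
  obtain f' g' where fg': "bimod_mon_iso R A (Up T') (Up T'') f'" "bimod_mon_iso R A (Down T') (Down T'') g'"
    and c': "\<And>x y t. x \<in> Obj A \<Longrightarrow> y \<in> Obj A \<Longrightarrow> t \<in> carrier (tsp (Down T') (Up T') x y) \<Longrightarrow>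
        tmap (Up T') (Down T') (Up T'') (Down T'') f' g' x y (Tw T' x y t) =
        Tw T'' x y (tmap (Down T') (Up T') (Down T'') (Up T'') g' f' x y t)"
    using iso' unfolding triple_isomorphic_def Sp_tensor by blast
  have b: "bimod_hom R A (Up T) (Up T') f" "bimod_hom R A (Down T) (Down T') g"
    "bimod_hom R A (Up T') (Up T'') f'" "bimod_hom R A (Down T') (Down T'') g'"
    using fg fg' by (auto simp: bimod_mon_iso_def bimod_mon_hom_def)
  show ?thesis unfolding triple_isomorphic_def Sp_tensor
  proof (intro exI conjI ballI)
    show "bimod_mon_iso R A (Up T) (Up T'') (\<lambda>x y m. f' x y (f x y m))"
      by (rule bimod_mon_iso_trans[OF X.P Y.P Z.P fg(1) fg'(1)])
    show "bimod_mon_iso R A (Down T) (Down T'') (\<lambda>x y m. g' x y (g x y m))"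
      by (rule bimod_mon_iso_trans[OF X.N Y.N Z.N fg(2) fg'(2)])
    fix x y t assume xy: "x \<in> Obj A" "y \<in> Obj A" and t: "t \<in> carrier (tsp (Down T) (Up T) x y)"
    have t': "Tw T x y t \<in> carrier (X.SPN x y)"
      using bimod_hom_closed[OF X.\<tau>_hom xy, unfolded Sp_tensor, OF t] .
    have u: "tmap (Down T) (Up T) (Down T') (Up T') g f x y t \<in> carrier (tsp (Down T') (Up T') x y)"
      using bimod_hom_closed[OF tens_map_hom[OF X.bN X.bP Y.bN Y.bP b(2,1)] xy, unfolded Sp_tensor, OF t] .
    show "tmap (Up T) (Down T) (Up T'') (Down T'') (\<lambda>x y m. f' x y (f x y m)) (\<lambda>x y m. g' x y (g x y m)) x y (Tw T x y t) =
      Tw T'' x y (tmap (Down T) (Up T) (Down T'') (Up T'') (\<lambda>x y m. g' x y (g x y m)) (\<lambda>x y m. f' x y (f x y m)) x y t)"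
      using tens_map_compose[OF X.bP X.bN Y.bP Y.bN Z.bP Z.bN b xy t']
        tens_map_compose[OF X.bN X.bP Y.bN Y.bP Z.bN Z.bP b(2,1,4,3) xy t] c[OF xy t] c'[OF xy u] by simp
  qed
qed

section \<open>Morphisms of stratified categories and morphisms of their triples\<close>

text \<open>A functor commutes with both composition maps, \<open>cPN\<close> and
  \<open>cNP\<close>. Since the twist is \<open>cNP\<close> followed by the inverse of
  \<open>cPN\<close>, it is respected too, by injectivity of \<open>cPN\<close> in
  \<open>D\<close>.\<close>

lemma strat_hom_triple_hom:
  assumes C: "stratified R A leq C" and D: "stratified R A leq D" and F: "strat_hom R A C D F"
  shows "triple_hom (triple_of_strat R A C) (triple_of_strat R A D) F F"
proof -
  interpret X: stratified_category R A leq C by (rule stratified_categoryI[OF C])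
  interpret Y: stratified_category R A leq D by (rule stratified_categoryI[OF D])
  have UD: "Up (triple_of_strat R A C) = X.Pc" "Down (triple_of_strat R A C) = X.Nc"
    "Up (triple_of_strat R A D) = Y.Pc" "Down (triple_of_strat R A D) = Y.Nc"
    by (simp_all add: triple_of_strat_def)
  have lin: "linear_map R (Hom C x y) (Hom D x y) (F x y)" if "x \<in> Obj A" "y \<in> Obj A" for x y
    using F that by (simp add: strat_hom_def linear_functor_def X.Obj_C)
  have comp: "F x z (Comp C x y z g f) = Comp D x y z (F y z g) (F x y f)"
    if "x \<in> Obj A" "y \<in> Obj A" "z \<in> Obj A" "g \<in> carrier (Hom C y z)" "f \<in> carrier (Hom C x y)" for x y z g f
    using F that by (simp add: strat_hom_def linear_functor_def X.Obj_C)
  have incl: "F x y (Incl C x y a) = Incl D x y a" if "x \<in> Obj A" "y \<in> Obj A" "a \<in> carrier (Hom A x y)" for x y a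
    using F that by (simp add: strat_hom_def)
  have hom: "bimod_mon_hom R A (X.PM S) (Y.PM S') F" if S: "X.part S" and S': "Y.part S'"
    and im: "\<And>x y. x \<in> Obj A \<Longrightarrow> y \<in> Obj A \<Longrightarrow> F x y ` S x y \<subseteq> S' x y" for S S'
  proof (rule bimod_mon_homI[OF X.PM_mon[OF S] Y.PM_mon[OF S']])
    fix x y assume xy: "x \<in> Obj A" "y \<in> Obj A"
    show "linear_map R (Sp (X.PM S) x y) (Sp (Y.PM S') x y) (F x y)"
      unfolding X.Sp_PM Y.Sp_PM Y.linear_PM_iff[OF Y.partD(2)[OF S' xy]]
      using X.linear_from_PM[OF lin[OF xy] X.partD(2)[OF S xy]] im[OF xy] by simp
    show "F x z (mul (X.PM S) x y z g h) = mul (Y.PM S') x y z (F y z g) (F x y h)"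
      if z: "z \<in> Obj A" and g: "g \<in> cs (X.PM S) y z" and h: "h \<in> cs (X.PM S) x y" for z g h
    proof -
      have "F y z g \<in> S' y z" "F x y h \<in> S' x y" using im xy z g h by auto
      then show ?thesis using xy z g h X.partD(3)[OF S]
        by (simp add: X.mul_PM[OF S] Y.mul_PM[OF S'] comp)
    qed
  qed (simp add: incl)
  have im: "F x y ` Pos C x y \<subseteq> Pos D x y" "F x y ` Neg C x y \<subseteq> Neg D x y" if "x \<in> Obj A" "y \<in> Obj A" for x y
    using F that by (simp_all add: strat_hom_def)
  have hP: "bimod_mon_hom R A X.Pc Y.Pc F" by (rule hom[OF X.part_Pos Y.part_Pos]) (rule im(1))
  have hN: "bimod_mon_hom R A X.Nc Y.Nc F" by (rule hom[OF X.part_Neg Y.part_Neg]) (rule im(2))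
  note bP = bimod_mon_hom_bimod[OF hP] and bN = bimod_mon_hom_bimod[OF hN]
  have im': "F x y p \<in> Pos D x y" if "x \<in> Obj A" "y \<in> Obj A" "p \<in> Pos C x y" for x y p using im that by blast
  have im'': "F x y p \<in> Neg D x y" if "x \<in> Obj A" "y \<in> Obj A" "p \<in> Neg C x y" for x y p using im that by blast
  show ?thesis unfolding triple_hom_def UD
  proof (intro conjI ballI hP hN)
    fix x y t assume xy: "x \<in> Obj A" "y \<in> Obj A" and t: "t \<in> carrier (tsp X.Nc X.Pc x y)"
    note m = tens_map_hom[OF X.E.bP X.E.bN Y.E.bP Y.E.bN bP bN] tens_map_hom[OF X.E.bN X.E.bP Y.E.bN Y.E.bP bN bP]
    note ml = bimod_hom_linear[OF m(1) xy, unfolded Sp_tensor] bimod_hom_linear[OF m(2) xy, unfolded Sp_tensor]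
    note mc = linear_map_closed[OF ml(1) X.cPN_tw(1)[OF xy t]] linear_map_closed[OF ml(2) t]
    have 1: "Y.cPN x y (tmap X.Pc X.Nc Y.Pc Y.Nc F F x y s) = F x y (X.cPN x y s)"
      if s: "s \<in> carrier (tsp X.Pc X.Nc x y)" for s
      by (rule tens_agree[OF X.E.bP X.E.bN xy Y.HomC[OF xy] linear_map_compose[OF ml(1) Y.cPN_linear[OF xy]]
            linear_map_compose[OF X.cPN_linear[OF xy] lin[OF xy]] _ s])
        (use xy in \<open>simp add: tens_map_pure[OF X.E.bP X.E.bN Y.E.bP Y.E.bN bP bN] X.cPN_pure Y.cPN_pure im' im'' comp X.PosD X.NegD\<close>)
    have 2: "Y.cNP x y (tmap X.Nc X.Pc Y.Nc Y.Pc F F x y t) = F x y (X.cNP x y t)"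
      by (rule tens_agree[OF X.E.bN X.E.bP xy Y.HomC[OF xy] linear_map_compose[OF ml(2) Y.cNP_linear[OF xy]]
            linear_map_compose[OF X.cNP_linear[OF xy] lin[OF xy]] _ t])
        (use xy in \<open>simp add: tens_map_pure[OF X.E.bN X.E.bP Y.E.bN Y.E.bP bN bP] X.cNP_pure Y.cNP_pure im' im'' comp X.PosD X.NegD\<close>)
    show "tmap X.Pc X.Nc Y.Pc Y.Nc F F x y (X.tw x y t) = Y.tw x y (tmap X.Nc X.Pc Y.Nc Y.Pc F F x y t)"
      by (rule Y.cPN_inj[OF xy mc(1) Y.cPN_tw(1)[OF xy mc(2)]])
        (simp add: 1[OF X.cPN_tw(1)[OF xy t]] 2 X.cPN_tw(2)[OF xy t] Y.cPN_tw(2)[OF xy mc(2)])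
  qed
qed

lemma strat_isomorphic_triple:
  assumes C: "stratified R A leq C" and D: "stratified R A leq D" and iso: "strat_isomorphic R A C D"
  shows "triple_isomorphic R A (triple_of_strat R A C) (triple_of_strat R A D)"
proof -
  interpret X: stratified_category R A leq C by (rule stratified_categoryI[OF C])
  interpret Y: stratified_category R A leq D by (rule stratified_categoryI[OF D])
  obtain F G where F: "strat_hom R A C D F" and G: "strat_hom R A D C G"
    and inv: "inverse_on (\<lambda>x y. carrier (Hom C x y)) (\<lambda>x y. carrier (Hom D x y)) F G"
    using iso unfolding strat_isomorphic_def inverse_on_def by blast
  note FG = strat_hom_triple_hom[OF C D F] strat_hom_triple_hom[OF D C G]
  show ?thesis
    by (rule triple_isomorphicI[OF FG(1)])
      (use FG(2) inv X.PosD(3) Y.PosD(3) X.NegD(3) Y.NegD(3) in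
        \<open>auto simp: triple_hom_def inverse_on_def triple_of_strat_def\<close>)
qed

text \<open>The values on products \<open>pn\<close> are kept in the conclusion because they
  determine \<open>F\<close> and so allow inverses to be checked. Multiplicativity is obtained for
  one factor at a time: \<open>p\<close> from the left, \<open>n\<close> from the right,
  \<open>n\<close> from the left, and then an arbitrary morphism, a sum of products
  \<open>pn\<close>.\<close>

lemma triple_hom_strat_hom:
  assumes C: "stratified R A leq C" and D: "stratified R A leq D"
    and fg: "triple_hom (triple_of_strat R A C) (triple_of_strat R A D) f g"
  obtains F where "strat_hom R A C D F"
    "\<And>x y z p n. x \<in> Obj A \<Longrightarrow> y \<in> Obj A \<Longrightarrow> z \<in> Obj A \<Longrightarrow> p \<in> Pos C y z \<Longrightarrow> n \<in> Neg C x y \<Longrightarrow>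
      F x z (Comp C x y z p n) = Comp D x y z (f y z p) (g x y n)"
proof -
  interpret X: stratified_category R A leq C by (rule stratified_categoryI[OF C])
  interpret Y: stratified_category R A leq D by (rule stratified_categoryI[OF D])
  have UD: "Up (triple_of_strat R A C) = X.Pc" "Down (triple_of_strat R A C) = X.Nc"
    "Up (triple_of_strat R A D) = Y.Pc" "Down (triple_of_strat R A D) = Y.Nc"
    by (simp_all add: triple_of_strat_def)
  have hP: "bimod_mon_hom R A X.Pc Y.Pc f" and hN: "bimod_mon_hom R A X.Nc Y.Nc g"
    and ex: "\<And>x y t. x \<in> Obj A \<Longrightarrow> y \<in> Obj A \<Longrightarrow> t \<in> carrier (tsp X.Nc X.Pc x y) \<Longrightarrow>
      tmap X.Pc X.Nc Y.Pc Y.Nc f g x y (X.tw x y t) = Y.tw x y (tmap X.Nc X.Pc Y.Nc Y.Pc g f x y t)"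
    using fg by (auto simp: triple_hom_def UD)
  note bP = bimod_mon_hom_bimod[OF hP] and bN = bimod_mon_hom_bimod[OF hN]
  note m = tens_map_hom[OF X.E.bP X.E.bN Y.E.bP Y.E.bN bP bN] tens_map_hom[OF X.E.bN X.E.bP Y.E.bN Y.E.bP bN bP]
  have ml: "linear_map R (tsp X.Pc X.Nc x y) (tsp Y.Pc Y.Nc x y) (tmap X.Pc X.Nc Y.Pc Y.Nc f g x y)"
      "linear_map R (tsp X.Nc X.Pc x y) (tsp Y.Nc Y.Pc x y) (tmap X.Nc X.Pc Y.Nc Y.Pc g f x y)"
    if "x \<in> Obj A" "y \<in> Obj A" for x y
    using bimod_hom_linear[OF m(1) that] bimod_hom_linear[OF m(2) that] by simp_all
  note homP = bimod_mon_homD[OF X.E.P Y.E.P hP] and homN = bimod_mon_homD[OF X.E.N Y.E.N hN]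
  have fc: "f x y p \<in> Pos D x y" if "x \<in> Obj A" "y \<in> Obj A" "p \<in> Pos C x y" for x y p
    using linear_map_closed[OF homP(1)] that by simp
  have gc: "g x y n \<in> Neg D x y" if "x \<in> Obj A" "y \<in> Obj A" "n \<in> Neg C x y" for x y n
    using linear_map_closed[OF homN(1)] that by simp
  have fmul: "f x z (Comp C x y z p p') = Comp D x y z (f y z p) (f x y p')"
    if "x \<in> Obj A" "y \<in> Obj A" "z \<in> Obj A" "p \<in> Pos C y z" "p' \<in> Pos C x y" for x y z p p'
    using homP(4)[OF that(1-3), of p p'] that fc by (simp add: X.mul_PM Y.mul_PM)
  have gmul: "g x z (Comp C x y z n n') = Comp D x y z (g y z n) (g x y n')"
    if "x \<in> Obj A" "y \<in> Obj A" "z \<in> Obj A" "n \<in> Neg C y z" "n' \<in> Neg C x y" for x y z n n'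
    using homN(4)[OF that(1-3), of n n'] that gc by (simp add: X.mul_PM Y.mul_PM)
  have fId: "f x x (Id C x) = Id D x" and gId: "g x x (Id C x) = Id D x" if "x \<in> Obj A" for x
    using homP(3)[OF that that] homN(3)[OF that that] that by (simp_all add: X.un_PM Y.un_PM)
  \<comment> \<open>The conjugate of \<open>f \<otimes> g\<close> by the two composition
    isomorphisms.\<close>
  define F where "F x y h = Y.cPN x y (tmap X.Pc X.Nc Y.Pc Y.Nc f g x y
    (inv_into (carrier (tsp X.Pc X.Nc x y)) (X.cPN x y) h))" for x y h
  have F_lin: "linear_map R (Hom C x y) (Hom D x y) (F x y)" if xy: "x \<in> Obj A" "y \<in> Obj A" for x y
    unfolding F_def
    by (rule linear_map_compose[OF linear_map_compose[OF linear_map_the_inv[OF X.E.mPN[OF xy] X.cPN_linear[OF xy] X.cPN_bij[OF xy]]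
          ml(1)[OF xy]] Y.cPN_linear[OF xy]])
  have F_cPN: "F x y (X.cPN x y s) = Y.cPN x y (tmap X.Pc X.Nc Y.Pc Y.Nc f g x y s)"
    if "x \<in> Obj A" "y \<in> Obj A" "s \<in> carrier (tsp X.Pc X.Nc x y)" for x y s
    using X.cPN_bij[OF that(1,2)] that(3) by (simp add: F_def bij_betw_def)
  have F_PN: "F x z (Comp C x y z p n) = Comp D x y z (f y z p) (g x y n)"
    if "x \<in> Obj A" "y \<in> Obj A" "z \<in> Obj A" "p \<in> Pos C y z" "n \<in> Neg C x y" for x y z p n
    using F_cPN[OF that(1,3), of "pure X.Pc X.Nc x z y p n"] that
    by (simp add: X.cPN_pure tens_map_pure[OF X.E.bP X.E.bN Y.E.bP Y.E.bN bP bN] Y.cPN_pure fc gc)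
  \<comment> \<open>The composite \<open>np\<close> is also \<open>cPN\<close> of the twist of
    \<open>n \<otimes> p\<close>, so compatibility with the twists computes its image.\<close>
  have F_NP: "F x z (Comp C x y z n p) = Comp D x y z (g y z n) (f x y p)"
    if o: "x \<in> Obj A" "y \<in> Obj A" "z \<in> Obj A" and n: "n \<in> Neg C y z" and p: "p \<in> Pos C x y" for x y z p n
  proof -
    let ?t = "pure X.Nc X.Pc x z y n p"
    have t: "?t \<in> carrier (tsp X.Nc X.Pc x z)" using o n p by simp
    note u = linear_map_closed[OF ml(2)[OF o(1,3)] t]
    have "F x z (X.cNP x z ?t) = Y.cNP x z (tmap X.Nc X.Pc Y.Nc Y.Pc g f x z ?t)"
      using F_cPN[OF o(1,3) X.cPN_tw(1)[OF o(1,3) t]] ex[OF o(1,3) t]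
      by (simp add: X.cPN_tw(2)[OF o(1,3) t] Y.cPN_tw(2)[OF o(1,3) u])
    then show ?thesis using o n p
      by (simp add: X.cNP_pure tens_map_pure[OF X.E.bN X.E.bP Y.E.bN Y.E.bP bN bP] Y.cNP_pure fc gc)
  qed
  \<comment> \<open>Here \<open>p\<close> is its own product with an identity, which lies in
    \<open>Neg C\<close> and is preserved by \<open>g\<close>.\<close>
  have F_P: "F x y p = f x y p" if "x \<in> Obj A" "y \<in> Obj A" "p \<in> Pos C x y" for x y p
    using F_PN[of x x y p "Id C x"] that fc[OF that]
    by (simp add: X.NegD X.PosD Y.PosD X.C_Id_right Y.C_Id_right gId)
  have F_N: "F x y n = g x y n" if "x \<in> Obj A" "y \<in> Obj A" "n \<in> Neg C x y" for x y n
    using F_PN[of x y y "Id C y" n] that gc[OF that]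
    by (simp add: X.NegD X.PosD Y.NegD X.C_Id_left Y.C_Id_left fId)
  note XP = X.PosD(3) and XN = X.NegD(3) and YP = Y.PosD(3)[OF _ _ fc] and YN = Y.NegD(3)[OF _ _ gc]
  have F_left_P: "F x z (Comp C x y z p h) = Comp D x y z (f y z p) (F x y h)"
    if o: "x \<in> Obj A" "y \<in> Obj A" "z \<in> Obj A" and p: "p \<in> Pos C y z" and h: "h \<in> carrier (Hom C x y)" for x y z p h
    by (rule X.Hom_agree[OF o(1,2) Y.HomC[OF o(1,3)] linear_map_compose[OF X.C_right[OF o XP[OF o(2,3) p]] F_lin[OF o(1,3)]]
          linear_map_compose[OF F_lin[OF o(1,2)] Y.C_right[OF o YP[OF o(2,3) o(2,3) p]]] _ h])
      (use o p in \<open>simp add: F_PN XP XN YP YN X.PosD(5) fmul Y.C_assoc flip: X.C_assoc\<close>)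
  have F_right_N: "F x z (Comp C x y z h n) = Comp D x y z (F y z h) (g x y n)"
    if o: "x \<in> Obj A" "y \<in> Obj A" "z \<in> Obj A" and n: "n \<in> Neg C x y" and h: "h \<in> carrier (Hom C y z)" for x y z n h
    by (rule X.Hom_agree[OF o(2,3) Y.HomC[OF o(1,3)] linear_map_compose[OF X.C_left[OF o XN[OF o(1,2) n]] F_lin[OF o(1,3)]]
          linear_map_compose[OF F_lin[OF o(2,3)] Y.C_left[OF o YN[OF o(1,2) o(1,2) n]]] _ h])
      (use o n in \<open>simp add: F_PN XP XN YP YN X.NegD(5) gmul Y.C_assoc X.C_assoc\<close>)
  \<comment> \<open>On \<open>h = pn'\<close> this is \<open>F_NP\<close> for \<open>np\<close>
    followed by right multiplication by \<open>n'\<close>.\<close>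
  have F_left_N: "F x z (Comp C x y z n h) = Comp D x y z (g y z n) (F x y h)"
    if o: "x \<in> Obj A" "y \<in> Obj A" "z \<in> Obj A" and n: "n \<in> Neg C y z" and h: "h \<in> carrier (Hom C x y)" for x y z n h
  proof (rule X.Hom_agree[OF o(1,2) Y.HomC[OF o(1,3)] linear_map_compose[OF X.C_right[OF o XN[OF o(2,3) n]] F_lin[OF o(1,3)]]
          linear_map_compose[OF F_lin[OF o(1,2)] Y.C_right[OF o YN[OF o(2,3) o(2,3) n]]] _ h])
    fix w p n' assume w: "w \<in> Obj A" and p: "p \<in> Pos C w y" and n': "n' \<in> Neg C x w"
    have "F x z (Comp C x y z n (Comp C x w y p n')) = F x z (Comp C x w z (Comp C w y z n p) n')"
      using o w n p n' by (simp add: X.C_assoc XP XN)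
    also have "\<dots> = Comp D x w z (Comp D w y z (g y z n) (f w y p)) (g x w n')"
      using o w n p n' by (simp add: F_right_N X.C_closed XP XN F_NP)
    also have "\<dots> = Comp D x y z (g y z n) (F x y (Comp C x w y p n'))"
      using o w n p n' by (simp add: F_PN Y.C_assoc YP YN)
    finally show "F x z (Comp C x y z n (Comp C x w y p n')) = Comp D x y z (g y z n) (F x y (Comp C x w y p n'))" .
  qed
  \<comment> \<open>With \<open>k = pn\<close>, the image of \<open>pnh\<close> is
    \<open>f(p)\<close> times the image of \<open>nh\<close>, which is \<open>g(n)\<close> times the
    image of \<open>h\<close>.\<close>
  have F_comp: "F x z (Comp C x y z k h) = Comp D x y z (F y z k) (F x y h)"
    if o: "x \<in> Obj A" "y \<in> Obj A" "z \<in> Obj A" and k: "k \<in> carrier (Hom C y z)" and h: "h \<in> carrier (Hom C x y)" for x y z k h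
    by (rule X.Hom_agree[OF o(2,3) Y.HomC[OF o(1,3)] linear_map_compose[OF X.C_left[OF o h] F_lin[OF o(1,3)]]
          linear_map_compose[OF F_lin[OF o(2,3)] Y.C_left[OF o linear_map_closed[OF F_lin[OF o(1,2)] h]]] _ k])
      (use o h in \<open>simp add: X.C_assoc XP XN X.C_closed F_left_P F_left_N F_N Y.C_assoc YP YN linear_map_closed[OF F_lin]\<close>)
  have F_Incl: "F x y (Incl C x y a) = Incl D x y a" if xy: "x \<in> Obj A" "y \<in> Obj A" and a: "a \<in> carrier (Hom A x y)" for x y a
  proof (cases "x = y")
    case True
    then show ?thesis using homP(2)[OF xy, of a] F_P[OF xy, of "Incl C x y a"] xy a X.PosD(6) by simp
  next
    case False
    then show ?thesis
      using Hom_offdiag_linear[OF xy False Y.HomC[OF xy] linear_map_compose[OF X.Incl_linear[OF xy] F_lin[OF xy]] a]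
        Hom_offdiag_linear[OF xy False Y.HomC[OF xy] Y.Incl_linear[OF xy] a] by simp
  qed
  have "strat_hom R A C D F"
    unfolding strat_hom_def linear_functor_def X.Obj_C Y.Obj_C
    using F_lin F_comp F_Incl F_P[OF _ _ X.PosD(4)] fId F_P F_N fc gc by auto
  then show thesis using F_PN by (rule that)
qed

text \<open>The functors extending a pair and its inverse, composed in either order, fix every
  product \<open>pn\<close>, hence everything by \<open>Hom_agree\<close>.\<close>

lemma triple_isomorphic_strat:
  assumes C: "stratified R A leq C" and D: "stratified R A leq D"
    and iso: "triple_isomorphic R A (triple_of_strat R A C) (triple_of_strat R A D)"
  shows "strat_isomorphic R A C D"
proof -
  interpret X: stratified_category R A leq C by (rule stratified_categoryI[OF C])
  interpret Y: stratified_category R A leq D by (rule stratified_categoryI[OF D])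
  obtain f g f' g' where h: "triple_hom (triple_of_strat R A C) (triple_of_strat R A D) f g"
    "triple_hom (triple_of_strat R A D) (triple_of_strat R A C) f' g'"
    and inv: "inverse_on (Pos C) (Pos D) f f'" "inverse_on (Neg C) (Neg D) g g'"
    using triple_isomorphicE[OF X.triple_of_strat_twisted Y.triple_of_strat_twisted iso]
    by (simp add: triple_of_strat_def) blast
  obtain F where F: "strat_hom R A C D F" "\<And>x y z p n. x \<in> Obj A \<Longrightarrow> y \<in> Obj A \<Longrightarrow> z \<in> Obj A \<Longrightarrow> p \<in> Pos C y z \<Longrightarrow> n \<in> Neg C x y \<Longrightarrow>
      F x z (Comp C x y z p n) = Comp D x y z (f y z p) (g x y n)"
    using triple_hom_strat_hom[OF C D h(1)] by blast
  obtain G where G: "strat_hom R A D C G" "\<And>x y z p n. x \<in> Obj A \<Longrightarrow> y \<in> Obj A \<Longrightarrow> z \<in> Obj A \<Longrightarrow> p \<in> Pos D y z \<Longrightarrow> n \<in> Neg D x y \<Longrightarrow>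
      G x z (Comp D x y z p n) = Comp C x y z (f' y z p) (g' x y n)"
    using triple_hom_strat_hom[OF D C h(2)] by blast
  have c: "f x y p \<in> Pos D x y" if "x \<in> Obj A" "y \<in> Obj A" "p \<in> Pos C x y" for x y p
    using h(1) bimod_hom_closed[OF bimod_mon_hom_bimod, of X.Pc Y.Pc f x y p] that by (simp add: triple_hom_def triple_of_strat_def)
  have c': "g x y p \<in> Neg D x y" if "x \<in> Obj A" "y \<in> Obj A" "p \<in> Neg C x y" for x y p
    using h(1) bimod_hom_closed[OF bimod_mon_hom_bimod, of X.Nc Y.Nc g x y p] that by (simp add: triple_hom_def triple_of_strat_def)
  have d: "f' x y p \<in> Pos C x y" if "x \<in> Obj A" "y \<in> Obj A" "p \<in> Pos D x y" for x y p
    using h(2) bimod_hom_closed[OF bimod_mon_hom_bimod, of Y.Pc X.Pc f' x y p] that by (simp add: triple_hom_def triple_of_strat_def)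
  have d': "g' x y p \<in> Neg C x y" if "x \<in> Obj A" "y \<in> Obj A" "p \<in> Neg D x y" for x y p
    using h(2) bimod_hom_closed[OF bimod_mon_hom_bimod, of Y.Nc X.Nc g' x y p] that by (simp add: triple_hom_def triple_of_strat_def)
  have lF: "linear_map R (Hom C x y) (Hom D x y) (F x y)" "linear_map R (Hom D x y) (Hom C x y) (G x y)"
    if "x \<in> Obj A" "y \<in> Obj A" for x y
    using F(1) G(1) that by (simp_all add: strat_hom_def linear_functor_def X.Obj_C Y.Obj_C)
  note inv' = inv[unfolded inverse_on_def, rule_format]
  have "G x y (F x y h) = h" if xy: "x \<in> Obj A" "y \<in> Obj A" and h: "h \<in> carrier (Hom C x y)" for x y h
    by (rule X.Hom_agree[OF xy X.HomC[OF xy] linear_map_compose[OF lF[OF xy]] linear_map_id _ h])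
      (use xy inv' in \<open>simp add: F(2) G(2) c c'\<close>)
  moreover have "F x y (G x y h) = h" if xy: "x \<in> Obj A" "y \<in> Obj A" and h: "h \<in> carrier (Hom D x y)" for x y h
    by (rule Y.Hom_agree[OF xy Y.HomC[OF xy] linear_map_compose[OF lF(2,1)[OF xy]] linear_map_id _ h])
      (use xy inv' in \<open>simp add: F(2) G(2) d d'\<close>)
  ultimately show ?thesis unfolding strat_isomorphic_def using F(1) G(1) by blast
qed

section \<open>The two round trips\<close>

text \<open>By \<open>triple_of_twisted_product\<close>, applied to the triple of \<open>C\<close>,
  the two stratified categories have isomorphic triples; \<open>triple_isomorphic_strat\<close>
  lifts this, so no functor has to be written down.\<close>

lemma twisted_product_of_triple_of_strat:
  assumes C: "stratified R A leq C"
  shows "strat_isomorphic R A (twisted_tensor_product R A (triple_of_strat R A C)) C"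
proof -
  interpret X: stratified_category R A leq C by (rule stratified_categoryI[OF C])
  interpret T: twisted R A leq "triple_of_strat R A C" by (rule twistedI[OF X.triple_of_strat_twisted])
  show ?thesis
    by (rule triple_isomorphic_strat[OF T.TC_stratified C triple_isomorphic_sym[OF X.triple_of_strat_twisted
            T.S.triple_of_strat_twisted T.triple_of_twisted_product]])
qed

text \<open>Each triple is isomorphic to the triple of its twisted tensor product, so the claim
  reduces to the comparison of stratified categories with their triples.\<close>

lemma triple_isomorphic_iff_twisted_product:
  assumes T: "twisted_triple R A leq T" and T': "twisted_triple R A leq T'"
  shows "triple_isomorphic R A T T' \<longleftrightarrow>
    strat_isomorphic R A (twisted_tensor_product R A T) (twisted_tensor_product R A T')"
proof -
  interpret X: twisted R A leq T by (rule twistedI[OF T])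
  interpret Y: twisted R A leq T' by (rule twistedI[OF T'])
  note XT = X.S.triple_of_strat_twisted and YT = Y.S.triple_of_strat_twisted
  note XX = X.triple_of_twisted_product and YY = Y.triple_of_twisted_product
  show ?thesis
  proof
    assume "triple_isomorphic R A T T'"
    then have "triple_isomorphic R A (triple_of_strat R A X.TC) (triple_of_strat R A Y.TC)"
      by (rule triple_isomorphic_trans[OF XT T YT triple_isomorphic_sym[OF T XT XX]
            triple_isomorphic_trans[OF T T' YT _ YY]])
    then show "strat_isomorphic R A X.TC Y.TC" by (rule triple_isomorphic_strat[OF X.TC_stratified Y.TC_stratified])
  next
    assume "strat_isomorphic R A X.TC Y.TC"
    then have "triple_isomorphic R A (triple_of_strat R A X.TC) (triple_of_strat R A Y.TC)"
      by (rule strat_isomorphic_triple[OF X.TC_stratified Y.TC_stratified])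
    then show "triple_isomorphic R A T T'"
      by (rule triple_isomorphic_trans[OF T YT T' triple_isomorphic_trans[OF T XT YT XX] triple_isomorphic_sym[OF T' YT YY]])
  qed
qed

end

text \<open>A bijection up to isomorphism is spelled out as follows: both constructions are defined
  on objects, both preserve and reflect isomorphism, and they are mutually inverse up to
  isomorphism. The type of a twisted tensor product differs from that of its factors, so isomorphism
  relates structures over different types, which a bijection between classes within one type would
  not express.\<close>

theorem theorem2p2:
  fixes R :: "('k, 'r) ring_scheme"
    and A :: "('o, 'k, 'a, 'z) lincat_scheme"
    and leq :: "'o \<Rightarrow> 'o \<Rightarrow> bool"
  assumes "cring R" and "base_category R A leq"
  shows
    "(\<forall>C :: ('o, 'k, 'a, 'm) strat.
        stratified R A leq C \<longrightarrow> twisted_triple R A leq (triple_of_strat R A C)) \<and>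
     (\<forall>T :: ('o, 'k, 'a, 'p, 'n) triple.
        twisted_triple R A leq T \<longrightarrow> stratified R A leq (twisted_tensor_product R A T)) \<and>
     (\<forall>(C :: ('o, 'k, 'a, 'm) strat) (D :: ('o, 'k, 'a, 'm') strat).
        stratified R A leq C \<longrightarrow> stratified R A leq D \<longrightarrow>
        (strat_isomorphic R A C D \<longleftrightarrow>
         triple_isomorphic R A (triple_of_strat R A C) (triple_of_strat R A D))) \<and>
     (\<forall>(T :: ('o, 'k, 'a, 'p, 'n) triple) (T' :: ('o, 'k, 'a, 'p', 'n') triple).
        twisted_triple R A leq T \<longrightarrow> twisted_triple R A leq T' \<longrightarrow>
        (triple_isomorphic R A T T' \<longleftrightarrow>
         strat_isomorphic R A (twisted_tensor_product R A T) (twisted_tensor_product R A T'))) \<and>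
     (\<forall>C :: ('o, 'k, 'a, 'm) strat.
        stratified R A leq C \<longrightarrow>
        strat_isomorphic R A (twisted_tensor_product R A (triple_of_strat R A C)) C) \<and>
     (\<forall>T :: ('o, 'k, 'a, 'p, 'n) triple.
        twisted_triple R A leq T \<longrightarrow>
        triple_isomorphic R A (triple_of_strat R A (twisted_tensor_product R A T)) T)"
proof -
  interpret base_category R A leq by fact
  show ?thesis
  proof (intro conjI allI impI)
    show "twisted_triple R A leq (triple_of_strat R A C)" if "stratified R A leq C" for C :: "('o, 'k, 'a, 'm) strat"
      by (rule stratified_category.triple_of_strat_twisted[OF stratified_categoryI[OF that]])
    show "stratified R A leq (twisted_tensor_product R A T)" if "twisted_triple R A leq T" for T :: "('o, 'k, 'a, 'p, 'n) triple"
      by (rule twisted.TC_stratified[OF twistedI[OF that]])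
    show "strat_isomorphic R A C D \<longleftrightarrow> triple_isomorphic R A (triple_of_strat R A C) (triple_of_strat R A D)"
      if "stratified R A leq C" "stratified R A leq D" for C :: "('o, 'k, 'a, 'm) strat" and D :: "('o, 'k, 'a, 'm') strat"
      using strat_isomorphic_triple triple_isomorphic_strat that by blast
    show "triple_isomorphic R A T T' \<longleftrightarrow>
        strat_isomorphic R A (twisted_tensor_product R A T) (twisted_tensor_product R A T')"
      if "twisted_triple R A leq T" "twisted_triple R A leq T'"
      for T :: "('o, 'k, 'a, 'p, 'n) triple" and T' :: "('o, 'k, 'a, 'p', 'n') triple"
      by (rule triple_isomorphic_iff_twisted_product[OF that])
    show "strat_isomorphic R A (twisted_tensor_product R A (triple_of_strat R A C)) C"
      if "stratified R A leq C" for C :: "('o, 'k, 'a, 'm) strat"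
      by (rule twisted_product_of_triple_of_strat[OF that])
    show "triple_isomorphic R A (triple_of_strat R A (twisted_tensor_product R A T)) T"
      if T: "twisted_triple R A leq T" for T :: "('o, 'k, 'a, 'p, 'n) triple"
    proof -
      interpret X: twisted R A leq T by (rule twistedI[OF T])
      show ?thesis
        by (rule triple_isomorphic_sym[OF T X.S.triple_of_strat_twisted X.triple_of_twisted_product])
    qed
  qed
qed

end
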